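(* (Preservation of equality by CPS.) For every type-variable context $\Delta$, terms $e_1,e_2$, type $H$ and effect $\varepsilon\in\{n,\tau\}$ of the language $\mathrm{DM}$: if $\Delta\mid\cdot\vdash e_1=e_2:H\,!\,\varepsilon$ then $\underline\Delta\models e_1^\star==e_2^\star$.
   Context: **The language $\mathrm{DM}$.** Effects $\epsilon\in\{n,\tau\}$ ($n$ non-effectful, $\tau$ an abstract monad). Types: $A::=X\mid b\mid A\xrightarrow{n}A\mid A+A\mid A\times A$; $H::=A\mid C$; $C::=H\xrightarrow{\tau}A\mid H\xrightarrow{n}C\mid C\times C$, where $X$ ranges over type variables and $b$ over base types. Terms: $e::=x\mid e\,e\mid\lambda x{:}H.e\mid\kappa(e,\dots,e)\mid(e,e)\mid\mathbf{fst}(e)\mid\mathbf{snd}(e)\mid\mathbf{inl}(e)\mid\mathbf{inr}(e)\mid\mathbf{case}\,e\,\mathbf{inl}\,x{:}A.e;\mathbf{inr}\,y{:}A.e\mid\mathbf{return}_\tau\,e\mid\mathbf{bind}_\tau\,e\,\mathbf{to}\,x\,\mathbf{in}\,e$, with $\kappa$ constants. Judgments are $\Delta\mid\Gamma\vdash e:H\,!\,n$ and $\Delta\mid\Gamma\vdash e:A\,!\,\tau$; $\Delta$ is a finite sequence of type variables, $\Gamma$ a list of bindings $x{:}H$ with distinct variables and types over $\Delta$ ($\cdot$ is the empty list). All types appearing in rules must be well formed by the grammar. Rules: variables ($x{:}H\in\Gamma$ gives $x:H!n$); constants ($\kappa:b_1,\dots,b_n\to b$ and $e_i:b_i!n$ give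 $\kappa(e_1,\dots,e_n):b!n$); $\Gamma,x{:}H\vdash e:H'!\epsilon$ gives $\lambda x{:}H.e:H\xrightarrow{\epsilon}H'\,!\,n$; $f:H\xrightarrow{\epsilon}H'!n$ and $e:H!n$ give $f\,e:H'!\epsilon$; $e:H!n$, $e':H'!n$ give $(e,e'):H\times H'!n$; projections from $e:H\times H'!n$ have effect $n$; $e:A!n$ gives $\mathbf{inl}(e):A+A'!n$ (similarly $\mathbf{inr}$); $e:A+A'!n$, $\Gamma,x{:}A\vdash e_1:H!\epsilon$, $\Gamma,y{:}A'\vdash e_2:H!\epsilon$ give $\mathbf{case}\,e\,\mathbf{inl}\,x{:}A.e_1;\mathbf{inr}\,y{:}A'.e_2:H!\epsilon$; $e:A!n$ gives $\mathbf{return}_\tau\,e:A!\tau$; $e_1:A!\tau$ and $\Gamma,x{:}A\vdash e_2:A'!\tau$ give $\mathbf{bind}_\tau\,e_1\,\mathbf{to}\,x\,\mathbf{in}\,e_2:A'!\tau$. **Equality judgment $\Delta\mid\Gamma\vdash e=e':H!\varepsilon$** on well-typed $\mathrm{DM}$ terms: the least congruence (equivalence relation, with a congruence rule for every term construct) containing, for well-typed instances: $(\lambda x{:}H.e_1)\,e_2=e_1[e_2/x]$; $\lambda x{:}H.\,e\,x=e$ for $e:H\xrightarrow{\varepsilon}H'!n$, $x\notin FV(e)$; the computation rules for $\mathbf{fst},\mathbf{snd}$ on pairs and $\mathbf{case}$ on $\mathbf{inl},\mathbf{inr}$; $(\mathbf{fst}(e),\mathbf{snd}(e))=e$; $\mathbf{case}\,e\,\mathbf{inl}\,x.\mathbf{inl}(x);\mathbf{inr}\,x.\mathbf{inr}(x)=e$;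 and the monad laws $\mathbf{bind}_\tau\,m\,\mathbf{to}\,x\,\mathbf{in}\,(\mathbf{return}_\tau\,x)=m$ for $m:A!\tau$; $\mathbf{bind}_\tau\,(\mathbf{return}_\tau\,e)\,\mathbf{to}\,x\,\mathbf{in}\,f\,x=f\,e$ for $e:A!n$, $f:A\xrightarrow{\tau}A'!n$, $x\notin FV(f)$; $\mathbf{bind}_\tau\,(\mathbf{bind}_\tau\,m\,\mathbf{to}\,x\,\mathbf{in}\,e_1)\,\mathbf{to}\,y\,\mathbf{in}\,e_2=\mathbf{bind}_\tau\,m\,\mathbf{to}\,x\,\mathbf{in}\,(\mathbf{bind}_\tau\,e_1\,\mathbf{to}\,y\,\mathbf{in}\,e_2)$ for $m:A!\tau$, $\Gamma,x{:}A\vdash e_1:A'!\tau$, $\Gamma,y{:}A'\vdash e_2:A''!\tau$, $x\notin FV(e_2)$. **The $\star$-translation** into $\mathrm{EMF}^\star$. On types: $A^\star$ is $A$ with every $\xrightarrow{n}$ replaced by $\to$; $(H\xrightarrow{n}C)^\star=H^\star\to C^\star$; $(C\times C')^\star=C^\star\times C'^\star$; $(H\xrightarrow{\tau}A)^\star=H^\star\to(A^\star\to\mathsf{Type}_0)\to\mathsf{Type}_0$. On terms (defined over typing derivations): $(\mathbf{return}_\tau\,e)^\star=\lambda p{:}(A^\star\to\mathsf{Type}_0).\,p\,e^\star$ when $e:A!n$; $(\mathbf{bind}_\tau\,e_1\,\mathbf{to}\,x\,\mathbf{in}\,e_2)^\star=\lambda p{:}(A'^\star\to\mathsf{Type}_0).\,e_1^\star\,(\lambda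 x{:}A^\star.\,e_2^\star\,p)$ when $e_1:A!\tau$, $e_2:A'!\tau$; all other constructs homomorphically ($(\lambda x{:}H.e)^\star=\lambda x{:}H^\star.e^\star$, etc.). If $\Delta=X_1,\dots,X_m$ then $\underline\Delta=X_1{:}\mathsf{Type}_0,\dots,X_m{:}\mathsf{Type}_0$. **Target and validity.** $\mathrm{EMF}^\star$ is a dependently typed $\lambda$-calculus with predicative universes $\mathsf{Type}_0:\mathsf{Type}_1:\cdots$; only its total fragment (functions, pairs, sums with case analysis, base types and constants of $\mathrm{DM}$) matters here. $\Gamma\models\phi$ is $\mathrm{EMF}^\star$'s validity judgment: a proof-irrelevant classical higher-order logic with the usual rules for hypotheses, connectives and quantifiers, squashed propositional equality $==$ (reflexive, symmetric, transitive, substitutive, containing $\beta\eta$-reduction, extensional on functions, with surjective pairing) and case analysis on sums. *)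

theory Defs
  imports Main
begin

text \<open>
  Both calculi use de Bruijn indices, so \<open>\<alpha>\<close>-equivalent terms are equal and the variables of a
  context are automatically distinct. A context is a list whose head is the most recent binding.
  A side condition \<open>x \<notin> FV(e)\<close> becomes a lifting of \<open>e\<close> over the binder of \<open>x\<close>.

  \<open>'b\<close> is the set of base types and \<open>'k\<close> the set of constants; a signature gives every constant
  \<open>\<kappa>\<close> the list of its argument types and its result type.
\<close>

type_synonym ('b, 'k) signature = "'k \<Rightarrow> 'b list \<times> 'b"


section \<open>The language DM\<close>

datatype eff = NonEff | Tau

text \<open>
  Raw types: \<open>A\<close>, \<open>C\<close> and \<open>H\<close> of the grammar are carved out by the predicates below.
  Types have no binders, so a type variable context \<open>\<Delta>\<close> is given by its length \<open>D\<close> and \<open>DTVar i\<close>,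
  for \<open>i < D\<close>, is one of its variables.
\<close>

datatype 'b dty =
    DTVar nat
  | DBase 'b
  | DArr eff "'b dty" "'b dty"
  | DSum "'b dty" "'b dty"
  | DProd "'b dty" "'b dty"

fun is_A :: "nat \<Rightarrow> 'b dty \<Rightarrow> bool" where
  "is_A D (DTVar i) = (i < D)"
| "is_A D (DBase b) = True"
| "is_A D (DArr NonEff A A') = (is_A D A \<and> is_A D A')"
| "is_A D (DArr Tau A A') = False"
| "is_A D (DSum A A') = (is_A D A \<and> is_A D A')"
| "is_A D (DProd A A') = (is_A D A \<and> is_A D A')"

fun is_C :: "nat \<Rightarrow> 'b dty \<Rightarrow> bool" where
  "is_C D (DTVar i) = False"
| "is_C D (DBase b) = False"
| "is_C D (DArr Tau H A) = ((is_A D H \<or> is_C D H) \<and> is_A D A)"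
| "is_C D (DArr NonEff H C) = ((is_A D H \<or> is_C D H) \<and> is_C D C)"
| "is_C D (DSum H H') = False"
| "is_C D (DProd C C') = (is_C D C \<and> is_C D C')"

definition is_H :: "nat \<Rightarrow> 'b dty \<Rightarrow> bool" where
  "is_H D H \<longleftrightarrow> is_A D H \<or> is_C D H"

datatype ('b, 'k) dtm =
    DVar nat
  | DApp "('b, 'k) dtm" "('b, 'k) dtm"
  | DLam "'b dty" "('b, 'k) dtm"
  | DCon 'k "('b, 'k) dtm list"
  | DPair "('b, 'k) dtm" "('b, 'k) dtm"
  | DFst "('b, 'k) dtm"
  | DSnd "('b, 'k) dtm"
  | DInl "('b, 'k) dtm"
  | DInr "('b, 'k) dtm"
  | DCase "('b, 'k) dtm" "'b dty" "('b, 'k) dtm" "'b dty" "('b, 'k) dtm"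
  | DReturn "('b, 'k) dtm"
  | DBind "('b, 'k) dtm" "('b, 'k) dtm"

primrec dlift :: "nat \<Rightarrow> ('b, 'k) dtm \<Rightarrow> ('b, 'k) dtm" where
  "dlift k (DVar i) = DVar (if i < k then i else Suc i)"
| "dlift k (DApp e1 e2) = DApp (dlift k e1) (dlift k e2)"
| "dlift k (DLam H e) = DLam H (dlift (Suc k) e)"
| "dlift k (DCon c es) = DCon c (map (dlift k) es)"
| "dlift k (DPair e1 e2) = DPair (dlift k e1) (dlift k e2)"
| "dlift k (DFst e) = DFst (dlift k e)"
| "dlift k (DSnd e) = DSnd (dlift k e)"
| "dlift k (DInl e) = DInl (dlift k e)"
| "dlift k (DInr e) = DInr (dlift k e)"
| "dlift k (DCase e A e1 A' e2) =
     DCase (dlift k e) A (dlift (Suc k) e1) A' (dlift (Suc k) e2)"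
| "dlift k (DReturn e) = DReturn (dlift k e)"
| "dlift k (DBind e1 e2) = DBind (dlift k e1) (dlift (Suc k) e2)"

text \<open>\<open>dsubst k u e\<close> replaces variable \<open>k\<close> of \<open>e\<close> by \<open>u\<close> and removes it from the context.\<close>

primrec dsubst :: "nat \<Rightarrow> ('b, 'k) dtm \<Rightarrow> ('b, 'k) dtm \<Rightarrow> ('b, 'k) dtm" where
  "dsubst k u (DVar i) = (if i < k then DVar i else if i = k then u else DVar (i - 1))"
| "dsubst k u (DApp e1 e2) = DApp (dsubst k u e1) (dsubst k u e2)"
| "dsubst k u (DLam H e) = DLam H (dsubst (Suc k) (dlift 0 u) e)"
| "dsubst k u (DCon c es) = DCon c (map (dsubst k u) es)"
| "dsubst k u (DPair e1 e2) = DPair (dsubst k u e1) (dsubst k u e2)"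
| "dsubst k u (DFst e) = DFst (dsubst k u e)"
| "dsubst k u (DSnd e) = DSnd (dsubst k u e)"
| "dsubst k u (DInl e) = DInl (dsubst k u e)"
| "dsubst k u (DInr e) = DInr (dsubst k u e)"
| "dsubst k u (DCase e A e1 A' e2) =
     DCase (dsubst k u e) A (dsubst (Suc k) (dlift 0 u) e1) A' (dsubst (Suc k) (dlift 0 u) e2)"
| "dsubst k u (DReturn e) = DReturn (dsubst k u e)"
| "dsubst k u (DBind e1 e2) = DBind (dsubst k u e1) (dsubst (Suc k) (dlift 0 u) e2)"

type_synonym 'b dctx = "'b dty list"

definition dctx_wf :: "nat \<Rightarrow> 'b dctx \<Rightarrow> bool" where
  "dctx_wf D G \<longleftrightarrow> (\<forall>H \<in> set G. is_H D H)"

text \<open>\<open>dm_typing S D G e H \<epsilon>\<close> is the judgment \<open>\<Delta> | \<Gamma> \<turnstile> e : H ! \<epsilon>\<close>.\<close>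

inductive dm_typing ::
  "('b, 'k) signature \<Rightarrow> nat \<Rightarrow> 'b dctx \<Rightarrow> ('b, 'k) dtm \<Rightarrow> 'b dty \<Rightarrow> eff \<Rightarrow> bool"
  for S :: "('b, 'k) signature" and D :: nat
where
  dt_var: "\<lbrakk> dctx_wf D G; i < length G; H = G ! i \<rbrakk> \<Longrightarrow> dm_typing S D G (DVar i) H NonEff"
| dt_con: "\<lbrakk> dctx_wf D G; S c = (bs, b); length es = length bs;
            \<forall>i < length es. dm_typing S D G (es ! i) (DBase (bs ! i)) NonEff \<rbrakk>
          \<Longrightarrow> dm_typing S D G (DCon c es) (DBase b) NonEff"
| dt_lam: "\<lbrakk> is_H D (DArr eps H H'); dm_typing S D (H # G) e H' eps \<rbrakk>
          \<Longrightarrow> dm_typing S D G (DLam H e) (DArr eps H H') NonEff"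
| dt_app: "\<lbrakk> dm_typing S D G f (DArr eps H H') NonEff; dm_typing S D G e H NonEff \<rbrakk>
          \<Longrightarrow> dm_typing S D G (DApp f e) H' eps"
| dt_pair: "\<lbrakk> is_H D (DProd H H'); dm_typing S D G e H NonEff; dm_typing S D G e' H' NonEff \<rbrakk>
          \<Longrightarrow> dm_typing S D G (DPair e e') (DProd H H') NonEff"
| dt_fst: "dm_typing S D G e (DProd H H') NonEff \<Longrightarrow> dm_typing S D G (DFst e) H NonEff"
| dt_snd: "dm_typing S D G e (DProd H H') NonEff \<Longrightarrow> dm_typing S D G (DSnd e) H' NonEff"
| dt_inl: "\<lbrakk> is_A D (DSum A A'); dm_typing S D G e A NonEff \<rbrakk>
          \<Longrightarrow> dm_typing S D G (DInl e) (DSum A A') NonEff"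
| dt_inr: "\<lbrakk> is_A D (DSum A A'); dm_typing S D G e A' NonEff \<rbrakk>
          \<Longrightarrow> dm_typing S D G (DInr e) (DSum A A') NonEff"
| dt_case: "\<lbrakk> dm_typing S D G e (DSum A A') NonEff; dm_typing S D (A # G) e1 H eps;
             dm_typing S D (A' # G) e2 H eps \<rbrakk>
          \<Longrightarrow> dm_typing S D G (DCase e A e1 A' e2) H eps"
| dt_return: "\<lbrakk> is_A D A; dm_typing S D G e A NonEff \<rbrakk> \<Longrightarrow> dm_typing S D G (DReturn e) A Tau"
| dt_bind: "\<lbrakk> is_A D A; is_A D A'; dm_typing S D G e1 A Tau; dm_typing S D (A # G) e2 A' Tau \<rbrakk>
          \<Longrightarrow> dm_typing S D G (DBind e1 e2) A' Tau"

text \<open>\<open>dm_eq S D G e e' H \<epsilon>\<close> is the judgment \<open>\<Delta> | \<Gamma> \<turnstile> e = e' : H ! \<epsilon>\<close>.\<close>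

inductive dm_eq ::
  "('b, 'k) signature \<Rightarrow> nat \<Rightarrow> 'b dctx \<Rightarrow> ('b, 'k) dtm \<Rightarrow> ('b, 'k) dtm \<Rightarrow> 'b dty \<Rightarrow> eff \<Rightarrow> bool"
  for S :: "('b, 'k) signature" and D :: nat
where
  de_refl: "dm_typing S D G e H eps \<Longrightarrow> dm_eq S D G e e H eps"
| de_sym: "dm_eq S D G e e' H eps \<Longrightarrow> dm_eq S D G e' e H eps"
| de_trans: "\<lbrakk> dm_eq S D G e e' H eps; dm_eq S D G e' e'' H eps \<rbrakk> \<Longrightarrow> dm_eq S D G e e'' H eps"
  (* congruence; for variables it is an instance of reflexivity *)
| de_con: "\<lbrakk> dctx_wf D G; S c = (bs, b); length es = length bs; length es' = length bs;
            \<forall>i < length bs. dm_eq S D G (es ! i) (es' ! i) (DBase (bs ! i)) NonEff \<rbrakk>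
          \<Longrightarrow> dm_eq S D G (DCon c es) (DCon c es') (DBase b) NonEff"
| de_lam: "\<lbrakk> is_H D (DArr eps H H'); dm_eq S D (H # G) e e' H' eps \<rbrakk>
          \<Longrightarrow> dm_eq S D G (DLam H e) (DLam H e') (DArr eps H H') NonEff"
| de_app: "\<lbrakk> dm_eq S D G f f' (DArr eps H H') NonEff; dm_eq S D G e e' H NonEff \<rbrakk>
          \<Longrightarrow> dm_eq S D G (DApp f e) (DApp f' e') H' eps"
| de_pair: "\<lbrakk> is_H D (DProd H H'); dm_eq S D G e1 e1' H NonEff; dm_eq S D G e2 e2' H' NonEff \<rbrakk>
          \<Longrightarrow> dm_eq S D G (DPair e1 e2) (DPair e1' e2') (DProd H H') NonEff"
| de_fst: "dm_eq S D G e e' (DProd H H') NonEff \<Longrightarrow> dm_eq S D G (DFst e) (DFst e') H NonEff"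
| de_snd: "dm_eq S D G e e' (DProd H H') NonEff \<Longrightarrow> dm_eq S D G (DSnd e) (DSnd e') H' NonEff"
| de_inl: "\<lbrakk> is_A D (DSum A A'); dm_eq S D G e e' A NonEff \<rbrakk>
          \<Longrightarrow> dm_eq S D G (DInl e) (DInl e') (DSum A A') NonEff"
| de_inr: "\<lbrakk> is_A D (DSum A A'); dm_eq S D G e e' A' NonEff \<rbrakk>
          \<Longrightarrow> dm_eq S D G (DInr e) (DInr e') (DSum A A') NonEff"
| de_case: "\<lbrakk> dm_eq S D G e e' (DSum A A') NonEff; dm_eq S D (A # G) e1 e1' H eps;
             dm_eq S D (A' # G) e2 e2' H eps \<rbrakk>
          \<Longrightarrow> dm_eq S D G (DCase e A e1 A' e2) (DCase e' A e1' A' e2') H eps"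
| de_return: "\<lbrakk> is_A D A; dm_eq S D G e e' A NonEff \<rbrakk>
          \<Longrightarrow> dm_eq S D G (DReturn e) (DReturn e') A Tau"
| de_bind: "\<lbrakk> is_A D A; is_A D A'; dm_eq S D G e1 e1' A Tau; dm_eq S D (A # G) e2 e2' A' Tau \<rbrakk>
          \<Longrightarrow> dm_eq S D G (DBind e1 e2) (DBind e1' e2') A' Tau"
  (* functions *)
| de_beta: "\<lbrakk> is_H D (DArr eps H H'); dm_typing S D (H # G) e1 H' eps; dm_typing S D G e2 H NonEff \<rbrakk>
          \<Longrightarrow> dm_eq S D G (DApp (DLam H e1) e2) (dsubst 0 e2 e1) H' eps"
| de_eta: "dm_typing S D G e (DArr eps H H') NonEff
          \<Longrightarrow> dm_eq S D G (DLam H (DApp (dlift 0 e) (DVar 0))) e (DArr eps H H') NonEff"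
  (* products and sums *)
| de_fst_pair: "\<lbrakk> is_H D (DProd H H'); dm_typing S D G e1 H NonEff; dm_typing S D G e2 H' NonEff \<rbrakk>
          \<Longrightarrow> dm_eq S D G (DFst (DPair e1 e2)) e1 H NonEff"
| de_snd_pair: "\<lbrakk> is_H D (DProd H H'); dm_typing S D G e1 H NonEff; dm_typing S D G e2 H' NonEff \<rbrakk>
          \<Longrightarrow> dm_eq S D G (DSnd (DPair e1 e2)) e2 H' NonEff"
| de_surj_pair: "dm_typing S D G e (DProd H H') NonEff
          \<Longrightarrow> dm_eq S D G (DPair (DFst e) (DSnd e)) e (DProd H H') NonEff"
| de_case_inl: "\<lbrakk> is_A D (DSum A A'); dm_typing S D G e A NonEff;
             dm_typing S D (A # G) e1 H eps; dm_typing S D (A' # G) e2 H eps \<rbrakk>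
          \<Longrightarrow> dm_eq S D G (DCase (DInl e) A e1 A' e2) (dsubst 0 e e1) H eps"
| de_case_inr: "\<lbrakk> is_A D (DSum A A'); dm_typing S D G e A' NonEff;
             dm_typing S D (A # G) e1 H eps; dm_typing S D (A' # G) e2 H eps \<rbrakk>
          \<Longrightarrow> dm_eq S D G (DCase (DInr e) A e1 A' e2) (dsubst 0 e e2) H eps"
| de_case_eta: "dm_typing S D G e (DSum A A') NonEff
          \<Longrightarrow> dm_eq S D G (DCase e A (DInl (DVar 0)) A' (DInr (DVar 0))) e (DSum A A') NonEff"
  (* monad laws *)
| de_bind_return: "\<lbrakk> is_A D A; dm_typing S D G m A Tau \<rbrakk>
          \<Longrightarrow> dm_eq S D G (DBind m (DReturn (DVar 0))) m A Tau"
| de_return_bind: "\<lbrakk> is_A D A; is_A D A'; dm_typing S D G e A NonEff;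
             dm_typing S D G f (DArr Tau A A') NonEff \<rbrakk>
          \<Longrightarrow> dm_eq S D G (DBind (DReturn e) (DApp (dlift 0 f) (DVar 0))) (DApp f e) A' Tau"
| de_bind_assoc: "\<lbrakk> is_A D A; is_A D A'; is_A D A''; dm_typing S D G m A Tau;
             dm_typing S D (A # G) e1 A' Tau; dm_typing S D (A' # G) e2 A'' Tau \<rbrakk>
          \<Longrightarrow> dm_eq S D G (DBind (DBind m e1) e2) (DBind m (DBind e1 (dlift (Suc 0) e2))) A'' Tau"


section \<open>The total fragment of EMF*\<close>

text \<open>
  Terms, types and formulas form one syntactic class. \<open>EPi\<close>, \<open>ELam\<close>, \<open>EAll\<close> and \<open>EEx\<close> bind
  variable 0 in their last argument, \<open>ECase e t e1 t' e2\<close> binds it in \<open>e1\<close> and in \<open>e2\<close>.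
  \<open>EEq t e e'\<close> is \<open>e == e'\<close> with its implicit type argument \<open>t\<close>.
\<close>

datatype ('b, 'k) etm =
    EVar nat
  | EType nat
  | EBase 'b
  | EPi "('b, 'k) etm" "('b, 'k) etm"
  | ESum "('b, 'k) etm" "('b, 'k) etm"
  | EProd "('b, 'k) etm" "('b, 'k) etm"
  | ELam "('b, 'k) etm" "('b, 'k) etm"
  | EApp "('b, 'k) etm" "('b, 'k) etm"
  | ECon 'k "('b, 'k) etm list"
  | EPair "('b, 'k) etm" "('b, 'k) etm"
  | EFst "('b, 'k) etm"
  | ESnd "('b, 'k) etm"
  | EInl "('b, 'k) etm"
  | EInr "('b, 'k) etm"
  | ECase "('b, 'k) etm" "('b, 'k) etm" "('b, 'k) etm" "('b, 'k) etm" "('b, 'k) etm"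
  | ETrue
  | EFalse
  | EAnd "('b, 'k) etm" "('b, 'k) etm"
  | EOr "('b, 'k) etm" "('b, 'k) etm"
  | EImp "('b, 'k) etm" "('b, 'k) etm"
  | EAll "('b, 'k) etm" "('b, 'k) etm"
  | EEx "('b, 'k) etm" "('b, 'k) etm"
  | EEq "('b, 'k) etm" "('b, 'k) etm" "('b, 'k) etm"

primrec elift :: "nat \<Rightarrow> ('b, 'k) etm \<Rightarrow> ('b, 'k) etm" where
  "elift k (EVar i) = EVar (if i < k then i else Suc i)"
| "elift k (EType n) = EType n"
| "elift k (EBase b) = EBase b"
| "elift k (EPi t t') = EPi (elift k t) (elift (Suc k) t')"
| "elift k (ESum t t') = ESum (elift k t) (elift k t')"
| "elift k (EProd t t') = EProd (elift k t) (elift k t')"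
| "elift k (ELam t e) = ELam (elift k t) (elift (Suc k) e)"
| "elift k (EApp e1 e2) = EApp (elift k e1) (elift k e2)"
| "elift k (ECon c es) = ECon c (map (elift k) es)"
| "elift k (EPair e1 e2) = EPair (elift k e1) (elift k e2)"
| "elift k (EFst e) = EFst (elift k e)"
| "elift k (ESnd e) = ESnd (elift k e)"
| "elift k (EInl e) = EInl (elift k e)"
| "elift k (EInr e) = EInr (elift k e)"
| "elift k (ECase e t e1 t' e2) =
     ECase (elift k e) (elift k t) (elift (Suc k) e1) (elift k t') (elift (Suc k) e2)"
| "elift k ETrue = ETrue"
| "elift k EFalse = EFalse"
| "elift k (EAnd p q) = EAnd (elift k p) (elift k q)"
| "elift k (EOr p q) = EOr (elift k p) (elift k q)"
| "elift k (EImp p q) = EImp (elift k p) (elift k q)"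
| "elift k (EAll t p) = EAll (elift k t) (elift (Suc k) p)"
| "elift k (EEx t p) = EEx (elift k t) (elift (Suc k) p)"
| "elift k (EEq t e1 e2) = EEq (elift k t) (elift k e1) (elift k e2)"

primrec esubst :: "nat \<Rightarrow> ('b, 'k) etm \<Rightarrow> ('b, 'k) etm \<Rightarrow> ('b, 'k) etm" where
  "esubst k u (EVar i) = (if i < k then EVar i else if i = k then u else EVar (i - 1))"
| "esubst k u (EType n) = EType n"
| "esubst k u (EBase b) = EBase b"
| "esubst k u (EPi t t') = EPi (esubst k u t) (esubst (Suc k) (elift 0 u) t')"
| "esubst k u (ESum t t') = ESum (esubst k u t) (esubst k u t')"
| "esubst k u (EProd t t') = EProd (esubst k u t) (esubst k u t')"
| "esubst k u (ELam t e) = ELam (esubst k u t) (esubst (Suc k) (elift 0 u) e)"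
| "esubst k u (EApp e1 e2) = EApp (esubst k u e1) (esubst k u e2)"
| "esubst k u (ECon c es) = ECon c (map (esubst k u) es)"
| "esubst k u (EPair e1 e2) = EPair (esubst k u e1) (esubst k u e2)"
| "esubst k u (EFst e) = EFst (esubst k u e)"
| "esubst k u (ESnd e) = ESnd (esubst k u e)"
| "esubst k u (EInl e) = EInl (esubst k u e)"
| "esubst k u (EInr e) = EInr (esubst k u e)"
| "esubst k u (ECase e t e1 t' e2) =
     ECase (esubst k u e) (esubst k u t) (esubst (Suc k) (elift 0 u) e1)
       (esubst k u t') (esubst (Suc k) (elift 0 u) e2)"
| "esubst k u ETrue = ETrue"
| "esubst k u EFalse = EFalse"
| "esubst k u (EAnd p q) = EAnd (esubst k u p) (esubst k u q)"
| "esubst k u (EOr p q) = EOr (esubst k u p) (esubst k u q)"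
| "esubst k u (EImp p q) = EImp (esubst k u p) (esubst k u q)"
| "esubst k u (EAll t p) = EAll (esubst k u t) (esubst (Suc k) (elift 0 u) p)"
| "esubst k u (EEx t p) = EEx (esubst k u t) (esubst (Suc k) (elift 0 u) p)"
| "esubst k u (EEq t e1 e2) = EEq (esubst k u t) (esubst k u e1) (esubst k u e2)"

text \<open>Non-dependent function type.\<close>

definition EFun :: "('b, 'k) etm \<Rightarrow> ('b, 'k) etm \<Rightarrow> ('b, 'k) etm" where
  "EFun t t' = EPi t (elift 0 t')"

text \<open>
  Variable 0 of \<open>p\<close> specialised to \<open>inl x\<close> (\<open>inr x\<close>), where \<open>x\<close> is the new variable 0 of the result.
\<close>

definition at_inl :: "('b, 'k) etm \<Rightarrow> ('b, 'k) etm" where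
  "at_inl p = esubst 0 (EInl (EVar 0)) (elift (Suc 0) p)"

definition at_inr :: "('b, 'k) etm \<Rightarrow> ('b, 'k) etm" where
  "at_inr p = esubst 0 (EInr (EVar 0)) (elift (Suc 0) p)"

type_synonym ('b, 'k) ectx = "('b, 'k) etm list"

text \<open>
  \<open>emf_wf S G\<close> says that \<open>G\<close> is a well-formed context, \<open>emf_typing S G e t\<close> is \<open>\<Gamma> \<turnstile> e : t\<close> and
  \<open>emf_valid S G p\<close> is \<open>\<Gamma> \<Turnstile> \<phi>\<close>. The type \<open>G ! i\<close> lives in the part of the context below
  it. Formulas are the terms of type \<open>Type\<^sub>0\<close>; a logical hypothesis is a variable \<open>h : \<phi>\<close> of the
  context, and validity carries no proof terms. Types are converted along valid equalities.
  The typing premises of the validity rules cannot be dropped: untyped \<open>\<beta>\<close>-equality would make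
  the logic inconsistent.
\<close>

inductive
  emf_wf :: "('b, 'k) signature \<Rightarrow> ('b, 'k) ectx \<Rightarrow> bool" and
  emf_typing :: "('b, 'k) signature \<Rightarrow> ('b, 'k) ectx \<Rightarrow> ('b, 'k) etm \<Rightarrow> ('b, 'k) etm \<Rightarrow> bool" and
  emf_valid :: "('b, 'k) signature \<Rightarrow> ('b, 'k) ectx \<Rightarrow> ('b, 'k) etm \<Rightarrow> bool"
  for S :: "('b, 'k) signature"
where
  ew_nil: "emf_wf S []"
| ew_cons: "\<lbrakk> emf_wf S G; emf_typing S G t (EType n) \<rbrakk> \<Longrightarrow> emf_wf S (t # G)"

| et_var: "\<lbrakk> emf_wf S G; i < length G \<rbrakk>
          \<Longrightarrow> emf_typing S G (EVar i) ((elift 0 ^^ Suc i) (G ! i))"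
| et_type: "emf_wf S G \<Longrightarrow> emf_typing S G (EType n) (EType (Suc n))"
| et_base: "emf_wf S G \<Longrightarrow> emf_typing S G (EBase b) (EType 0)"
| et_pi: "\<lbrakk> emf_typing S G t (EType m); emf_typing S (t # G) t' (EType n) \<rbrakk>
          \<Longrightarrow> emf_typing S G (EPi t t') (EType (max m n))"
| et_sum: "\<lbrakk> emf_typing S G t (EType m); emf_typing S G t' (EType n) \<rbrakk>
          \<Longrightarrow> emf_typing S G (ESum t t') (EType (max m n))"
| et_prod: "\<lbrakk> emf_typing S G t (EType m); emf_typing S G t' (EType n) \<rbrakk>
          \<Longrightarrow> emf_typing S G (EProd t t') (EType (max m n))"
| et_lam: "\<lbrakk> emf_typing S G t (EType n); emf_typing S (t # G) e t' \<rbrakk>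
          \<Longrightarrow> emf_typing S G (ELam t e) (EPi t t')"
| et_app: "\<lbrakk> emf_typing S G f (EPi t t'); emf_typing S G e t \<rbrakk>
          \<Longrightarrow> emf_typing S G (EApp f e) (esubst 0 e t')"
| et_con: "\<lbrakk> emf_wf S G; S c = (bs, b); length es = length bs;
            \<forall>i < length es. emf_typing S G (es ! i) (EBase (bs ! i)) \<rbrakk>
          \<Longrightarrow> emf_typing S G (ECon c es) (EBase b)"
| et_pair: "\<lbrakk> emf_typing S G e t; emf_typing S G e' t' \<rbrakk>
          \<Longrightarrow> emf_typing S G (EPair e e') (EProd t t')"
| et_fst: "emf_typing S G e (EProd t t') \<Longrightarrow> emf_typing S G (EFst e) t"
| et_snd: "emf_typing S G e (EProd t t') \<Longrightarrow> emf_typing S G (ESnd e) t'"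
| et_inl: "\<lbrakk> emf_typing S G e t; emf_typing S G t' (EType n) \<rbrakk>
          \<Longrightarrow> emf_typing S G (EInl e) (ESum t t')"
| et_inr: "\<lbrakk> emf_typing S G e t'; emf_typing S G t (EType n) \<rbrakk>
          \<Longrightarrow> emf_typing S G (EInr e) (ESum t t')"
| et_case: "\<lbrakk> emf_typing S G e (ESum t t'); emf_typing S (ESum t t' # G) s (EType n);
             emf_typing S (t # G) e1 (at_inl s); emf_typing S (t' # G) e2 (at_inr s) \<rbrakk>
          \<Longrightarrow> emf_typing S G (ECase e t e1 t' e2) (esubst 0 e s)"
| et_true: "emf_wf S G \<Longrightarrow> emf_typing S G ETrue (EType 0)"
| et_false: "emf_wf S G \<Longrightarrow> emf_typing S G EFalse (EType 0)"
| et_and: "\<lbrakk> emf_typing S G p (EType 0); emf_typing S G q (EType 0) \<rbrakk>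
          \<Longrightarrow> emf_typing S G (EAnd p q) (EType 0)"
| et_or: "\<lbrakk> emf_typing S G p (EType 0); emf_typing S G q (EType 0) \<rbrakk>
          \<Longrightarrow> emf_typing S G (EOr p q) (EType 0)"
| et_imp: "\<lbrakk> emf_typing S G p (EType 0); emf_typing S G q (EType 0) \<rbrakk>
          \<Longrightarrow> emf_typing S G (EImp p q) (EType 0)"
| et_all: "\<lbrakk> emf_typing S G t (EType n); emf_typing S (t # G) p (EType 0) \<rbrakk>
          \<Longrightarrow> emf_typing S G (EAll t p) (EType 0)"
| et_ex: "\<lbrakk> emf_typing S G t (EType n); emf_typing S (t # G) p (EType 0) \<rbrakk>
          \<Longrightarrow> emf_typing S G (EEx t p) (EType 0)"
| et_eq: "\<lbrakk> emf_typing S G t (EType n); emf_typing S G e t; emf_typing S G e' t \<rbrakk>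
          \<Longrightarrow> emf_typing S G (EEq t e e') (EType 0)"
| et_conv: "\<lbrakk> emf_typing S G e t; emf_typing S G t' (EType n); emf_valid S G (EEq (EType n) t t') \<rbrakk>
          \<Longrightarrow> emf_typing S G e t'"

  (* hypotheses *)
| ev_hyp: "\<lbrakk> emf_typing S G (EVar i) p; emf_typing S G p (EType 0) \<rbrakk> \<Longrightarrow> emf_valid S G p"
  (* connectives and quantifiers *)
| ev_trueI: "emf_wf S G \<Longrightarrow> emf_valid S G ETrue"
| ev_falseE: "\<lbrakk> emf_valid S G EFalse; emf_typing S G p (EType 0) \<rbrakk> \<Longrightarrow> emf_valid S G p"
| ev_andI: "\<lbrakk> emf_valid S G p; emf_valid S G q \<rbrakk> \<Longrightarrow> emf_valid S G (EAnd p q)"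
| ev_andE1: "emf_valid S G (EAnd p q) \<Longrightarrow> emf_valid S G p"
| ev_andE2: "emf_valid S G (EAnd p q) \<Longrightarrow> emf_valid S G q"
| ev_orI1: "\<lbrakk> emf_valid S G p; emf_typing S G q (EType 0) \<rbrakk> \<Longrightarrow> emf_valid S G (EOr p q)"
| ev_orI2: "\<lbrakk> emf_valid S G q; emf_typing S G p (EType 0) \<rbrakk> \<Longrightarrow> emf_valid S G (EOr p q)"
| ev_orE: "\<lbrakk> emf_valid S G (EOr p q); emf_typing S G r (EType 0);
            emf_valid S (p # G) (elift 0 r); emf_valid S (q # G) (elift 0 r) \<rbrakk>
          \<Longrightarrow> emf_valid S G r"
| ev_impI: "\<lbrakk> emf_typing S G p (EType 0); emf_typing S G q (EType 0);
             emf_valid S (p # G) (elift 0 q) \<rbrakk>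
          \<Longrightarrow> emf_valid S G (EImp p q)"
| ev_impE: "\<lbrakk> emf_valid S G (EImp p q); emf_valid S G p \<rbrakk> \<Longrightarrow> emf_valid S G q"
| ev_allI: "\<lbrakk> emf_typing S G t (EType n); emf_valid S (t # G) p \<rbrakk> \<Longrightarrow> emf_valid S G (EAll t p)"
| ev_allE: "\<lbrakk> emf_valid S G (EAll t p); emf_typing S G e t \<rbrakk> \<Longrightarrow> emf_valid S G (esubst 0 e p)"
| ev_exI: "\<lbrakk> emf_typing S G t (EType n); emf_typing S (t # G) p (EType 0);
            emf_typing S G e t; emf_valid S G (esubst 0 e p) \<rbrakk>
          \<Longrightarrow> emf_valid S G (EEx t p)"
| ev_exE: "\<lbrakk> emf_valid S G (EEx t p); emf_typing S G r (EType 0);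
            emf_valid S (p # t # G) (elift 0 (elift 0 r)) \<rbrakk>
          \<Longrightarrow> emf_valid S G r"
| ev_classical: "emf_typing S G p (EType 0) \<Longrightarrow> emf_valid S G (EOr p (EImp p EFalse))"
  (* equality *)
| ev_refl: "\<lbrakk> emf_typing S G t (EType n); emf_typing S G e t \<rbrakk> \<Longrightarrow> emf_valid S G (EEq t e e)"
| ev_sym: "emf_valid S G (EEq t e e') \<Longrightarrow> emf_valid S G (EEq t e' e)"
| ev_trans: "\<lbrakk> emf_valid S G (EEq t e e'); emf_valid S G (EEq t e' e'') \<rbrakk>
          \<Longrightarrow> emf_valid S G (EEq t e e'')"
| ev_subst: "\<lbrakk> emf_valid S G (EEq t e e'); emf_typing S (t # G) p (EType 0);
              emf_valid S G (esubst 0 e p) \<rbrakk>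
          \<Longrightarrow> emf_valid S G (esubst 0 e' p)"
| ev_ext: "\<lbrakk> emf_typing S G f (EPi t t'); emf_typing S G g (EPi t t');
            emf_valid S (t # G) (EEq t' (EApp (elift 0 f) (EVar 0)) (EApp (elift 0 g) (EVar 0))) \<rbrakk>
          \<Longrightarrow> emf_valid S G (EEq (EPi t t') f g)"
  (* reduction *)
| ev_beta: "\<lbrakk> emf_typing S G t (EType n); emf_typing S (t # G) e1 t'; emf_typing S G e2 t \<rbrakk>
          \<Longrightarrow> emf_valid S G (EEq (esubst 0 e2 t') (EApp (ELam t e1) e2) (esubst 0 e2 e1))"
| ev_eta: "emf_typing S G e (EPi t t')
          \<Longrightarrow> emf_valid S G (EEq (EPi t t') (ELam t (EApp (elift 0 e) (EVar 0))) e)"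
| ev_fst_pair: "\<lbrakk> emf_typing S G e1 t; emf_typing S G e2 t' \<rbrakk>
          \<Longrightarrow> emf_valid S G (EEq t (EFst (EPair e1 e2)) e1)"
| ev_snd_pair: "\<lbrakk> emf_typing S G e1 t; emf_typing S G e2 t' \<rbrakk>
          \<Longrightarrow> emf_valid S G (EEq t' (ESnd (EPair e1 e2)) e2)"
| ev_surj_pair: "emf_typing S G e (EProd t t')
          \<Longrightarrow> emf_valid S G (EEq (EProd t t') (EPair (EFst e) (ESnd e)) e)"
| ev_case_inl: "\<lbrakk> emf_typing S G e t; emf_typing S (ESum t t' # G) s (EType n);
             emf_typing S (t # G) e1 (at_inl s); emf_typing S (t' # G) e2 (at_inr s) \<rbrakk>
          \<Longrightarrow> emf_valid S G (EEq (esubst 0 (EInl e) s) (ECase (EInl e) t e1 t' e2) (esubst 0 e e1))"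
| ev_case_inr: "\<lbrakk> emf_typing S G e t'; emf_typing S (ESum t t' # G) s (EType n);
             emf_typing S (t # G) e1 (at_inl s); emf_typing S (t' # G) e2 (at_inr s) \<rbrakk>
          \<Longrightarrow> emf_valid S G (EEq (esubst 0 (EInr e) s) (ECase (EInr e) t e1 t' e2) (esubst 0 e e2))"
  (* equality under the binders of types and formulas, which ev_subst does not reach *)
| ev_pi_cong: "\<lbrakk> emf_valid S G (EEq (EType m) t s); emf_typing S (s # G) s' (EType n);
             emf_valid S (t # G) (EEq (EType n) t' s') \<rbrakk>
          \<Longrightarrow> emf_valid S G (EEq (EType (max m n)) (EPi t t') (EPi s s'))"
| ev_all_cong: "\<lbrakk> emf_valid S G (EEq (EType m) t s); emf_typing S (s # G) q (EType 0);
             emf_valid S (t # G) (EEq (EType 0) p q) \<rbrakk>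
          \<Longrightarrow> emf_valid S G (EEq (EType 0) (EAll t p) (EAll s q))"
| ev_ex_cong: "\<lbrakk> emf_valid S G (EEq (EType m) t s); emf_typing S (s # G) q (EType 0);
             emf_valid S (t # G) (EEq (EType 0) p q) \<rbrakk>
          \<Longrightarrow> emf_valid S G (EEq (EType 0) (EEx t p) (EEx s q))"
  (* case analysis on sums *)
| ev_sum_cases: "\<lbrakk> emf_typing S G e (ESum t t'); emf_typing S (ESum t t' # G) p (EType 0);
             emf_valid S (t # G) (at_inl p); emf_valid S (t' # G) (at_inr p) \<rbrakk>
          \<Longrightarrow> emf_valid S G (esubst 0 e p)"


section \<open>The star translation\<close>

text \<open>
  A term variable context \<open>\<Gamma>\<close> of length \<open>k\<close> is placed on top of the type variables, so that
  \<open>DTVar i\<close> is variable \<open>k + i\<close> of the target.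
\<close>

definition wp_ty :: "('b, 'k) etm \<Rightarrow> ('b, 'k) etm" where
  "wp_ty t = EFun (EFun t (EType 0)) (EType 0)"

fun star_ty :: "nat \<Rightarrow> 'b dty \<Rightarrow> ('b, 'k) etm" where
  "star_ty k (DTVar i) = EVar (k + i)"
| "star_ty k (DBase b) = EBase b"
| "star_ty k (DArr NonEff H H') = EFun (star_ty k H) (star_ty k H')"
| "star_ty k (DArr Tau H A) = EFun (star_ty k H) (wp_ty (star_ty k A))"
| "star_ty k (DSum A A') = ESum (star_ty k A) (star_ty k A')"
| "star_ty k (DProd H H') = EProd (star_ty k H) (star_ty k H')"

text \<open>The type of the translation of a term \<open>e : H ! \<epsilon>\<close>.\<close>

definition star_comp_ty :: "nat \<Rightarrow> 'b dty \<Rightarrow> eff \<Rightarrow> ('b, 'k) etm" where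
  "star_comp_ty k H eps = (case eps of NonEff \<Rightarrow> star_ty k H | Tau \<Rightarrow> wp_ty (star_ty k H))"

definition star_tctx :: "nat \<Rightarrow> ('b, 'k) ectx" where
  "star_tctx D = replicate D (EType 0)"

text \<open>
  The translation is defined over typing derivations, and a typing judgment may have several of
  them, since the injections and \<open>bind\<close> carry no type annotation. \<open>dm_star S D G e H \<epsilon> t\<close> says
  that some derivation of \<open>\<Delta> | \<Gamma> \<turnstile> e : H ! \<epsilon>\<close> is translated to \<open>t\<close>.
\<close>

inductive dm_star ::
  "('b, 'k) signature \<Rightarrow> nat \<Rightarrow> 'b dctx \<Rightarrow> ('b, 'k) dtm \<Rightarrow> 'b dty \<Rightarrow> eff \<Rightarrow> ('b, 'k) etm \<Rightarrow> bool"
  for S :: "('b, 'k) signature" and D :: nat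
where
  ds_var: "\<lbrakk> dctx_wf D G; i < length G; H = G ! i \<rbrakk> \<Longrightarrow> dm_star S D G (DVar i) H NonEff (EVar i)"
| ds_con: "\<lbrakk> dctx_wf D G; S c = (bs, b); length es = length bs; length ts = length bs;
            \<forall>i < length es. dm_star S D G (es ! i) (DBase (bs ! i)) NonEff (ts ! i) \<rbrakk>
          \<Longrightarrow> dm_star S D G (DCon c es) (DBase b) NonEff (ECon c ts)"
| ds_lam: "\<lbrakk> is_H D (DArr eps H H'); dm_star S D (H # G) e H' eps t \<rbrakk>
          \<Longrightarrow> dm_star S D G (DLam H e) (DArr eps H H') NonEff (ELam (star_ty (length G) H) t)"
| ds_app: "\<lbrakk> dm_star S D G f (DArr eps H H') NonEff t; dm_star S D G e H NonEff u \<rbrakk>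
          \<Longrightarrow> dm_star S D G (DApp f e) H' eps (EApp t u)"
| ds_pair: "\<lbrakk> is_H D (DProd H H'); dm_star S D G e H NonEff t; dm_star S D G e' H' NonEff t' \<rbrakk>
          \<Longrightarrow> dm_star S D G (DPair e e') (DProd H H') NonEff (EPair t t')"
| ds_fst: "dm_star S D G e (DProd H H') NonEff t \<Longrightarrow> dm_star S D G (DFst e) H NonEff (EFst t)"
| ds_snd: "dm_star S D G e (DProd H H') NonEff t \<Longrightarrow> dm_star S D G (DSnd e) H' NonEff (ESnd t)"
| ds_inl: "\<lbrakk> is_A D (DSum A A'); dm_star S D G e A NonEff t \<rbrakk>
          \<Longrightarrow> dm_star S D G (DInl e) (DSum A A') NonEff (EInl t)"
| ds_inr: "\<lbrakk> is_A D (DSum A A'); dm_star S D G e A' NonEff t \<rbrakk>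
          \<Longrightarrow> dm_star S D G (DInr e) (DSum A A') NonEff (EInr t)"
| ds_case: "\<lbrakk> dm_star S D G e (DSum A A') NonEff t; dm_star S D (A # G) e1 H eps t1;
             dm_star S D (A' # G) e2 H eps t2 \<rbrakk>
          \<Longrightarrow> dm_star S D G (DCase e A e1 A' e2) H eps
                (ECase t (star_ty (length G) A) t1 (star_ty (length G) A') t2)"
| ds_return: "\<lbrakk> is_A D A; dm_star S D G e A NonEff t \<rbrakk>
          \<Longrightarrow> dm_star S D G (DReturn e) A Tau
                (ELam (EFun (star_ty (length G) A) (EType 0)) (EApp (EVar 0) (elift 0 t)))"
  (* in the result p is variable 0 under its own binder and variable 1 under the binder of x,
     and t2 is moved from the context x, G to the context x, p, G *)
| ds_bind: "\<lbrakk> is_A D A; is_A D A'; dm_star S D G e1 A Tau t1; dm_star S D (A # G) e2 A' Tau t2 \<rbrakk>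
          \<Longrightarrow> dm_star S D G (DBind e1 e2) A' Tau
                (ELam (EFun (star_ty (length G) A') (EType 0))
                  (EApp (elift 0 t1)
                    (ELam (star_ty (Suc (length G)) A) (EApp (elift (Suc 0) t2) (EVar (Suc 0))))))"

lemma dm_typing_iff_star: "dm_typing S D G e H eps \<longleftrightarrow> (\<exists>t. dm_star S D G e H eps t)"
proof
  assume "dm_typing S D G e H eps"
  then show "\<exists>t. dm_star S D G e H eps t"
  proof (induction rule: dm_typing.induct)
    case (dt_con G c bs b es)
    then obtain f where
      "\<forall>i < length es. dm_star S D G (es ! i) (DBase (bs ! i)) NonEff (f i)" by metis
    then have "dm_star S D G (DCon c es) (DBase b) NonEff (ECon c (map f [0..<length es]))"
      using dt_con by (intro ds_con) auto
    then show ?case ..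
  qed (blast intro: dm_star.intros)+
next
  assume "\<exists>t. dm_star S D G e H eps t"
  then obtain t where "dm_star S D G e H eps t" ..
  then show "dm_typing S D G e H eps"
    by (induction rule: dm_star.induct) (auto intro: dm_typing.intros)
qed

end

(* A term may have several translations, because bind does not record the type of the value it
   passes on and the injections leave one summand free. So besides checking that every equation of
   DM becomes an EMF* equation (the monad laws are the laws of the continuation monad of predicates,
   and hold by beta, eta and functional extensionality), one has to show that any two translations
   of a term are equal. This goes by a logical relation, written as an EMF* formula, between the
   translations of a term at two possibly different types; at equal types the relation is equality. *)

theory Submission
  imports Defs
begin

section \<open>Renamings\<close>

text \<open>Coherence cannot be proved as plain equality by induction: two derivations of a
  \<open>bind\<close> may give the bound variable types \<open>A\<close> and \<open>A'\<close>, so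
  the translated bodies live in different contexts and the induction hypothesis must speak about
  distinct types. The relation is a formula and not a metalevel predicate because the relatedness of
  the two bound variables, and of two continuations, has to become a hypothesis of the logic. Both
  translations are then renamed into one context that holds both variables and this hypothesis.
  Taking \<open>EFalse\<close> at function types with distinct domains, or at types of distinct
  shape, is harmless: annotated abstractions have equal domains, annotated scrutinees have equal
  types, and a non-effectful term acquires such a pair of types only where the hypotheses are
  already contradictory. Coherence enters at transitivity, where the middle term may carry two
  translations, and once more at the end, where arbitrary translations are compared.\<close>

definition upr :: "(nat \<Rightarrow> nat) \<Rightarrow> nat \<Rightarrow> nat" where
  "upr r i = (case i of 0 \<Rightarrow> 0 | Suc j \<Rightarrow> Suc (r j))"

lemma upr_simps [simp]: "upr r 0 = 0" "upr r (Suc i) = Suc (r i)"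
  by (simp_all add: upr_def)

lemma upr_comp: "upr (r \<circ> s) = upr r \<circ> upr s"
  by (auto simp: upr_def fun_eq_iff split: nat.split)

lemma upr_id [simp]: "upr (\<lambda>i. i) = (\<lambda>i. i)"
  by (auto simp: upr_def fun_eq_iff split: nat.split)

text \<open>Liftings, and substitutions of a variable for a variable, are both renamings, so
  identities between them reduce through \<open>ren_ren\<close> to equations between functions on
  indices. Arbitrary renamings are also what carries two translations into one common
  context.\<close>

primrec ren :: "(nat \<Rightarrow> nat) \<Rightarrow> ('b, 'k) etm \<Rightarrow> ('b, 'k) etm" where
  "ren r (EVar i) = EVar (r i)"
| "ren r (EType n) = EType n"
| "ren r (EBase b) = EBase b"
| "ren r (EPi t t') = EPi (ren r t) (ren (upr r) t')"
| "ren r (ESum t t') = ESum (ren r t) (ren r t')"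
| "ren r (EProd t t') = EProd (ren r t) (ren r t')"
| "ren r (ELam t e) = ELam (ren r t) (ren (upr r) e)"
| "ren r (EApp e1 e2) = EApp (ren r e1) (ren r e2)"
| "ren r (ECon c es) = ECon c (map (ren r) es)"
| "ren r (EPair e1 e2) = EPair (ren r e1) (ren r e2)"
| "ren r (EFst e) = EFst (ren r e)"
| "ren r (ESnd e) = ESnd (ren r e)"
| "ren r (EInl e) = EInl (ren r e)"
| "ren r (EInr e) = EInr (ren r e)"
| "ren r (ECase e t e1 t' e2) =
     ECase (ren r e) (ren r t) (ren (upr r) e1) (ren r t') (ren (upr r) e2)"
| "ren r ETrue = ETrue"
| "ren r EFalse = EFalse"
| "ren r (EAnd p q) = EAnd (ren r p) (ren r q)"
| "ren r (EOr p q) = EOr (ren r p) (ren r q)"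
| "ren r (EImp p q) = EImp (ren r p) (ren r q)"
| "ren r (EAll t p) = EAll (ren r t) (ren (upr r) p)"
| "ren r (EEx t p) = EEx (ren r t) (ren (upr r) p)"
| "ren r (EEq t e1 e2) = EEq (ren r t) (ren r e1) (ren r e2)"

lemma ren_ren: "ren r (ren s t) = ren (r \<circ> s) t"
  by (induction t arbitrary: r s) (simp_all add: upr_comp)

lemma ren_id [simp]: "ren (\<lambda>i. i) t = t"
  by (induction t) (simp_all add: map_idI)

definition liftr :: "nat \<Rightarrow> nat \<Rightarrow> nat" where
  "liftr k i = (if i < k then i else Suc i)"

lemma upr_liftr: "upr (liftr k) = liftr (Suc k)"
  by (auto simp: upr_def liftr_def fun_eq_iff split: nat.split)

lemma elift_ren: "elift k t = ren (liftr k) t"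
  by (induction t arbitrary: k) (simp_all add: upr_liftr, simp_all add: liftr_def)

lemma liftr_0: "liftr 0 = Suc"
  by (auto simp: liftr_def)

lemma elift0_ren: "elift 0 t = ren Suc t"
  by (simp add: elift_ren liftr_0)

lemma ren_upr_elift0: "ren (upr r) (elift 0 t) = elift 0 (ren r t)"
  by (simp add: elift0_ren ren_ren comp_def)

lemma ren_upr_upr_elift1: "ren (upr (upr r)) (elift (Suc 0) t) = elift (Suc 0) (ren (upr r) t)"
  by (simp add: elift_ren ren_ren upr_liftr[symmetric] upr_comp[symmetric] liftr_0)
    (simp add: comp_def)

definition instr :: "nat \<Rightarrow> nat \<Rightarrow> nat \<Rightarrow> nat" where
  "instr k m i = (if i < k then i else if i = k then m else i - 1)"

lemma upr_instr: "upr (instr k m) = instr (Suc k) (Suc m)"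
  by (auto simp: upr_def instr_def fun_eq_iff split: nat.split)

lemma esubst_var_ren: "esubst k (EVar m) t = ren (instr k m) t"
  by (induction t arbitrary: k m) (simp_all add: upr_instr, simp_all add: instr_def)

lemma esubst_elift [simp]: "esubst k u (elift k t) = t"
  by (induction t arbitrary: k u) (auto simp: map_idI)

lemma elift_elift: "j \<le> k \<Longrightarrow> elift j (elift k t) = elift (Suc k) (elift j t)"
  by (induction t arbitrary: j k) auto

lemma elift_esubst:
  "j \<le> k \<Longrightarrow> elift j (esubst k u t) = esubst (Suc k) (elift j u) (elift j t)"
  by (induction t arbitrary: j k u) (auto simp: elift_elift)

lemma upr_funpow_lt: "i < k \<Longrightarrow> (upr ^^ k) r i = i"
  by (induction k arbitrary: i) (auto simp: upr_def split: nat.split)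

lemma upr_funpow_ge: "(upr ^^ k) r (k + i) = k + r i"
  by (induction k) auto

lemma upr_funpow_Suc: "upr ((upr ^^ k) r) = (upr ^^ Suc k) r"
  by simp

lemma ren_upr_funpow_elift0: "ren ((upr ^^ Suc k) r) (elift 0 t) = elift 0 (ren ((upr ^^ k) r) t)"
  by (simp add: ren_upr_elift0)

text \<open>Generalised to \<open>k\<close> crossed binders because the induction passes under them;
  the instance \<open>k = 0\<close> is the law wanted.\<close>

lemma ren_esubst_funpow:
  "ren ((upr ^^ k) r) (esubst k u t) = esubst k (ren ((upr ^^ k) r) u) (ren ((upr ^^ Suc k) r) t)"
proof (induction t arbitrary: k u)
  case (EVar i)
  \<comment> \<open>A bound index is fixed, index \<open>k\<close> is the one replaced, and a larger
    index drops by one before the outer renaming acts.\<close>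
  consider "i < k" | "i = k" | j where "i = Suc (k + j)"
    by (metis less_imp_Suc_add nat_neq_iff)
  then show ?case
  proof cases
    case 3
    then have "(upr ^^ Suc k) r i = Suc (k + r j)"
      using upr_funpow_ge[of "Suc k" r j] by simp
    then show ?thesis using 3 by (simp add: upr_funpow_ge)
  qed (use upr_funpow_lt[of i "Suc k"] in \<open>simp_all add: upr_funpow_lt\<close>)
qed (simp_all add: upr_funpow_Suc ren_upr_funpow_elift0 del: funpow.simps)

lemma ren_esubst: "ren r (esubst 0 u t) = esubst 0 (ren r u) (ren (upr r) t)"
  using ren_esubst_funpow[of 0] by simp

lemma ren_at_inl: "ren (upr r) (at_inl s) = at_inl (ren (upr r) s)"
  by (simp add: at_inl_def ren_esubst ren_upr_upr_elift1)

lemma ren_at_inr: "ren (upr r) (at_inr s) = at_inr (ren (upr r) s)"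
  by (simp add: at_inr_def ren_esubst ren_upr_upr_elift1)

lemma ren_EFun [simp]: "ren r (EFun t t') = EFun (ren r t) (ren r t')"
  by (simp add: EFun_def ren_upr_elift0)

text \<open>A lifted term does not mention the variable being specialised, so only the passage to
  the bound variable of the branch remains. This is the situation of a case whose result type is
  constant.\<close>

lemma at_inl_elift0 [simp]: "at_inl (elift 0 t) = elift 0 t"
  using elift_elift[of 0 0 t] by (simp add: at_inl_def flip: elift_elift)

lemma at_inr_elift0 [simp]: "at_inr (elift 0 t) = elift 0 t"
  using elift_elift[of 0 0 t] by (simp add: at_inr_def flip: elift_elift)

section \<open>EMF* derivations are stable under renaming\<close>

text \<open>Context morphisms made of variables. Each \<open>G ! i\<close> lives in the part of the
  context below it, so both types are first lifted to the whole context.\<close>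

definition renames :: "(nat \<Rightarrow> nat) \<Rightarrow> ('b, 'k) ectx \<Rightarrow> ('b, 'k) ectx \<Rightarrow> bool" where
  "renames r G G' \<longleftrightarrow> (\<forall>i < length G. r i < length G' \<and>
     (elift 0 ^^ Suc (r i)) (G' ! r i) = ren r ((elift 0 ^^ Suc i) (G ! i)))"

lemma renames_upr: "renames r G G' \<Longrightarrow> renames (upr r) (t # G) (ren r t # G')"
  by (auto simp: renames_def ren_upr_elift0 less_Suc_eq_0_disj)

lemma renames_Suc: "renames Suc G (t # G)"
  by (auto simp: renames_def elift0_ren)

lemma renames_comp: "renames r G G' \<Longrightarrow> renames s G' G'' \<Longrightarrow> renames (s \<circ> r) G G''"
  by (auto simp: renames_def ren_ren simp flip: ren_ren)

text \<open>For instance, \<open>et_case\<close> types a branch in \<open>t # G\<close> with no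
  premise that \<open>t\<close> is a type; through this predicate the induction hypothesis for the
  branch supplies that fact in the renamed context.\<close>

primrec ctx_renamable :: "('b, 'k) signature \<Rightarrow> ('b, 'k) ectx \<Rightarrow> bool" where
  "ctx_renamable S [] = True"
| "ctx_renamable S (t # G) = (ctx_renamable S G \<and>
     (\<exists>n. \<forall>r G'. emf_wf S G' \<longrightarrow> renames r G G' \<longrightarrow> emf_typing S G' (ren r t) (EType n)))"

lemma ctx_renamable_Cons:
  assumes "ctx_renamable S (t # G)" "emf_wf S G'" "renames r G G'"
  shows "emf_wf S (ren r t # G')" "renames (upr r) (t # G) (ren r t # G')"
  using assms by (auto intro: ew_cons renames_upr)

definition ren_typing :: "('b, 'k) signature \<Rightarrow> ('b, 'k) ectx \<Rightarrow> ('b, 'k) etm \<Rightarrow> ('b, 'k) etm \<Rightarrow> bool" where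
  "ren_typing S G e t \<longleftrightarrow> ctx_renamable S G \<and>
     (\<forall>r G'. emf_wf S G' \<longrightarrow> renames r G G' \<longrightarrow> emf_typing S G' (ren r e) (ren r t))"

definition ren_valid :: "('b, 'k) signature \<Rightarrow> ('b, 'k) ectx \<Rightarrow> ('b, 'k) etm \<Rightarrow> bool" where
  "ren_valid S G p \<longleftrightarrow> ctx_renamable S G \<and>
     (\<forall>r G'. emf_wf S G' \<longrightarrow> renames r G G' \<longrightarrow> emf_valid S G' (ren r p))"

lemma ren_typing_head: "ren_typing S G e t \<Longrightarrow> ctx_renamable S G"
  by (simp add: ren_typing_def)

lemma ren_valid_head: "ren_valid S G p \<Longrightarrow> ctx_renamable S G"
  by (simp add: ren_valid_def)

lemma ren_typingI:
  "\<lbrakk> ctx_renamable S G;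
     \<And>r G'. \<lbrakk> emf_wf S G'; renames r G G' \<rbrakk> \<Longrightarrow> emf_typing S G' (ren r e) (ren r t) \<rbrakk>
   \<Longrightarrow> ren_typing S G e t"
  by (simp add: ren_typing_def)

lemma ren_validI:
  "\<lbrakk> ctx_renamable S G;
     \<And>r G'. \<lbrakk> emf_wf S G'; renames r G G' \<rbrakk> \<Longrightarrow> emf_valid S G' (ren r p) \<rbrakk>
   \<Longrightarrow> ren_valid S G p"
  by (simp add: ren_valid_def)

lemma ren_typingD:
  "\<lbrakk> ren_typing S G e t; emf_wf S G'; renames r G G' \<rbrakk> \<Longrightarrow> emf_typing S G' (ren r e) (ren r t)"
  by (simp add: ren_typing_def)

lemma ren_validD:
  "\<lbrakk> ren_valid S G p; emf_wf S G'; renames r G G' \<rbrakk> \<Longrightarrow> emf_valid S G' (ren r p)"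
  by (simp add: ren_valid_def)

lemma ren_typingD1:
  "\<lbrakk> ren_typing S (u # G) e t; emf_wf S G'; renames r G G' \<rbrakk>
   \<Longrightarrow> emf_typing S (ren r u # G') (ren (upr r) e) (ren (upr r) t)"
  by (meson ctx_renamable_Cons ren_typing_def)

lemma ren_validD1:
  "\<lbrakk> ren_valid S (u # G) p; emf_wf S G'; renames r G G' \<rbrakk>
   \<Longrightarrow> emf_valid S (ren r u # G') (ren (upr r) p)"
  by (meson ctx_renamable_Cons ren_valid_def)

lemma ren_validD2:
  "\<lbrakk> ren_valid S (v # u # G) p; emf_wf S G'; renames r G G' \<rbrakk>
   \<Longrightarrow> emf_valid S (ren (upr r) v # ren r u # G') (ren (upr (upr r)) p)"
  by (meson ctx_renamable.simps(2) ctx_renamable_Cons ren_valid_def)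

text \<open>Some rules type a term under a binder without typing the binder, so the induction
  also carries the fact that the entries of the context remain types under renaming.\<close>

lemma emf_ren_aux:
  shows "emf_wf S G \<Longrightarrow> ctx_renamable S G"
    and "emf_typing S G e t \<Longrightarrow> ren_typing S G e t"
    and "emf_valid S G p \<Longrightarrow> ren_valid S G p"
proof (induction rule: emf_wf_emf_typing_emf_valid.inducts)
  case ew_nil
  then show ?case by (simp add: ren_typing_def)
next
  case (ew_cons G t n)
  then show ?case by (auto simp: ren_typing_def)
next
  case (et_var G i)
  then have "emf_typing S G' (ren r (EVar i)) (ren r ((elift 0 ^^ Suc i) (G ! i)))"
    if "emf_wf S G'" "renames r G G'" for r G'
    using that emf_wf_emf_typing_emf_valid.et_var[of S G' "r i"] by (simp add: renames_def)
  then show ?case using et_var by (simp add: ren_typing_def)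
next
  case (et_con G c bs b es)
  then show ?case
    by (auto simp: ren_typing_def intro!: emf_wf_emf_typing_emf_valid.et_con)
next
  case (ev_hyp G i p)
  then show ?case
    by (auto simp: ren_typing_def ren_valid_def intro!: emf_wf_emf_typing_emf_valid.ev_hyp)
\<comment> \<open>The remaining rules are uniform: the context part comes from an induction
  hypothesis, the premises are moved along the renaming (under one or two binders where needed), the
  renaming is pushed through substitution, lifting, \<open>at_inl\<close> and \<open>at_inr\<close>,
  and the same rule is applied again.\<close>
qed ((rule ren_typingI ren_validI, (erule ren_typing_head ren_valid_head | assumption)),
  ((drule (2) ren_typingD ren_validD ren_typingD1 ren_validD1 ren_validD2)+)?,
  (simp only: ren.simps ren_esubst ren_at_inl ren_at_inr ren_upr_elift0 upr_simps)?,
  rule emf_wf_emf_typing_emf_valid.intros; assumption)+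

lemma emf_typing_ren:
  "\<lbrakk> emf_typing S G e t; emf_wf S G'; renames r G G' \<rbrakk> \<Longrightarrow> emf_typing S G' (ren r e) (ren r t)"
  by (meson emf_ren_aux(2) ren_typingD)

lemma emf_valid_ren:
  "\<lbrakk> emf_valid S G p; emf_wf S G'; renames r G G' \<rbrakk> \<Longrightarrow> emf_valid S G' (ren r p)"
  by (meson emf_ren_aux(3) ren_validD)

section \<open>Typed equality\<close>

lemma
  shows "emf_wf S G \<Longrightarrow> True"
    and emf_typing_wf: "emf_typing S G e t \<Longrightarrow> emf_wf S G"
    and "emf_valid S G p \<Longrightarrow> emf_wf S G"
  by (induction rule: emf_wf_emf_typing_emf_valid.inducts) auto

definition is_type :: "('b, 'k) signature \<Rightarrow> ('b, 'k) ectx \<Rightarrow> ('b, 'k) etm \<Rightarrow> bool" where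
  "is_type S G t \<longleftrightarrow> (\<exists>n. emf_typing S G t (EType n))"

lemma is_type_wf: "is_type S G t \<Longrightarrow> emf_wf S G"
  by (auto simp: is_type_def emf_typing_wf)

lemma is_type_wf_Cons: "is_type S G t \<Longrightarrow> emf_wf S (t # G)"
  using is_type_wf[of S G t] by (auto simp: is_type_def intro: ew_cons)

lemma elift1_ren: "elift (Suc 0) t = ren (upr Suc) t"
  by (simp add: elift_ren liftr_0[symmetric] upr_liftr)

lemma esubst_0_elift1 [simp]: "esubst 0 (EVar 0) (elift (Suc 0) t) = t"
proof -
  have "instr 0 0 \<circ> upr Suc = (\<lambda>i. i)"
    by (auto simp: fun_eq_iff instr_def upr_def split: nat.split)
  then show ?thesis by (simp add: esubst_var_ren elift1_ren ren_ren)
qed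

section \<open>Weakening, and typing rules for non-dependent types\<close>

lemma emf_typing_elift0:
  "\<lbrakk> emf_typing S G e t; emf_wf S (u # G) \<rbrakk> \<Longrightarrow> emf_typing S (u # G) (elift 0 e) (elift 0 t)"
  using emf_typing_ren[OF _ _ renames_Suc] by (simp add: elift0_ren)

lemma emf_valid_elift0:
  "\<lbrakk> emf_valid S G p; emf_wf S (u # G) \<rbrakk> \<Longrightarrow> emf_valid S (u # G) (elift 0 p)"
  using emf_valid_ren[OF _ _ renames_Suc] by (simp add: elift0_ren)

lemma is_type_elift0: "\<lbrakk> is_type S G t; emf_wf S (u # G) \<rbrakk> \<Longrightarrow> is_type S (u # G) (elift 0 t)"
  using emf_typing_elift0[of S G t "EType _" u] by (auto simp: is_type_def)

lemma emf_typing_elift1: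
  assumes "emf_typing S (t # G) e t'" "is_type S G t" "emf_wf S (u # G)"
  shows "emf_typing S (elift 0 t # u # G) (elift (Suc 0) e) (elift (Suc 0) t')"
proof -
  have "emf_wf S (elift 0 t # u # G)"
    using assms is_type_elift0 is_type_wf_Cons by blast
  then show ?thesis
    using emf_typing_ren[OF assms(1) _ renames_upr[OF renames_Suc]]
    by (simp add: elift1_ren elift0_ren)
qed

lemma et_var0: "is_type S G t \<Longrightarrow> emf_typing S (t # G) (EVar 0) (elift 0 t)"
  using et_var[of S "t # G" 0] is_type_wf_Cons by auto

lemma et_var_Suc: "emf_typing S G (EVar i) t \<Longrightarrow> emf_wf S (u # G)
    \<Longrightarrow> emf_typing S (u # G) (EVar (Suc i)) (elift 0 t)"
  using emf_typing_elift0[of S G "EVar i" t u] by simp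

lemma is_type_EType: "emf_wf S G \<Longrightarrow> is_type S G (EType n)"
  by (auto simp: is_type_def intro: et_type)

lemma is_type_EFun: "\<lbrakk> is_type S G t; is_type S G t' \<rbrakk> \<Longrightarrow> is_type S G (EFun t t')"
  using is_type_wf_Cons[of S G t] is_type_elift0[of S G t' t]
  by (auto simp: is_type_def EFun_def intro: et_pi)

lemma is_type_ESum: "\<lbrakk> is_type S G t; is_type S G t' \<rbrakk> \<Longrightarrow> is_type S G (ESum t t')"
  by (auto simp: is_type_def intro: et_sum)

lemma is_type_EProd: "\<lbrakk> is_type S G t; is_type S G t' \<rbrakk> \<Longrightarrow> is_type S G (EProd t t')"
  by (auto simp: is_type_def intro: et_prod)

lemma et_app_fun: "\<lbrakk> emf_typing S G f (EFun t t'); emf_typing S G e t \<rbrakk>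
    \<Longrightarrow> emf_typing S G (EApp f e) t'"
  using et_app[of S G f t "elift 0 t'" e] by (simp add: EFun_def)

lemma et_lam_fun: "\<lbrakk> is_type S G t; emf_typing S (t # G) e (elift 0 t') \<rbrakk>
    \<Longrightarrow> emf_typing S G (ELam t e) (EFun t t')"
  by (auto simp: EFun_def is_type_def intro: et_lam)

lemma et_case_const:
  assumes "emf_typing S G e (ESum t t')" "is_type S G t" "is_type S G t'" "is_type S G s"
    "emf_typing S (t # G) e1 (elift 0 s)" "emf_typing S (t' # G) e2 (elift 0 s)"
  shows "emf_typing S G (ECase e t e1 t' e2) s"
proof -
  have "is_type S (ESum t t' # G) (elift 0 s)"
    using assms is_type_elift0 is_type_wf_Cons is_type_ESum by blast
  then show ?thesis
    using et_case[of S G e t t' "elift 0 s" _ e1 e2] assms by (auto simp: is_type_def)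
qed

lemma et_inl': "\<lbrakk> emf_typing S G e t; is_type S G t' \<rbrakk> \<Longrightarrow> emf_typing S G (EInl e) (ESum t t')"
  by (auto simp: is_type_def intro: et_inl)

lemma et_inr': "\<lbrakk> emf_typing S G e t'; is_type S G t \<rbrakk> \<Longrightarrow> emf_typing S G (EInr e) (ESum t t')"
  by (auto simp: is_type_def intro: et_inr)

text \<open>The typings travel with the equation because the congruence rules need them as premises
  of \<open>ev_subst\<close> and of the formation rules; no derivation of validity ever has to be
  inverted to recover them.\<close>

definition eqv ::
  "('b, 'k) signature \<Rightarrow> ('b, 'k) ectx \<Rightarrow> ('b, 'k) etm \<Rightarrow> ('b, 'k) etm \<Rightarrow> ('b, 'k) etm \<Rightarrow> bool"
where
  "eqv S G t a b \<longleftrightarrow> is_type S G t \<and> emf_typing S G a t \<and> emf_typing S G b t \<and>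
     emf_valid S G (EEq t a b)"

lemma eqvD:
  assumes "eqv S G t a b"
  shows "is_type S G t" "emf_typing S G a t" "emf_typing S G b t" "emf_valid S G (EEq t a b)"
    "emf_wf S G"
  using assms by (auto simp: eqv_def is_type_wf)

lemma eqv_refl: "\<lbrakk> is_type S G t; emf_typing S G a t \<rbrakk> \<Longrightarrow> eqv S G t a a"
  by (auto simp: eqv_def is_type_def intro: ev_refl)

lemma eqv_sym: "eqv S G t a b \<Longrightarrow> eqv S G t b a"
  by (auto simp: eqv_def intro: ev_sym)

lemma eqv_trans [trans]: "\<lbrakk> eqv S G t a b; eqv S G t b c \<rbrakk> \<Longrightarrow> eqv S G t a c"
  by (auto simp: eqv_def intro: ev_trans)

section \<open>Congruence, beta and eta for typed equality\<close>

lemma eqv_elift0: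
  "\<lbrakk> eqv S G t a b; emf_wf S (u # G) \<rbrakk> \<Longrightarrow> eqv S (u # G) (elift 0 t) (elift 0 a) (elift 0 b)"
  using emf_valid_elift0[of S G "EEq t a b"]
  by (auto simp: eqv_def is_type_elift0 emf_typing_elift0)

text \<open>Leibniz's law for terms. A congruence rule whose changed argument is not under a binder
  is an instance, with variable 0 of \<open>F\<close> in place of that argument.\<close>

lemma eqv_esubst:
  assumes ab: "eqv S G t a b" and K: "is_type S G K"
    and F: "emf_typing S (t # G) F (elift 0 K)"
    and Fa: "emf_typing S G (esubst 0 a F) K" and Fb: "emf_typing S G (esubst 0 b F) K"
  shows "eqv S G K (esubst 0 a F) (esubst 0 b F)"
proof -
  \<comment> \<open>The motive is F[a] == F: it holds by reflexivity at \<open>a\<close> and is the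
    goal at \<open>b\<close>.\<close>
  let ?p = "EEq (elift 0 K) (elift 0 (esubst 0 a F)) F"
  have wf: "emf_wf S (t # G)" using eqvD(1)[OF ab] is_type_wf_Cons by blast
  have "is_type S (t # G) (elift 0 K)" using K wf is_type_elift0 by blast
  then have "emf_typing S (t # G) ?p (EType 0)"
    using F emf_typing_elift0[OF Fa wf] by (auto simp: is_type_def intro: et_eq)
  moreover have "emf_valid S G (esubst 0 a ?p)"
    using K Fa by (auto simp: is_type_def intro: ev_refl)
  ultimately have "emf_valid S G (esubst 0 b ?p)" using eqvD(4)[OF ab] ev_subst by blast
  then show ?thesis using K Fa Fb by (simp add: eqv_def)
qed

lemma eqv_app:
  assumes fg: "eqv S G (EFun t K) f g" and ab: "eqv S G t a b" and K: "is_type S G K"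
  shows "eqv S G K (EApp f a) (EApp g b)"
proof -
  have wf: "emf_wf S (t # G)" "emf_wf S (EFun t K # G)"
    using eqvD[OF fg] eqvD[OF ab] is_type_wf_Cons by blast+
  have 1: "emf_typing S (EFun t K # G) (EApp (EVar 0) (elift 0 a)) (elift 0 K)"
    using et_var0[OF eqvD(1)[OF fg]] emf_typing_elift0[OF eqvD(2)[OF ab] wf(2)]
    by (auto simp: elift0_ren intro: et_app_fun)
  have 2: "emf_typing S (t # G) (EApp (elift 0 g) (EVar 0)) (elift 0 K)"
    using et_var0[OF eqvD(1)[OF ab]] emf_typing_elift0[OF eqvD(3)[OF fg] wf(1)]
    by (auto simp: elift0_ren intro: et_app_fun)
  have "eqv S G K (EApp f a) (EApp g a)"
    using eqv_esubst[OF fg K 1] eqvD(2,3)[OF fg] eqvD[OF ab] by (auto intro: et_app_fun)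
  also have "eqv S G K (EApp g a) (EApp g b)"
    using eqv_esubst[OF ab K 2] eqvD(2,3)[OF fg] eqvD[OF ab] by (auto intro: et_app_fun)
  finally show ?thesis .
qed

lemma eqv_ext:
  assumes f: "emf_typing S G f (EFun t K)" and g: "emf_typing S G g (EFun t K)"
    and t: "is_type S G t" and K: "is_type S G K"
    and eq: "eqv S (t # G) (elift 0 K) (EApp (elift 0 f) (EVar 0)) (EApp (elift 0 g) (EVar 0))"
  shows "eqv S G (EFun t K) f g"
  using ev_ext[of S G f t "elift 0 K" g] assms
  by (auto simp: eqv_def EFun_def[symmetric] is_type_EFun)

lemma eqv_beta:
  assumes t: "is_type S G t" and K: "is_type S G K" and e: "emf_typing S (t # G) e (elift 0 K)"
    and a: "emf_typing S G a t" and ea: "emf_typing S G (esubst 0 a e) K"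
  shows "eqv S G K (EApp (ELam t e) a) (esubst 0 a e)"
proof -
  have "emf_typing S G (EApp (ELam t e) a) K"
    using et_app_fun[OF et_lam_fun[OF t e] a] .
  moreover have "emf_valid S G (EEq K (EApp (ELam t e) a) (esubst 0 a e))"
    using t ev_beta[OF _ e a] by (auto simp: is_type_def)
  ultimately show ?thesis using K ea by (simp add: eqv_def)
qed

text \<open>Lifting the body past the new variable and substituting that variable back is the
  identity, so a single beta step returns the body itself.\<close>

lemma eqv_lam_var:
  assumes t: "is_type S G t" and K: "is_type S (t # G) (elift 0 K)"
    and e: "emf_typing S (t # G) e (elift 0 K)"
  shows "eqv S (t # G) (elift 0 K) (EApp (elift 0 (ELam t e)) (EVar 0)) e"
proof -
  have wf: "emf_wf S (t # G)" using t is_type_wf_Cons by blast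
  have "emf_typing S (elift 0 t # t # G) (elift (Suc 0) e) (elift 0 (elift 0 K))"
    using emf_typing_elift1[OF e t wf] by (simp add: elift_elift[symmetric])
  then show ?thesis
    using eqv_beta[OF is_type_elift0[OF t wf] K, of "elift (Suc 0) e" "EVar 0"] et_var0[OF t] e
    by simp
qed

text \<open>\<open>ev_subst\<close> does not act under a binder, but extensionality does: applied to
  a fresh variable, the two abstractions are their bodies by beta.\<close>

lemma eqv_lam:
  assumes e: "eqv S (t # G) (elift 0 K) e e'" and t: "is_type S G t" and K: "is_type S G K"
  shows "eqv S G (EFun t K) (ELam t e) (ELam t e')"
proof (rule eqv_ext)
  have K': "is_type S (t # G) (elift 0 K)" using eqvD(1)[OF e] .
  show "eqv S (t # G) (elift 0 K) (EApp (elift 0 (ELam t e)) (EVar 0))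
      (EApp (elift 0 (ELam t e')) (EVar 0))"
    using eqv_lam_var[OF t K'] eqvD(2,3)[OF e] e by (meson eqv_sym eqv_trans)
qed (use assms eqvD[OF e] in \<open>auto intro: et_lam_fun\<close>)

lemma eqv_eta:
  assumes "emf_typing S G f (EFun t K)" "is_type S G t" "is_type S G K"
  shows "eqv S G (EFun t K) (ELam t (EApp (elift 0 f) (EVar 0))) f"
proof -
  have wf: "emf_wf S (t # G)" using assms is_type_wf_Cons by blast
  have "emf_typing S (t # G) (EApp (elift 0 f) (EVar 0)) (elift 0 K)"
    using emf_typing_elift0[OF assms(1) wf] et_var0[OF assms(2)]
    by (auto simp: elift0_ren intro: et_app_fun)
  then show ?thesis
    using assms ev_eta[of S G f t "elift 0 K"]
    by (auto simp: eqv_def is_type_EFun EFun_def[symmetric] intro: et_lam_fun)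
qed

lemma eqv_fst:
  assumes ab: "eqv S G (EProd t t') a b" and t: "is_type S G t"
  shows "eqv S G t (EFst a) (EFst b)"
proof -
  have "emf_typing S (EProd t t' # G) (EFst (EVar 0)) (elift 0 t)"
    using et_var0[OF eqvD(1)[OF ab]] by (auto intro: et_fst)
  from eqv_esubst[OF ab t this] show ?thesis using eqvD[OF ab] by (auto intro: et_fst)
qed

lemma eqv_snd:
  assumes ab: "eqv S G (EProd t t') a b" and t: "is_type S G t'"
  shows "eqv S G t' (ESnd a) (ESnd b)"
proof -
  have "emf_typing S (EProd t t' # G) (ESnd (EVar 0)) (elift 0 t')"
    using et_var0[OF eqvD(1)[OF ab]] by (auto intro: et_snd)
  from eqv_esubst[OF ab t this] show ?thesis using eqvD[OF ab] by (auto intro: et_snd)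
qed

lemma eqv_inl:
  assumes ab: "eqv S G t a b" and t': "is_type S G t'"
  shows "eqv S G (ESum t t') (EInl a) (EInl b)"
proof -
  have "emf_typing S (t # G) (EInl (EVar 0)) (elift 0 (ESum t t'))"
    using et_var0[OF eqvD(1)[OF ab]] is_type_elift0[OF t'] is_type_wf_Cons[OF eqvD(1)[OF ab]]
    by (auto intro: et_inl')
  from eqv_esubst[OF ab is_type_ESum[OF eqvD(1)[OF ab] t'] this] show ?thesis
    using eqvD[OF ab] t' by (auto intro: et_inl')
qed

lemma eqv_inr:
  assumes ab: "eqv S G t' a b" and t: "is_type S G t"
  shows "eqv S G (ESum t t') (EInr a) (EInr b)"
proof -
  have "emf_typing S (t' # G) (EInr (EVar 0)) (elift 0 (ESum t t'))"
    using et_var0[OF eqvD(1)[OF ab]] is_type_elift0[OF t] is_type_wf_Cons[OF eqvD(1)[OF ab]]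
    by (auto intro: et_inr')
  from eqv_esubst[OF ab is_type_ESum[OF t eqvD(1)[OF ab]] this] show ?thesis
    using eqvD[OF ab] t by (auto intro: et_inr')
qed

lemma eqv_pair:
  assumes ab: "eqv S G t a b" and ab': "eqv S G t' a' b'"
  shows "eqv S G (EProd t t') (EPair a a') (EPair b b')"
proof -
  have wf: "emf_wf S (t # G)" "emf_wf S (t' # G)"
    using eqvD[OF ab] eqvD[OF ab'] is_type_wf_Cons by blast+
  have P: "is_type S G (EProd t t')" using eqvD[OF ab] eqvD[OF ab'] is_type_EProd by blast
  have 1: "emf_typing S (t # G) (EPair (EVar 0) (elift 0 a')) (elift 0 (EProd t t'))"
    using et_var0[OF eqvD(1)[OF ab]] emf_typing_elift0[OF eqvD(2)[OF ab'] wf(1)]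
    by (auto intro: et_pair)
  have 2: "emf_typing S (t' # G) (EPair (elift 0 b) (EVar 0)) (elift 0 (EProd t t'))"
    using et_var0[OF eqvD(1)[OF ab']] emf_typing_elift0[OF eqvD(3)[OF ab] wf(2)]
    by (auto intro: et_pair)
  have "eqv S G (EProd t t') (EPair a a') (EPair b a')"
    using eqv_esubst[OF ab P 1] eqvD[OF ab] eqvD[OF ab'] by (auto intro: et_pair)
  also have "eqv S G (EProd t t') (EPair b a') (EPair b b')"
    using eqv_esubst[OF ab' P 2] eqvD[OF ab] eqvD[OF ab'] by (auto intro: et_pair)
  finally show ?thesis .
qed

text \<open>The arguments are replaced one at a time: \<open>k\<close> of them have been dealt with.\<close>

lemma eqv_con:
  assumes wf: "emf_wf S G" and c: "S c = (bs, b)"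
    and len: "length es = length bs" "length es' = length bs"
    and eq: "\<And>i. i < length bs \<Longrightarrow> eqv S G (EBase (bs ! i)) (es ! i) (es' ! i)"
  shows "eqv S G (EBase b) (ECon c es) (ECon c es')"
proof -
  let ?m = "\<lambda>k. take k es' @ drop k es"
  have B: "is_type S G (EBase b)" using wf by (auto simp: is_type_def intro: et_base)
  have nth: "?m k ! i = (if i < k then es' ! i else es ! i)" if "k \<le> length bs" "i < length bs" for k i
    using that len by (simp add: nth_append)
  have ty: "emf_typing S G (ECon c (?m k)) (EBase b)" if "k \<le> length bs" for k
    using that wf c len eqvD(2,3)[OF eq] by (intro et_con[of S G c bs b]) (auto simp: nth)
  have "eqv S G (EBase b) (ECon c es) (ECon c (?m k))" if "k \<le> length bs" for k
    using that
  proof (induction k)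
    case 0
    then show ?case using eqv_refl[OF B ty[of 0]] by simp
  next
    case (Suc k)
    \<comment> \<open>Variable 0 marks argument \<open>k\<close>; the arguments before it already
      come from \<open>es'\<close>, those after it still from \<open>es\<close>.\<close>
    let ?F = "ECon c (map (elift 0) (take k es') @ EVar 0 # map (elift 0) (drop (Suc k) es))"
    let ?t = "EBase (bs ! k)"
    have k: "k < length bs" using Suc by simp
    have wf': "emf_wf S (?t # G)" using eqvD(1)[OF eq[OF k]] is_type_wf_Cons by blast
    have F: "emf_typing S (?t # G) ?F (elift 0 (EBase b))"
    proof (simp, intro et_con[OF wf' c] allI impI)
      fix i assume "i < length (map (elift 0) (take k es') @ EVar 0 # map (elift 0) (drop (Suc k) es))"
      then have i: "i < length bs" using len k by simp
      consider "i < k" | "i = k" | "k < i" by linarith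
      then show "emf_typing S (?t # G)
         ((map (elift 0) (take k es') @ EVar 0 # map (elift 0) (drop (Suc k) es)) ! i) (EBase (bs ! i))"
      proof cases
        case 1
        then show ?thesis using emf_typing_elift0[OF eqvD(3)[OF eq[OF i]] wf'] len k i
          by (simp add: nth_append)
      next
        case 2
        then show ?thesis using et_var0[OF eqvD(1)[OF eq[OF k]]] len k
          by (simp add: nth_append)
      next
        case 3
        then show ?thesis using emf_typing_elift0[OF eqvD(2)[OF eq[OF i]] wf'] len k i
          by (simp add: nth_append nth_Cons split: nat.split)
            (metis Suc_leI add_Suc_shift diff_Suc_Suc le_add_diff_inverse less_imp_Suc_add add_diff_cancel_left')
      qed
    qed (use len k in simp)
    have a: "esubst 0 (es ! k) ?F = ECon c (?m k)"
      using len k by (simp add: o_def Cons_nth_drop_Suc)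
    have b: "esubst 0 (es' ! k) ?F = ECon c (?m (Suc k))"
      using len k by (simp add: o_def take_Suc_conv_app_nth)
    have "eqv S G (EBase b) (ECon c (?m k)) (ECon c (?m (Suc k)))"
      using eqv_esubst[OF eq[OF k] B F] ty[of k] ty[of "Suc k"] Suc.prems unfolding a b by simp
    then show ?case using Suc eqv_trans by fastforce
  qed
  from this[of "length bs"] show ?thesis using len by simp
qed

lemma eqv_case_scrutinee:
  assumes ab: "eqv S G (ESum t t') a b" and t: "is_type S G t" "is_type S G t'" "is_type S G s"
    and e: "emf_typing S (t # G) e1 (elift 0 s)" "emf_typing S (t' # G) e2 (elift 0 s)"
  shows "eqv S G s (ECase a t e1 t' e2) (ECase b t e1 t' e2)"
proof -
  let ?F = "ECase (EVar 0) (elift 0 t) (elift (Suc 0) e1) (elift 0 t') (elift (Suc 0) e2)"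
  have wf: "emf_wf S (ESum t t' # G)" using eqvD(1)[OF ab] is_type_wf_Cons by blast
  have "emf_typing S (ESum t t' # G) ?F (elift 0 s)"
    using et_var0[OF eqvD(1)[OF ab]] is_type_elift0[OF _ wf] t
      emf_typing_elift1[OF e(1) t(1) wf] emf_typing_elift1[OF e(2) t(2) wf]
    by (intro et_case_const) (auto simp: elift_elift)
  from eqv_esubst[OF ab t(3) this] show ?thesis
    using eqvD[OF ab] t e by (simp add: et_case_const)
qed

lemma eqv_case_inl:
  assumes a: "emf_typing S G a t" and t: "is_type S G t" "is_type S G t'" "is_type S G s"
    and e: "emf_typing S (t # G) e1 (elift 0 s)" "emf_typing S (t' # G) e2 (elift 0 s)"
    and ea: "emf_typing S G (esubst 0 a e1) s"
  shows "eqv S G s (ECase (EInl a) t e1 t' e2) (esubst 0 a e1)"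
proof -
  have "is_type S (ESum t t' # G) (elift 0 s)"
    using t is_type_elift0 is_type_wf_Cons is_type_ESum by blast
  then have "emf_valid S G (EEq s (ECase (EInl a) t e1 t' e2) (esubst 0 a e1))"
    using ev_case_inl[OF a, of t' "elift 0 s" _ e1 e2] e by (auto simp: is_type_def)
  then show ?thesis using assms by (simp add: eqv_def et_case_const et_inl')
qed

lemma eqv_case_inr:
  assumes a: "emf_typing S G a t'" and t: "is_type S G t" "is_type S G t'" "is_type S G s"
    and e: "emf_typing S (t # G) e1 (elift 0 s)" "emf_typing S (t' # G) e2 (elift 0 s)"
    and ea: "emf_typing S G (esubst 0 a e2) s"
  shows "eqv S G s (ECase (EInr a) t e1 t' e2) (esubst 0 a e2)"
proof -
  have "is_type S (ESum t t' # G) (elift 0 s)"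
    using t is_type_elift0 is_type_wf_Cons is_type_ESum by blast
  then have "emf_valid S G (EEq s (ECase (EInr a) t e1 t' e2) (esubst 0 a e2))"
    using ev_case_inr[OF a, of t "elift 0 s" _ e1 e2] e by (auto simp: is_type_def)
  then show ?thesis using assms by (simp add: eqv_def et_case_const et_inr')
qed

lemma eqv_case_inl_var:
  assumes t: "is_type S G t" "is_type S G t'" "is_type S G s"
    and e: "emf_typing S (t # G) e1 (elift 0 s)" "emf_typing S (t' # G) e2 (elift 0 s)"
  shows "eqv S (t # G) (elift 0 s) (ECase (EInl (EVar 0))
    (elift 0 t) (elift (Suc 0) e1) (elift 0 t') (elift (Suc 0) e2)) e1"
proof -
  have wf: "emf_wf S (t # G)" using t is_type_wf_Cons by blast
  show ?thesis
    using eqv_case_inl[OF et_var0[OF t(1)] is_type_elift0[OF t(1) wf] is_type_elift0[OF t(2) wf]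
        is_type_elift0[OF t(3) wf], of "elift (Suc 0) e1" "elift (Suc 0) e2"]
      emf_typing_elift1[OF e(1) t(1) wf] emf_typing_elift1[OF e(2) t(2) wf] e
    by (simp add: elift_elift)
qed

lemma eqv_case_inr_var:
  assumes t: "is_type S G t" "is_type S G t'" "is_type S G s"
    and e: "emf_typing S (t # G) e1 (elift 0 s)" "emf_typing S (t' # G) e2 (elift 0 s)"
  shows "eqv S (t' # G) (elift 0 s) (ECase (EInr (EVar 0))
    (elift 0 t) (elift (Suc 0) e1) (elift 0 t') (elift (Suc 0) e2)) e2"
proof -
  have wf: "emf_wf S (t' # G)" using t is_type_wf_Cons by blast
  show ?thesis
    using eqv_case_inr[OF et_var0[OF t(2)] is_type_elift0[OF t(1) wf] is_type_elift0[OF t(2) wf]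
        is_type_elift0[OF t(3) wf], of "elift (Suc 0) e1" "elift (Suc 0) e2"]
      emf_typing_elift1[OF e(1) t(1) wf] emf_typing_elift1[OF e(2) t(2) wf] e
    by (simp add: elift_elift)
qed

lemma at_inl_case_var:
  "at_inl (ECase (EVar 0) (elift 0 t) (elift (Suc 0) e1) (elift 0 t') (elift (Suc 0) e2)) =
   ECase (EInl (EVar 0)) (elift 0 t) (elift (Suc 0) e1) (elift 0 t') (elift (Suc 0) e2)"
  using at_inl_elift0[of t] at_inl_elift0[of t'] by (simp add: at_inl_def flip: elift_elift)

lemma at_inr_case_var:
  "at_inr (ECase (EVar 0) (elift 0 t) (elift (Suc 0) e1) (elift 0 t') (elift (Suc 0) e2)) =
   ECase (EInr (EVar 0)) (elift 0 t) (elift (Suc 0) e1) (elift 0 t') (elift (Suc 0) e2)"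
  using at_inr_elift0[of t] at_inr_elift0[of t'] by (simp add: at_inr_def flip: elift_elift)

lemma et_case_var:
  assumes t: "is_type S G t" "is_type S G t'" "is_type S G s"
    and e: "emf_typing S (t # G) e1 (elift 0 s)" "emf_typing S (t' # G) e2 (elift 0 s)"
  shows "emf_typing S (ESum t t' # G) (ECase (EVar 0)
    (elift 0 t) (elift (Suc 0) e1) (elift 0 t') (elift (Suc 0) e2)) (elift 0 s)"
proof -
  have st: "is_type S G (ESum t t')" using t is_type_ESum by blast
  then have wf: "emf_wf S (ESum t t' # G)" using is_type_wf_Cons by blast
  show ?thesis
    using et_var0[OF st] is_type_elift0[OF _ wf] t
      emf_typing_elift1[OF e(1) t(1) wf] emf_typing_elift1[OF e(2) t(2) wf]
    by (intro et_case_const) (auto simp: elift_elift)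
qed

text \<open>The branches lie under binders, out of reach of Leibniz's law. The equation is therefore
  stated for a variable scrutinee and proved by case analysis on the sum: in each summand both sides
  reduce to their branches, which are equal by assumption.\<close>

lemma eqv_case_branches:
  assumes a: "emf_typing S G a (ESum t t')"
    and t: "is_type S G t" "is_type S G t'" "is_type S G s"
    and e: "eqv S (t # G) (elift 0 s) e1 e1'" "eqv S (t' # G) (elift 0 s) e2 e2'"
  shows "eqv S G s (ECase a t e1 t' e2) (ECase a t e1' t' e2')"
proof -
  \<comment> \<open>The branches are lifted at level 1 because the scrutinee variable enters the
    context below their own bound variable.\<close>
  let ?c = "\<lambda>e1 e2. ECase (EVar 0) (elift 0 t) (elift (Suc 0) e1) (elift 0 t') (elift (Suc 0) e2)"
  let ?p = "EEq (elift 0 s) (?c e1 e2) (?c e1' e2')"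
  note ty = et_case_var[OF t] and e' = eqvD(2,3)[OF e(1)] eqvD(2,3)[OF e(2)]
  have st: "is_type S (ESum t t' # G) (elift 0 s)"
    using t is_type_elift0 is_type_wf_Cons is_type_ESum by blast
  have "emf_typing S (ESum t t' # G) ?p (EType 0)"
    using st ty[OF e'(1,3)] ty[OF e'(2,4)] by (auto simp: is_type_def intro: et_eq)
  moreover have "at_inl ?p = EEq (elift 0 s) (at_inl (?c e1 e2)) (at_inl (?c e1' e2'))"
    "at_inr ?p = EEq (elift 0 s) (at_inr (?c e1 e2)) (at_inr (?c e1' e2'))"
    using at_inl_elift0[of s] at_inr_elift0[of s] by (simp_all add: at_inl_def at_inr_def)
  moreover have "eqv S (t # G) (elift 0 s) (at_inl (?c e1 e2)) (at_inl (?c e1' e2'))"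
    unfolding at_inl_case_var
    using eqv_case_inl_var[OF t e'(1,3)] eqv_case_inl_var[OF t e'(2,4)] e(1)
    by (meson eqv_sym eqv_trans)
  moreover have "eqv S (t' # G) (elift 0 s) (at_inr (?c e1 e2)) (at_inr (?c e1' e2'))"
    unfolding at_inr_case_var
    using eqv_case_inr_var[OF t e'(1,3)] eqv_case_inr_var[OF t e'(2,4)] e(2)
    by (meson eqv_sym eqv_trans)
  ultimately have "emf_valid S G (esubst 0 a ?p)"
    using ev_sum_cases[OF a, of ?p] by (simp only: eqvD)
  then show ?thesis using t et_case_const[OF a t] e' by (simp add: eqv_def)
qed

lemma eqv_case:
  assumes a: "eqv S G (ESum t t') a a'"
    and t: "is_type S G t" "is_type S G t'" "is_type S G s"
    and e: "eqv S (t # G) (elift 0 s) e1 e1'" "eqv S (t' # G) (elift 0 s) e2 e2'"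
  shows "eqv S G s (ECase a t e1 t' e2) (ECase a' t e1' t' e2')"
  using eqv_case_scrutinee[OF a t eqvD(2)[OF e(1)] eqvD(2)[OF e(2)]]
    eqv_case_branches[OF eqvD(3)[OF a] t e] by (rule eqv_trans)

text \<open>The same case analysis on a variable scrutinee; at an injection the left side reduces to
  that injection.\<close>

lemma eqv_case_eta:
  assumes a: "emf_typing S G a (ESum t t')" and t: "is_type S G t" "is_type S G t'"
  shows "eqv S G (ESum t t') (ECase a t (EInl (EVar 0)) t' (EInr (EVar 0))) a"
proof -
  let ?c = "ECase (EVar 0) (elift 0 t) (elift (Suc 0) (EInl (EVar 0)))
    (elift 0 t') (elift (Suc 0) (EInr (EVar 0)))"
  let ?p = "EEq (elift 0 (ESum t t')) ?c (EVar 0)"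
  have st: "is_type S G (ESum t t')" using t is_type_ESum by blast
  have st': "is_type S (ESum t t' # G) (elift 0 (ESum t t'))"
    using st is_type_elift0 is_type_wf_Cons by blast
  have e: "emf_typing S (t # G) (EInl (EVar 0)) (elift 0 (ESum t t'))"
    "emf_typing S (t' # G) (EInr (EVar 0)) (elift 0 (ESum t t'))"
    using t et_var0 is_type_elift0[OF _ is_type_wf_Cons] by (auto intro!: et_inl' et_inr')
  have "emf_typing S (ESum t t' # G) ?p (EType 0)"
    using st' et_case_var[OF t st e] et_var0[OF st] unfolding is_type_def by (blast intro: et_eq)
  moreover have "at_inl ?p = EEq (elift 0 (ESum t t')) (at_inl ?c) (EInl (EVar 0))"
    "at_inr ?p = EEq (elift 0 (ESum t t')) (at_inr ?c) (EInr (EVar 0))"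
    using at_inl_elift0[of "ESum t t'"] at_inr_elift0[of "ESum t t'"]
    by (simp_all add: at_inl_def at_inr_def)
  moreover have "eqv S (t # G) (elift 0 (ESum t t')) (at_inl ?c) (EInl (EVar 0))"
    unfolding at_inl_case_var by (rule eqv_case_inl_var[OF t st e])
  moreover have "eqv S (t' # G) (elift 0 (ESum t t')) (at_inr ?c) (EInr (EVar 0))"
    unfolding at_inr_case_var by (rule eqv_case_inr_var[OF t st e])
  ultimately have "emf_valid S G (esubst 0 a ?p)"
    using ev_sum_cases[OF a, of ?p] by (simp only: eqvD)
  then have "emf_valid S G (EEq (ESum t t') (ECase a t (EInl (EVar 0)) t' (EInr (EVar 0))) a)"
    by simp
  moreover have "emf_typing S G (ECase a t (EInl (EVar 0)) t' (EInr (EVar 0))) (ESum t t')"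
    using et_case_const[OF a t st e] .
  ultimately show ?thesis using st a by (simp add: eqv_def)
qed

section \<open>The continuation monad of predicates\<close>

definition EPred :: "('b, 'k) etm \<Rightarrow> ('b, 'k) etm" where
  "EPred t = EFun t (EType 0)"

definition ERet :: "('b, 'k) etm \<Rightarrow> ('b, 'k) etm \<Rightarrow> ('b, 'k) etm" where
  "ERet t e = ELam (EPred t) (EApp (EVar 0) (elift 0 e))"

text \<open>Bind of the continuation monad, \<lambda>p. m (\<lambda>x. e p). It is named so that
  renaming and substitution act on it by one equation, without exposing the liftings of
  \<open>m\<close> and \<open>e\<close> past p.\<close>

definition EBnd ::
  "('b, 'k) etm \<Rightarrow> ('b, 'k) etm \<Rightarrow> ('b, 'k) etm \<Rightarrow> ('b, 'k) etm \<Rightarrow> ('b, 'k) etm" where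
  "EBnd t t' m e = ELam (EPred t')
     (EApp (elift 0 m) (ELam (elift 0 t) (EApp (elift (Suc 0) e) (EVar (Suc 0)))))"

lemma wp_ty_EPred: "wp_ty t = EFun (EPred t) (EType 0)"
  by (simp add: wp_ty_def EPred_def)

lemma ren_EPred [simp]: "ren r (EPred t) = EPred (ren r t)"
  by (simp add: EPred_def)

lemma ren_wp_ty [simp]: "ren r (wp_ty t) = wp_ty (ren r t)"
  by (simp add: wp_ty_def)

lemma ren_ERet [simp]: "ren r (ERet t e) = ERet (ren r t) (ren r e)"
  by (simp add: ERet_def ren_upr_elift0)

lemma ren_EBnd [simp]: "ren r (EBnd t t' m e) = EBnd (ren r t) (ren r t') (ren r m) (ren (upr r) e)"
  by (simp add: EBnd_def ren_upr_elift0 ren_upr_upr_elift1)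

lemma elift_EFun [simp]: "elift k (EFun t t') = EFun (elift k t) (elift k t')"
  by (simp add: elift_ren)

lemma elift_EPred [simp]: "elift k (EPred t) = EPred (elift k t)"
  by (simp add: elift_ren)

lemma elift_wp_ty [simp]: "elift k (wp_ty t) = wp_ty (elift k t)"
  by (simp add: elift_ren)

lemma elift_ERet [simp]: "elift k (ERet t e) = ERet (elift k t) (elift k e)"
  by (simp add: elift_ren)

lemma elift_EBnd [simp]:
  "elift k (EBnd t t' m e) = EBnd (elift k t) (elift k t') (elift k m) (elift (Suc k) e)"
  by (simp add: elift_ren upr_liftr)

lemma esubst_EFun [simp]: "esubst k u (EFun t t') = EFun (esubst k u t) (esubst k u t')"
  by (simp add: EFun_def elift_esubst)

lemma esubst_EPred [simp]: "esubst k u (EPred t) = EPred (esubst k u t)"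
  by (simp add: EPred_def)

lemma esubst_wp_ty [simp]: "esubst k u (wp_ty t) = wp_ty (esubst k u t)"
  by (simp add: wp_ty_def)

lemma esubst_ERet [simp]: "esubst k u (ERet t e) = ERet (esubst k u t) (esubst k u e)"
  by (simp add: ERet_def elift_esubst)

lemma esubst_EBnd [simp]:
  "esubst k u (EBnd t t' m e) =
   EBnd (esubst k u t) (esubst k u t') (esubst k u m) (esubst (Suc k) (elift 0 u) e)"
  by (simp add: EBnd_def elift_esubst elift_elift)

lemma is_type_EPred: "is_type S G t \<Longrightarrow> is_type S G (EPred t)"
  by (simp add: EPred_def is_type_EFun is_type_EType is_type_wf)

lemma is_type_wp_ty: "is_type S G t \<Longrightarrow> is_type S G (wp_ty t)"
  by (simp add: wp_ty_EPred is_type_EFun is_type_EPred is_type_EType is_type_wf)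

lemma et_app_pred: "\<lbrakk> emf_typing S G p (EPred t); emf_typing S G e t \<rbrakk>
    \<Longrightarrow> emf_typing S G (EApp p e) (EType 0)"
  by (auto simp: EPred_def intro: et_app_fun)

lemma et_app_wp: "\<lbrakk> emf_typing S G m (wp_ty t); emf_typing S G p (EPred t) \<rbrakk>
    \<Longrightarrow> emf_typing S G (EApp m p) (EType 0)"
  by (auto simp: wp_ty_EPred intro: et_app_fun)

lemma et_lam_pred: "\<lbrakk> is_type S G t; emf_typing S (t # G) e (EType 0) \<rbrakk>
    \<Longrightarrow> emf_typing S G (ELam t e) (EPred t)"
  by (auto simp: EPred_def intro: et_lam_fun)

lemma et_lam_wp: "\<lbrakk> is_type S G t; emf_typing S (EPred t # G) e (EType 0) \<rbrakk>
    \<Longrightarrow> emf_typing S G (ELam (EPred t) e) (wp_ty t)"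
  by (auto simp: wp_ty_EPred intro: et_lam_fun is_type_EPred)

lemma et_ret_body:
  assumes "emf_typing S G e t" "is_type S G t"
  shows "emf_typing S (EPred t # G) (EApp (EVar 0) (elift 0 e)) (EType 0)"
  using et_var0[OF is_type_EPred[OF assms(2)]]
    emf_typing_elift0[OF assms(1) is_type_wf_Cons[OF is_type_EPred[OF assms(2)]]]
  by (auto intro: et_app_pred)

lemma et_ERet: "\<lbrakk> emf_typing S G e t; is_type S G t \<rbrakk> \<Longrightarrow> emf_typing S G (ERet t e) (wp_ty t)"
  unfolding ERet_def by (blast intro: et_lam_wp et_ret_body)

text \<open>The continuation \<lambda>x. e k that a bind hands to its first computation when it is
  run on \<open>k\<close>.\<close>

lemma et_bnd_cont:
  assumes "is_type S G t" "is_type S G t'" "emf_typing S (t # G) e (wp_ty (elift 0 t'))"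
    "emf_typing S G k (EPred t')"
  shows "emf_typing S G (ELam t (EApp e (elift 0 k))) (EPred t)"
    "emf_typing S (t # G) (EApp e (elift 0 k)) (EType 0)"
proof -
  show "emf_typing S (t # G) (EApp e (elift 0 k)) (EType 0)"
    using emf_typing_elift0[OF assms(4) is_type_wf_Cons[OF assms(1)]] assms(3)
    by (auto intro: et_app_wp)
  then show "emf_typing S G (ELam t (EApp e (elift 0 k))) (EPred t)"
    using assms(1) by (blast intro: et_lam_pred)
qed

lemma et_bnd_body:
  assumes t: "is_type S G t" "is_type S G t'" and m: "emf_typing S G m (wp_ty t)"
    and e: "emf_typing S (t # G) e (wp_ty (elift 0 t'))"
  shows "emf_typing S (EPred t' # G)
    (EApp (elift 0 m) (ELam (elift 0 t) (EApp (elift (Suc 0) e) (EVar (Suc 0))))) (EType 0)"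
proof -
  have wf: "emf_wf S (EPred t' # G)" using is_type_wf_Cons[OF is_type_EPred[OF t(2)]] .
  have "emf_typing S (EPred t' # G) (ELam (elift 0 t) (EApp (elift (Suc 0) e) (elift 0 (EVar 0))))
     (EPred (elift 0 t))"
    using et_bnd_cont[OF is_type_elift0[OF t(1) wf] is_type_elift0[OF t(2) wf], of "elift (Suc 0) e" "EVar 0"]
      emf_typing_elift1[OF e t(1) wf] et_var0[OF is_type_EPred[OF t(2)]]
    by (simp add: elift_elift)
  then show ?thesis using emf_typing_elift0[OF m wf] by (auto intro: et_app_wp)
qed

lemma et_EBnd:
  assumes t: "is_type S G t" "is_type S G t'" and m: "emf_typing S G m (wp_ty t)"
    and e: "emf_typing S (t # G) e (wp_ty (elift 0 t'))"
  shows "emf_typing S G (EBnd t t' m e) (wp_ty t')"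
  unfolding EBnd_def using et_lam_wp[OF t(2) et_bnd_body[OF assms]] .

section \<open>Computation rules, congruence and the monad laws\<close>

lemma eqv_ret_app:
  assumes e: "emf_typing S G e t" and t: "is_type S G t" and k: "emf_typing S G k (EPred t)"
  shows "eqv S G (EType 0) (EApp (ERet t e) k) (EApp k e)"
proof -
  have "emf_typing S G (EApp k e) (EType 0)" using k e et_app_pred by blast
  then show ?thesis
    using eqv_beta[of S G "EPred t" "EType 0" "EApp (EVar 0) (elift 0 e)" k]
      is_type_EPred[OF t] et_ret_body[OF e t] k is_type_EType[OF is_type_wf[OF t]]
    by (simp add: ERet_def)
qed

lemma eqv_bnd_app:
  assumes t: "is_type S G t" "is_type S G t'" and m: "emf_typing S G m (wp_ty t)"
    and e: "emf_typing S (t # G) e (wp_ty (elift 0 t'))" and k: "emf_typing S G k (EPred t')"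
  shows "eqv S G (EType 0) (EApp (EBnd t t' m e) k) (EApp m (ELam t (EApp e (elift 0 k))))"
proof -
  have "emf_typing S G (EApp m (ELam t (EApp e (elift 0 k)))) (EType 0)"
    using et_app_wp[OF m et_bnd_cont(1)[OF t e k]] .
  then show ?thesis
    using eqv_beta[OF is_type_EPred[OF t(2)] is_type_EType[OF is_type_wf[OF t(1)], of 0] _ k,
        of "EApp (elift 0 m) (ELam (elift 0 t) (EApp (elift (Suc 0) e) (EVar (Suc 0))))"]
      et_bnd_body[OF t m e] by (simp add: EBnd_def)
qed

lemma eqv_app_wp: "\<lbrakk> eqv S G (wp_ty t) m m'; eqv S G (EPred t) k k' \<rbrakk>
    \<Longrightarrow> eqv S G (EType 0) (EApp m k) (EApp m' k')"
  using eqv_app[of S G "EPred t" "EType 0"] eqvD(5) is_type_EType by (metis wp_ty_EPred)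

lemma eqv_app_pred: "\<lbrakk> eqv S G (EPred t) k k'; eqv S G t e e' \<rbrakk>
    \<Longrightarrow> eqv S G (EType 0) (EApp k e) (EApp k' e')"
  using eqv_app[of S G t "EType 0"] eqvD(5) is_type_EType by (metis EPred_def)

lemma eqv_lam_pred: "\<lbrakk> eqv S (t # G) (EType 0) e e'; is_type S G t \<rbrakk>
    \<Longrightarrow> eqv S G (EPred t) (ELam t e) (ELam t e')"
  using eqv_lam[of S t G "EType 0" e e'] is_type_EType[OF is_type_wf[of S G t]]
  by (auto simp: EPred_def)

text \<open>Predicate transformers are compared on a fresh predicate, so each monad law becomes an
  equation between propositions.\<close>

lemma eqv_ext_wp:
  assumes "emf_typing S G m (wp_ty t)" "emf_typing S G m' (wp_ty t)" "is_type S G t"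
    and "eqv S (EPred t # G) (EType 0) (EApp (elift 0 m) (EVar 0)) (EApp (elift 0 m') (EVar 0))"
  shows "eqv S G (wp_ty t) m m'"
  using eqv_ext[of S G m "EPred t" "EType 0" m'] assms
  by (auto simp: wp_ty_EPred is_type_EPred is_type_EType is_type_wf)

lemma eqv_ERet:
  assumes "eqv S G t e e'"
  shows "eqv S G (wp_ty t) (ERet t e) (ERet t e')"
proof -
  note t = eqvD(1)[OF assms]
  have wf: "emf_wf S (EPred t # G)" using is_type_wf_Cons[OF is_type_EPred[OF t]] .
  have p: "eqv S (EPred t # G) (EPred (elift 0 t)) (EVar 0) (EVar 0)"
    using et_var0[OF is_type_EPred[OF t]] is_type_EPred[OF is_type_elift0[OF t wf]]
    by (simp add: eqv_refl)
  have "eqv S (EPred t # G) (EType 0) (EApp (EVar 0) (elift 0 e)) (EApp (EVar 0) (elift 0 e'))"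
    using eqv_app_pred[OF p eqv_elift0[OF assms wf]] .
  then show ?thesis
    using eqv_lam[of S "EPred t" G "EType 0"] is_type_EPred[OF t] is_type_EType[OF is_type_wf[OF t]]
    by (auto simp: ERet_def wp_ty_EPred)
qed

lemma et_wp_weaken:
  assumes "emf_typing S (t # G) e (wp_ty (elift 0 t'))" "is_type S G t" "emf_wf S (u # G)"
  shows "emf_typing S (elift 0 t # u # G) (elift (Suc 0) e) (wp_ty (elift 0 (elift 0 t')))"
  using emf_typing_elift1[OF assms] by (simp add: elift_elift)

lemma eqv_elift1:
  assumes "eqv S (t # G) t' e e'" "is_type S G t" "emf_wf S (u # G)"
  shows "eqv S (elift 0 t # u # G) (elift (Suc 0) t') (elift (Suc 0) e) (elift (Suc 0) e')"
proof -
  have "emf_wf S (elift 0 t # u # G)" using assms is_type_elift0 is_type_wf_Cons by blast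
  then show ?thesis
    using emf_valid_ren[of S "t # G" "EEq t' e e'" "elift 0 t # u # G" "upr Suc"]
      renames_upr[OF renames_Suc, of t G u] emf_typing_elift1[OF _ assms(2,3)] assms(1)
      emf_typing_elift1[of S t G t' "EType _" u] assms(2,3)
    by (auto simp: eqv_def elift1_ren elift0_ren is_type_def)
qed

lemma eqv_EBnd:
  assumes m: "eqv S G (wp_ty t) m m'" and e: "eqv S (t # G) (wp_ty (elift 0 t')) e e'"
    and t: "is_type S G t" "is_type S G t'"
  shows "eqv S G (wp_ty t') (EBnd t t' m e) (EBnd t t' m' e')"
proof (rule eqv_ext_wp)
  let ?G = "EPred t' # G"
  have wf: "emf_wf S ?G" using is_type_wf_Cons[OF is_type_EPred[OF t(2)]] .
  note t' = is_type_elift0[OF t(1) wf] is_type_elift0[OF t(2) wf]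
  have m': "eqv S ?G (wp_ty (elift 0 t)) (elift 0 m) (elift 0 m')"
    using eqv_elift0[OF m wf] by simp
  have k: "emf_typing S ?G (EVar 0) (EPred (elift 0 t'))"
    using et_var0[OF is_type_EPred[OF t(2)]] by simp
  have k': "eqv S (elift 0 t # ?G) (EPred (elift 0 (elift 0 t'))) (elift 0 (EVar 0)) (elift 0 (EVar 0))"
    using eqv_elift0[OF eqv_refl[OF is_type_EPred[OF t'(2)] k] is_type_wf_Cons[OF t'(1)]] by simp
  have e'': "eqv S (elift 0 t # ?G) (wp_ty (elift 0 (elift 0 t'))) (elift (Suc 0) e) (elift (Suc 0) e')"
    using eqv_elift1[OF e t(1) wf] by (simp add: elift_elift)
  have "eqv S ?G (EType 0) (EApp (elift 0 (EBnd t t' m e)) (EVar 0))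
      (EApp (elift 0 m) (ELam (elift 0 t) (EApp (elift (Suc 0) e) (elift 0 (EVar 0)))))"
    unfolding elift_EBnd using eqv_bnd_app[OF t' eqvD(2)[OF m'] eqvD(2)[OF e''] k] .
  also have "eqv S ?G (EType 0) \<dots>
      (EApp (elift 0 m') (ELam (elift 0 t) (EApp (elift (Suc 0) e') (elift 0 (EVar 0)))))"
    using eqv_app_wp[OF m' eqv_lam_pred[OF eqv_app_wp[OF e'' k'] t'(1)]] .
  also have "eqv S ?G (EType 0) \<dots> (EApp (elift 0 (EBnd t t' m' e')) (EVar 0))"
    unfolding elift_EBnd using eqv_sym[OF eqv_bnd_app[OF t' eqvD(3)[OF m'] eqvD(3)[OF e''] k]] .
  finally show "eqv S ?G (EType 0) (EApp (elift 0 (EBnd t t' m e)) (EVar 0))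
    (EApp (elift 0 (EBnd t t' m' e')) (EVar 0))" .
qed (use eqvD[OF m] eqvD[OF e] t in \<open>auto intro: et_EBnd\<close>)

text \<open>Run on a predicate p, the left side is m (\<lambda>x. ret x p); beta under the binder
  and then eta give m p.\<close>

lemma eqv_bnd_ret:
  assumes m: "emf_typing S G m (wp_ty t)" and t: "is_type S G t"
  shows "eqv S G (wp_ty t) (EBnd t t m (ERet (elift 0 t) (EVar 0))) m"
proof (rule eqv_ext_wp)
  let ?G = "EPred t # G"
  have wf: "emf_wf S ?G" using is_type_wf_Cons[OF is_type_EPred[OF t]] .
  note t' = is_type_elift0[OF t wf]
  have m': "emf_typing S ?G (elift 0 m) (wp_ty (elift 0 t))"
    using emf_typing_elift0[OF m wf] by simp
  have k: "emf_typing S ?G (EVar 0) (EPred (elift 0 t))"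
    using et_var0[OF is_type_EPred[OF t]] by simp
  have wf': "emf_wf S (elift 0 t # ?G)" using is_type_wf_Cons[OF t'] .
  note t'' = is_type_elift0[OF t' wf']
  have k': "emf_typing S (elift 0 t # ?G) (elift 0 (EVar 0)) (EPred (elift 0 (elift 0 t)))"
    using emf_typing_elift0[OF k wf'] by simp
  have x: "emf_typing S (elift 0 t # ?G) (EVar 0) (elift 0 (elift 0 t))" using et_var0[OF t'] .
  have r: "emf_typing S (elift 0 t # ?G) (ERet (elift 0 (elift 0 t)) (EVar 0)) (wp_ty (elift 0 (elift 0 t)))"
    using et_ERet[OF x t''] .
  have "eqv S ?G (EType 0) (EApp (EBnd (elift 0 t) (elift 0 t) (elift 0 m) (ERet (elift 0 (elift 0 t)) (EVar 0))) (EVar 0))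
    (EApp (elift 0 m) (ELam (elift 0 t) (EApp (ERet (elift 0 (elift 0 t)) (EVar 0)) (elift 0 (EVar 0)))))"
    using eqv_bnd_app[OF t' t' m' r k] .
  also have "eqv S ?G (EType 0) \<dots> (EApp (elift 0 m) (ELam (elift 0 t) (EApp (elift 0 (EVar 0)) (EVar 0))))"
    using eqv_app_wp[OF eqv_refl[OF is_type_wp_ty[OF t'] m'] eqv_lam_pred[OF eqv_ret_app[OF x t'' k'] t']] .
  also have "eqv S ?G (EType 0) \<dots> (EApp (elift 0 m) (EVar 0))"
    using eqv_app_wp[OF eqv_refl[OF is_type_wp_ty[OF t'] m']]
      eqv_eta[of S ?G "EVar 0" "elift 0 t" "EType 0"] k t' is_type_EType[OF wf]
    by (simp add: EPred_def)
  finally show "eqv S ?G (EType 0) (EApp (elift 0 (EBnd t t m (ERet (elift 0 t) (EVar 0)))) (EVar 0))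
      (EApp (elift 0 m) (EVar 0))"
    by (simp add: elift_elift)
  have "emf_typing S (t # G) (ERet (elift 0 t) (EVar 0)) (wp_ty (elift 0 t))"
    using et_ERet[OF et_var0[OF t] is_type_elift0[OF t is_type_wf_Cons[OF t]]] .
  then show "emf_typing S G (EBnd t t m (ERet (elift 0 t) (EVar 0))) (wp_ty t)"
    using et_EBnd[OF t t m] by simp
qed (use assms in auto)

text \<open>Run on p, the bind hands \<lambda>x. f x p to the return, which applies it to
  \<open>e\<close>; both sides become f e p.\<close>

lemma eqv_ret_bnd:
  assumes e: "emf_typing S G e t" and f: "emf_typing S G f (EFun t (wp_ty t'))"
    and t: "is_type S G t" "is_type S G t'"
  shows "eqv S G (wp_ty t') (EBnd t t' (ERet t e) (EApp (elift 0 f) (EVar 0))) (EApp f e)"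
proof (rule eqv_ext_wp)
  let ?G = "EPred t' # G"
  \<comment> \<open>Stated for any context, because it is used in \<open>G\<close> and again once
    the predicate variable has been added.\<close>
  have body: "emf_typing S (t # G) (EApp (elift 0 f) (EVar 0)) (wp_ty (elift 0 t'))"
    if "emf_typing S G f (EFun t (wp_ty t'))" "is_type S G t" for G t t' f
    using emf_typing_elift0[OF that(1) is_type_wf_Cons[OF that(2)]] et_var0[OF that(2)]
    by (auto intro: et_app_fun)
  show "emf_typing S G (EBnd t t' (ERet t e) (EApp (elift 0 f) (EVar 0))) (wp_ty t')"
    using et_EBnd[OF t et_ERet[OF e t(1)] body[OF f t(1)]] .
  have wf: "emf_wf S ?G" using is_type_wf_Cons[OF is_type_EPred[OF t(2)]] .
  note t' = is_type_elift0[OF t(1) wf] is_type_elift0[OF t(2) wf]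
  have e': "emf_typing S ?G (elift 0 e) (elift 0 t)" using emf_typing_elift0[OF e wf] .
  have f': "emf_typing S ?G (elift 0 f) (EFun (elift 0 t) (wp_ty (elift 0 t')))"
    using emf_typing_elift0[OF f wf] by simp
  have k: "emf_typing S ?G (EVar 0) (EPred (elift 0 t'))"
    using et_var0[OF is_type_EPred[OF t(2)]] by simp
  note c = et_bnd_cont[OF t' body[OF f' t'(1)] k]
  have "eqv S ?G (EType 0) (EApp (elift 0 (EBnd t t' (ERet t e) (EApp (elift 0 f) (EVar 0)))) (EVar 0))
     (EApp (ERet (elift 0 t) (elift 0 e)) (ELam (elift 0 t) (EApp (EApp (elift 0 (elift 0 f)) (EVar 0)) (elift 0 (EVar 0)))))"
    using eqv_bnd_app[OF t' et_ERet[OF e' t'(1)] body[OF f' t'(1)] k] by (simp add: elift_elift)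
  also have "eqv S ?G (EType 0) \<dots>
     (EApp (ELam (elift 0 t) (EApp (EApp (elift 0 (elift 0 f)) (EVar 0)) (elift 0 (EVar 0)))) (elift 0 e))"
    using eqv_ret_app[OF e' t'(1) c(1)] .
  also have "eqv S ?G (EType 0) \<dots> (EApp (EApp (elift 0 f) (elift 0 e)) (EVar 0))"
    using eqv_beta[OF t'(1) is_type_EType[OF wf, of 0] _ e', of "EApp (EApp (elift 0 (elift 0 f)) (EVar 0)) (elift 0 (EVar 0))"]
      c(2) et_app_wp[OF et_app_fun[OF f' e'] k] by simp
  finally show "eqv S ?G (EType 0) (EApp (elift 0 (EBnd t t' (ERet t e) (EApp (elift 0 f) (EVar 0)))) (EVar 0))
     (EApp (elift 0 (EApp f e)) (EVar 0))" by simp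
qed (use assms in \<open>auto intro: et_app_fun\<close>)

text \<open>Run on p, both sides become m (\<lambda>x. e1 (\<lambda>y. e2 p)).\<close>

lemma eqv_bnd_assoc:
  assumes m: "emf_typing S G m (wp_ty t)"
    and e1: "emf_typing S (t # G) e1 (wp_ty (elift 0 t'))"
    and e2: "emf_typing S (t' # G) e2 (wp_ty (elift 0 t''))"
    and t: "is_type S G t" "is_type S G t'" "is_type S G t''"
  shows "eqv S G (wp_ty t'') (EBnd t' t'' (EBnd t t' m e1) e2)
    (EBnd t t'' m (EBnd (elift 0 t') (elift 0 t'') e1 (elift (Suc 0) e2)))"
proof (rule eqv_ext_wp)
  have inner: "emf_typing S (t # G) (EBnd (elift 0 t') (elift 0 t'') e1 (elift (Suc 0) e2)) (wp_ty (elift 0 t''))"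
    if "emf_typing S (t # G) e1 (wp_ty (elift 0 t'))" "emf_typing S (t' # G) e2 (wp_ty (elift 0 t''))"
      "is_type S G t" "is_type S G t'" "is_type S G t''" for G t t' t'' e1 e2
  proof -
    have wf: "emf_wf S (t # G)" using that is_type_wf_Cons by blast
    show ?thesis
      using et_EBnd[OF is_type_elift0[OF that(4) wf] is_type_elift0[OF that(5) wf] that(1)
         et_wp_weaken[OF that(2,4) wf]] .
  qed
  show "emf_typing S G (EBnd t' t'' (EBnd t t' m e1) e2) (wp_ty t'')"
    using et_EBnd[OF t(2,3) et_EBnd[OF t(1,2) m e1] e2] .
  show "emf_typing S G (EBnd t t'' m (EBnd (elift 0 t') (elift 0 t'') e1 (elift (Suc 0) e2))) (wp_ty t'')"
    using et_EBnd[OF t(1,3) m inner[OF e1 e2 t]] .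
  let ?G = "EPred t'' # G"
  have wf: "emf_wf S ?G" using is_type_wf_Cons[OF is_type_EPred[OF t(3)]] .
  note u = is_type_elift0[OF t(1) wf] is_type_elift0[OF t(2) wf] is_type_elift0[OF t(3) wf]
  have k: "emf_typing S ?G (EVar 0) (EPred (elift 0 t''))"
    using et_var0[OF is_type_EPred[OF t(3)]] by simp
  have m': "emf_typing S ?G (elift 0 m) (wp_ty (elift 0 t))"
    using emf_typing_elift0[OF m wf] by simp
  let ?f1 = "elift (Suc 0) e1" and ?f2 = "elift (Suc 0) e2"
  note f1 = et_wp_weaken[OF e1 t(1) wf] and f2 = et_wp_weaken[OF e2 t(2) wf]
  let ?k2 = "ELam (elift 0 t') (EApp ?f2 (elift 0 (EVar 0)))"
  note k2 = et_bnd_cont[OF u(2,3) f2 k]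
  have "eqv S ?G (EType 0) (EApp (elift 0 (EBnd t' t'' (EBnd t t' m e1) e2)) (EVar 0))
     (EApp (EBnd (elift 0 t) (elift 0 t') (elift 0 m) ?f1) ?k2)"
    using eqv_bnd_app[OF u(2,3) et_EBnd[OF u(1,2) m' f1] f2 k] by simp
  also have "eqv S ?G (EType 0) \<dots> (EApp (elift 0 m) (ELam (elift 0 t) (EApp ?f1 (elift 0 ?k2))))"
    using eqv_bnd_app[OF u(1,2) m' f1 k2(1)] .
  also have "eqv S ?G (EType 0) \<dots> (EApp (elift 0 m) (ELam (elift 0 t)
     (EApp (EBnd (elift 0 (elift 0 t')) (elift 0 (elift 0 t'')) ?f1 (elift (Suc 0) ?f2)) (elift 0 (EVar 0)))))"
  proof -
    have wf': "emf_wf S (elift 0 t # ?G)" using u is_type_wf_Cons by blast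
    have k': "emf_typing S (elift 0 t # ?G) (elift 0 (EVar 0)) (EPred (elift 0 (elift 0 t'')))"
      using emf_typing_elift0[OF k wf'] by simp
    have "eqv S (elift 0 t # ?G) (EType 0)
      (EApp (EBnd (elift 0 (elift 0 t')) (elift 0 (elift 0 t'')) ?f1 (elift (Suc 0) ?f2)) (elift 0 (EVar 0)))
      (EApp ?f1 (elift 0 ?k2))"
      using eqv_bnd_app[OF is_type_elift0[OF u(2) wf'] is_type_elift0[OF u(3) wf'] f1
          et_wp_weaken[OF f2 u(2) wf'] k'] by (simp add: elift_elift)
    then show ?thesis
      using eqv_app_wp[OF eqv_refl[OF is_type_wp_ty[OF u(1)] m'] eqv_lam_pred[OF _ u(1)]] eqv_sym
      by blast
  qed
  also have "eqv S ?G (EType 0) \<dots> (EApp (EBnd (elift 0 t) (elift 0 t'') (elift 0 m)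
     (EBnd (elift 0 (elift 0 t')) (elift 0 (elift 0 t'')) ?f1 (elift (Suc 0) ?f2))) (EVar 0))"
    using eqv_sym[OF eqv_bnd_app[OF u(1,3) m' inner[OF f1 f2 u] k]] .
  finally show "eqv S ?G (EType 0) (EApp (elift 0 (EBnd t' t'' (EBnd t t' m e1) e2)) (EVar 0))
     (EApp (elift 0 (EBnd t t'' m (EBnd (elift 0 t') (elift 0 t'') e1 (elift (Suc 0) e2)))) (EVar 0))"
    by (simp add: elift_elift)
qed (use t in auto)

section \<open>Translated types\<close>

text \<open>What typing and renaming of translated types need. It passes to the parts of every type
  constructor, regardless of the split into \<open>is_A\<close> and \<open>is_C\<close>.\<close>

primrec tvars_below :: "nat \<Rightarrow> 'b dty \<Rightarrow> bool" where
  "tvars_below D (DTVar i) = (i < D)"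
| "tvars_below D (DBase b) = True"
| "tvars_below D (DArr e H H') = (tvars_below D H \<and> tvars_below D H')"
| "tvars_below D (DSum H H') = (tvars_below D H \<and> tvars_below D H')"
| "tvars_below D (DProd H H') = (tvars_below D H \<and> tvars_below D H')"

lemma is_A_tvars_below: "is_A D H \<Longrightarrow> tvars_below D H"
  by (induction D H rule: is_A.induct) auto

lemma is_C_tvars_below: "is_C D H \<Longrightarrow> tvars_below D H"
  by (induction D H rule: is_C.induct) (auto dest: is_A_tvars_below)

lemma is_H_tvars_below: "is_H D H \<Longrightarrow> tvars_below D H"
  by (auto simp: is_H_def dest: is_A_tvars_below is_C_tvars_below)

lemma star_comp_ty_simps [simp]:
  "star_comp_ty k H NonEff = star_ty k H"
  "star_comp_ty k H Tau = wp_ty (star_ty k H)"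
  by (simp_all add: star_comp_ty_def)

lemma star_ty_DArr: "star_ty k (DArr e H K) = EFun (star_ty k H) (star_comp_ty k K e)"
  by (cases e) auto

text \<open>All that a translated type can see of a renaming: the type variables move as a block
  from depth \<open>d\<close> to depth \<open>d'\<close>.\<close>

definition tren :: "nat \<Rightarrow> (nat \<Rightarrow> nat) \<Rightarrow> nat \<Rightarrow> nat \<Rightarrow> bool" where
  "tren D r d d' \<longleftrightarrow> (\<forall>i < D. r (d + i) = d' + i)"

lemma tren_upr: "tren D r d d' \<Longrightarrow> tren D (upr r) (Suc d) (Suc d')"
  by (simp add: tren_def)

lemma tren_liftr: "j \<le> d \<Longrightarrow> tren D (liftr j) d (Suc d)"
  by (simp add: tren_def liftr_def)

lemma tren_comp: "tren D r d d' \<Longrightarrow> tren D s d' d'' \<Longrightarrow> tren D (s \<circ> r) d d''"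
  by (simp add: tren_def)

lemma ren_star_ty: "\<lbrakk> tvars_below D H; tren D r d d' \<rbrakk> \<Longrightarrow> ren r (star_ty d H) = star_ty d' H"
  by (induction d H rule: star_ty.induct) (auto simp: tren_def)

lemma elift_star_ty [simp]: "j \<le> d \<Longrightarrow> elift j (star_ty d H) = star_ty (Suc d) H"
  by (induction d H rule: star_ty.induct) auto

lemma elift_star_comp_ty [simp]: "j \<le> d \<Longrightarrow> elift j (star_comp_ty d H e) = star_comp_ty (Suc d) H e"
  by (cases e) auto

lemma esubst_star_ty [simp]: "j \<le> d \<Longrightarrow> esubst j u (star_ty (Suc d) H) = star_ty d H"
  by (metis elift_star_ty esubst_elift)

lemma ren_star_comp_ty:
  "\<lbrakk> tvars_below D H; tren D r d d' \<rbrakk> \<Longrightarrow> ren r (star_comp_ty d H e) = star_comp_ty d' H e"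
  by (cases e) (auto simp: ren_star_ty)

text \<open>The last \<open>D\<close> entries of \<open>G\<close> are the type variables, and \<open>d\<close> entries lie above them.\<close>

definition tctx :: "('b, 'k) signature \<Rightarrow> nat \<Rightarrow> nat \<Rightarrow> ('b, 'k) ectx \<Rightarrow> bool" where
  "tctx S D d G \<longleftrightarrow> emf_wf S G \<and> length G = d + D \<and> (\<forall>i < D. G ! (d + i) = EType 0)"

lemma tctx_wf: "tctx S D d G \<Longrightarrow> emf_wf S G"
  by (simp add: tctx_def)

text \<open>The new entry may be a translated type, a type of predicates or, since formulas are
  terms of type \<open>EType 0\<close>, a logical hypothesis. All three occur in the contexts used
  for the relation.\<close>

lemma tctx_Cons: "\<lbrakk> tctx S D d G; is_type S G t \<rbrakk> \<Longrightarrow> tctx S D (Suc d) (t # G)"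
  by (simp add: tctx_def is_type_wf_Cons)

lemma elift_funpow_EType: "(elift k ^^ n) (EType m) = EType m"
  by (induction n) auto

lemma is_type_star_ty: "\<lbrakk> tctx S D d G; tvars_below D H \<rbrakk> \<Longrightarrow> is_type S G (star_ty d H)"
proof (induction d H rule: star_ty.induct)
  case (1 k i)
  then show ?case
    using et_var[of S G "k + i"]
    by (auto simp: tctx_def is_type_def elift_funpow_EType simp del: funpow.simps)
next
  case (2 k b)
  then show ?case by (auto simp: tctx_def is_type_def intro: et_base)
qed (auto intro: is_type_EFun is_type_wp_ty is_type_ESum is_type_EProd)

lemma is_type_star_comp_ty:
  "\<lbrakk> tctx S D d G; tvars_below D H \<rbrakk> \<Longrightarrow> is_type S G (star_comp_ty d H e)"
  by (cases e) (auto intro: is_type_star_ty is_type_wp_ty)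

lemma tctx_star_Cons:
  "\<lbrakk> tctx S D d G; tvars_below D H \<rbrakk> \<Longrightarrow> tctx S D (Suc d) (star_ty d H # G)"
  by (blast intro: tctx_Cons is_type_star_ty)

section \<open>The relation between translations at different types\<close>

text \<open>The formula \<open>R\<close> relates variable 1 to variable 0.\<close>

definition cont_rel ::
  "nat \<Rightarrow> 'b dty \<Rightarrow> 'b dty \<Rightarrow> ('b, 'k) etm \<Rightarrow> ('b, 'k) etm \<Rightarrow> ('b, 'k) etm \<Rightarrow> ('b, 'k) etm" where
  "cont_rel d A A' R k k' = EAll (star_ty d A) (EAll (star_ty (Suc d) A') (EImp R
     (EEq (EType 0) (EApp (elift 0 (elift 0 k)) (EVar 1)) (EApp (elift 0 (elift 0 k')) (EVar 0)))))"

text \<open>The lifting of \<open>R\<close> through the continuation monad: transformers are related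
  if they agree, as propositions, on related continuations. \<open>R\<close> stands under four
  quantifiers (two predicates, two values), which is why \<open>relc\<close> supplies it at depth
  \<open>d + 4\<close>.\<close>

definition wp_rel ::
  "nat \<Rightarrow> 'b dty \<Rightarrow> 'b dty \<Rightarrow> ('b, 'k) etm \<Rightarrow> ('b, 'k) etm \<Rightarrow> ('b, 'k) etm \<Rightarrow> ('b, 'k) etm" where
  "wp_rel d A A' R m m' = EAll (EPred (star_ty d A)) (EAll (EPred (star_ty (Suc d) A'))
     (EImp (cont_rel (Suc (Suc d)) A A' R (EVar 1) (EVar 0))
     (EEq (EType 0) (EApp (elift 0 (elift 0 m)) (EVar 1)) (EApp (elift 0 (elift 0 m')) (EVar 0)))))"

text \<open>The types of two translations of the same term can
  differ only in the unannotated summands of injections, and a term of such a sum type is never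
  analysed by an (annotated) case, so distinct sum types need no constraint at all.\<close>

function (sequential)
  rel :: "nat \<Rightarrow> 'b dty \<Rightarrow> 'b dty \<Rightarrow> ('b, 'k) etm \<Rightarrow> ('b, 'k) etm \<Rightarrow> ('b, 'k) etm" and
  relc :: "nat \<Rightarrow> eff \<Rightarrow> eff \<Rightarrow> 'b dty \<Rightarrow> 'b dty \<Rightarrow> ('b, 'k) etm \<Rightarrow> ('b, 'k) etm \<Rightarrow> ('b, 'k) etm"
where
  "rel d (DArr e H K) (DArr e' H' K') a b =
     (if DArr e H K = DArr e' H' K' then EEq (star_ty d (DArr e H K)) a b
      else if H = H' then EAll (star_ty d H) (relc (Suc d) e e' K K'
        (EApp (elift 0 a) (EVar 0)) (EApp (elift 0 b) (EVar 0)))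
      else EFalse)"
| "rel d (DProd H K) (DProd H' K') a b =
     (if DProd H K = DProd H' K' then EEq (star_ty d (DProd H K)) a b
      else EAnd (rel d H H' (EFst a) (EFst b)) (rel d K K' (ESnd a) (ESnd b)))"
| "rel d (DSum H K) (DSum H' K') a b =
     (if DSum H K = DSum H' K' then EEq (star_ty d (DSum H K)) a b else ETrue)"
| "rel d H H' a b = (if H = H' then EEq (star_ty d H) a b else EFalse)"
| "relc d NonEff NonEff H H' a b = rel d H H' a b"
| "relc d Tau Tau H H' a b = (if H = H' then EEq (wp_ty (star_ty d H)) a b else
     wp_rel d H H' (rel (Suc (Suc (Suc (Suc d)))) H H' (EVar 1) (EVar 0)) a b)"
| "relc d e e' H H' a b = EFalse"
  by pat_completeness auto
termination
  \<comment> \<open>\<open>relc\<close> calls \<open>rel\<close> on the same types, so it gets the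
    odd value just above; passing from a type to a part of it lowers the value by at least
    2.\<close>
  by (relation "measure (case_sum (\<lambda>(d, H, H', a, b). 2 * size H) (\<lambda>(d, e, e', H, H', a, b). 2 * size H + 1))")
    auto

lemma rel_same: "rel d H H a b = EEq (star_ty d H) a b"
  by (cases H) auto

lemma relc_same: "relc d e e H H a b = EEq (star_comp_ty d H e) a b"
  by (cases e) (auto simp: rel_same)

section \<open>Renaming, substitution and typing of the relation formulas\<close>

lemma ren_cont_rel:
  "\<lbrakk> tvars_below D A; tvars_below D A'; tren D r d d' \<rbrakk> \<Longrightarrow>
   ren r (cont_rel d A A' R k k') = cont_rel d' A A' (ren (upr (upr r)) R) (ren r k) (ren r k')"
  by (simp add: cont_rel_def ren_upr_elift0 ren_star_ty[of D A r d d']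
      ren_star_ty[OF _ tren_upr, of D A' r d d'])

lemma ren_wp_rel:
  "\<lbrakk> tvars_below D A; tvars_below D A'; tren D r d d' \<rbrakk> \<Longrightarrow>
   ren r (wp_rel d A A' R m m') =
   wp_rel d' A A' (ren (upr (upr (upr (upr r)))) R) (ren r m) (ren r m')"
  by (simp add: wp_rel_def ren_upr_elift0 ren_star_ty[of D A r d d']
      ren_star_ty[OF _ tren_upr, of D A' r d d']
      ren_cont_rel[OF _ _ tren_upr[OF tren_upr], of D A A' r d d'])

lemma
  fixes a b :: "('b, 'k) etm"
  shows ren_rel: "\<lbrakk> tvars_below D H; tvars_below D H'; tren D r d d' \<rbrakk> \<Longrightarrow>
      ren r (rel d H H' a b) = rel d' H H' (ren r a) (ren r b)"
    and ren_relc: "\<lbrakk> tvars_below D H; tvars_below D H'; tren D r d d' \<rbrakk> \<Longrightarrow>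
      ren r (relc d e e' H H' a b) = relc d' e e' H H' (ren r a) (ren r b)"
proof (induction d H H' a b and d e e' H H' a b arbitrary: r d' and r d' rule: rel_relc.induct)
  case (1 d e H K e' H' K' a b)
  then show ?case
    using tren_upr[OF 1(4)]
    by (auto simp: ren_upr_elift0 ren_star_ty[of D _ r d d'] ren_star_comp_ty[of D _ r d d'] star_ty_DArr
        simp del: star_ty.simps)
next
  case (6 d H H' a b)
  then show ?case
    using tren_upr[OF tren_upr[OF tren_upr[OF tren_upr[OF 6(4)]]]]
    by (simp add: ren_wp_rel[OF 6(2,3)] ren_star_ty[of D])
qed (auto simp: ren_star_ty[where D=D] tren_def[of D r d d' for r d d'])

lemma elift_relc:
  "\<lbrakk> tvars_below D H; tvars_below D H'; j \<le> d \<rbrakk> \<Longrightarrow>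
   elift j (relc d e e' H H' a b) = relc (Suc d) e e' H H' (elift j a) (elift j b)"
  using ren_relc[OF _ _ tren_liftr] by (simp add: elift_ren)

lemma esubst_cont_rel:
  "j \<le> d \<Longrightarrow> esubst j u (cont_rel (Suc d) A A' R k k') =
   cont_rel d A A' (esubst (Suc (Suc j)) (elift 0 (elift 0 u)) R) (esubst j u k) (esubst j u k')"
  by (simp add: cont_rel_def elift_esubst)

lemma esubst_wp_rel:
  "j \<le> d \<Longrightarrow> esubst j u (wp_rel (Suc d) A A' R m m') =
   wp_rel d A A' (esubst (Suc (Suc (Suc (Suc j)))) (elift 0 (elift 0 (elift 0 (elift 0 u)))) R)
     (esubst j u m) (esubst j u m')"
  by (simp add: wp_rel_def elift_esubst esubst_cont_rel)

text \<open>Liftings are covered by renaming, but instantiating the quantifiers and rewriting along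
  equations substitute arbitrary terms. The bound \<open>j \<le> d\<close> keeps the substituted
  variable above the type variables.\<close>

lemma
  fixes a b :: "('b, 'k) etm"
  shows esubst_rel: "j \<le> d \<Longrightarrow> esubst j u (rel (Suc d) H H' a b) = rel d H H' (esubst j u a) (esubst j u b)"
    and esubst_relc: "j \<le> d \<Longrightarrow> esubst j u (relc (Suc d) e e' H H' a b) = relc d e e' H H' (esubst j u a) (esubst j u b)"
proof (induction "Suc d" H H' a b and "Suc d" e e' H H' a b arbitrary: j u d and j u d rule: rel_relc.induct)
qed (auto simp: elift_esubst esubst_wp_rel simp del: star_ty.simps)

lemma et_EEq: "\<lbrakk> is_type S G t; emf_typing S G a t; emf_typing S G b t \<rbrakk>
    \<Longrightarrow> emf_typing S G (EEq t a b) (EType 0)"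
  by (auto simp: is_type_def intro: et_eq)

lemma et_EAll: "\<lbrakk> is_type S G t; emf_typing S (t # G) p (EType 0) \<rbrakk>
    \<Longrightarrow> emf_typing S G (EAll t p) (EType 0)"
  by (auto simp: is_type_def intro: et_all)

lemma ev_EAllI: "\<lbrakk> is_type S G t; emf_valid S (t # G) p \<rbrakk> \<Longrightarrow> emf_valid S G (EAll t p)"
  by (auto simp: is_type_def intro: ev_allI)

lemma is_type_if: "emf_typing S G t (EType n) \<Longrightarrow> is_type S G t"
  by (auto simp: is_type_def)

lemma ev_var0: "emf_typing S G p (EType 0) \<Longrightarrow> emf_valid S (p # G) (elift 0 p)"
  using ev_hyp[of S "p # G" 0 "elift 0 p"] et_var0[OF is_type_if]
    emf_typing_elift0[OF _ is_type_wf_Cons[OF is_type_if], of S G p "EType 0" p 0] by auto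

lemma et_cont_rel:
  assumes G: "tctx S D d G" and A: "tvars_below D A" "tvars_below D A'"
    and k: "emf_typing S G k (EPred (star_ty d A))" "emf_typing S G k' (EPred (star_ty d A'))"
    and R: "emf_typing S (star_ty (Suc d) A' # star_ty d A # G) R (EType 0)"
  shows "emf_typing S G (cont_rel d A A' R k k') (EType 0)"
proof -
  note G1 = tctx_star_Cons[OF G A(1)]
  note G2 = tctx_star_Cons[OF G1 A(2)]
  have k1: "emf_typing S (star_ty (Suc d) A' # star_ty d A # G) (elift 0 (elift 0 k))
      (EPred (star_ty (Suc (Suc d)) A))"
    using emf_typing_elift0[OF emf_typing_elift0[OF k(1) tctx_wf[OF G1]] tctx_wf[OF G2]] by simp
  have k2: "emf_typing S (star_ty (Suc d) A' # star_ty d A # G) (elift 0 (elift 0 k'))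
      (EPred (star_ty (Suc (Suc d)) A'))"
    using emf_typing_elift0[OF emf_typing_elift0[OF k(2) tctx_wf[OF G1]] tctx_wf[OF G2]] by simp
  have y: "emf_typing S (star_ty (Suc d) A' # star_ty d A # G) (EVar 0) (star_ty (Suc (Suc d)) A')"
    using et_var0[OF is_type_star_ty[OF G1 A(2)]] by simp
  have x: "emf_typing S (star_ty (Suc d) A' # star_ty d A # G) (EVar 1) (star_ty (Suc (Suc d)) A)"
    using et_var_Suc[OF et_var0[OF is_type_star_ty[OF G A(1)]] tctx_wf[OF G2]] by simp
  show ?thesis unfolding cont_rel_def
    using et_EAll[OF is_type_star_ty[OF G A(1)] et_EAll[OF is_type_star_ty[OF G1 A(2)]
      et_imp[OF R et_EEq[OF is_type_EType[OF tctx_wf[OF G2]] et_app_pred[OF k1 x] et_app_pred[OF k2 y]]]]] .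
qed

lemma tctx_EPred_Cons:
  "\<lbrakk> tctx S D d G; tvars_below D H \<rbrakk> \<Longrightarrow> tctx S D (Suc d) (EPred (star_ty d H) # G)"
  by (blast intro: tctx_Cons is_type_star_ty is_type_EPred)

lemma pred_pair_ctx:
  assumes G: "tctx S D d G" and A: "tvars_below D A" "tvars_below D A'"
  defines "G2 \<equiv> EPred (star_ty (Suc d) A') # EPred (star_ty d A) # G"
  shows "tctx S D (Suc (Suc d)) G2"
    "emf_typing S G2 (EVar 1) (EPred (star_ty (Suc (Suc d)) A))"
    "emf_typing S G2 (EVar 0) (EPred (star_ty (Suc (Suc d)) A'))"
proof -
  note G1 = tctx_EPred_Cons[OF G A(1)]
  show G2: "tctx S D (Suc (Suc d)) G2" unfolding G2_def using tctx_EPred_Cons[OF G1 A(2)] .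
  show "emf_typing S G2 (EVar 0) (EPred (star_ty (Suc (Suc d)) A'))"
    using et_var0[OF is_type_EPred[OF is_type_star_ty[OF G1 A(2)]]] by (simp add: G2_def)
  show "emf_typing S G2 (EVar 1) (EPred (star_ty (Suc (Suc d)) A))"
    using et_var_Suc[OF et_var0[OF is_type_EPred[OF is_type_star_ty[OF G A(1)]]]] tctx_wf[OF G2]
    by (simp add: G2_def)
qed

lemma star_pair_ctx:
  assumes G: "tctx S D d G" and A: "tvars_below D A" "tvars_below D A'"
  defines "G2 \<equiv> star_ty (Suc d) A' # star_ty d A # G"
  shows "tctx S D (Suc (Suc d)) G2"
    "emf_typing S G2 (EVar 1) (star_ty (Suc (Suc d)) A)"
    "emf_typing S G2 (EVar 0) (star_ty (Suc (Suc d)) A')"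
proof -
  note G1 = tctx_star_Cons[OF G A(1)]
  show G2: "tctx S D (Suc (Suc d)) G2" unfolding G2_def using tctx_star_Cons[OF G1 A(2)] .
  show "emf_typing S G2 (EVar 0) (star_ty (Suc (Suc d)) A')"
    using et_var0[OF is_type_star_ty[OF G1 A(2)]] by (simp add: G2_def)
  show "emf_typing S G2 (EVar 1) (star_ty (Suc (Suc d)) A)"
    using et_var_Suc[OF et_var0[OF is_type_star_ty[OF G A(1)]]] tctx_wf[OF G2]
    by (simp add: G2_def)
qed

lemma et_wp_rel:
  assumes G: "tctx S D d G" and A: "tvars_below D A" "tvars_below D A'"
    and m: "emf_typing S G m (wp_ty (star_ty d A))" "emf_typing S G m' (wp_ty (star_ty d A'))"
    and R: "\<And>G. tctx S D (Suc (Suc d)) G \<Longrightarrow>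
      emf_typing S (star_ty (Suc (Suc (Suc d))) A' # star_ty (Suc (Suc d)) A # G) R (EType 0)"
  shows "emf_typing S G (wp_rel d A A' R m m') (EType 0)"
proof -
  let ?G2 = "EPred (star_ty (Suc d) A') # EPred (star_ty d A) # G"
  note G1 = tctx_EPred_Cons[OF G A(1)] and G2 = pred_pair_ctx[OF G A]
  have m1: "emf_typing S ?G2 (elift 0 (elift 0 m)) (wp_ty (star_ty (Suc (Suc d)) A))"
    using emf_typing_elift0[OF emf_typing_elift0[OF m(1) tctx_wf[OF G1]] tctx_wf[OF G2(1)]] by simp
  have m2: "emf_typing S ?G2 (elift 0 (elift 0 m')) (wp_ty (star_ty (Suc (Suc d)) A'))"
    using emf_typing_elift0[OF emf_typing_elift0[OF m(2) tctx_wf[OF G1]] tctx_wf[OF G2(1)]] by simp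
  note c = et_cont_rel[OF G2(1) A G2(2,3) R[OF G2(1)]]
  show ?thesis unfolding wp_rel_def
    using et_EAll[OF is_type_EPred[OF is_type_star_ty[OF G A(1)]]
      et_EAll[OF is_type_EPred[OF is_type_star_ty[OF G1 A(2)]]
      et_imp[OF c et_EEq[OF is_type_EType[OF tctx_wf[OF G2(1)]]
        et_app_wp[OF m1 G2(2)] et_app_wp[OF m2 G2(3)]]]]] .
qed

text \<open>Falsity elimination, implication introduction, substitution and case analysis on sums
  all ask that the formula be a proposition, so the relation must be typed before it can be
  used.\<close>

lemma
  fixes a b :: "('b, 'k) etm"
  shows et_rel: "\<lbrakk> tctx S D d G; tvars_below D H; tvars_below D H';
      emf_typing S G a (star_ty d H); emf_typing S G b (star_ty d H') \<rbrakk>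
      \<Longrightarrow> emf_typing S G (rel d H H' a b) (EType 0)"
    and et_relc: "\<lbrakk> tctx S D d G; tvars_below D H; tvars_below D H';
      emf_typing S G a (star_comp_ty d H e); emf_typing S G b (star_comp_ty d H' e') \<rbrakk>
      \<Longrightarrow> emf_typing S G (relc d e e' H H' a b) (EType 0)"
proof (induction d H H' a b and d e e' H H' a b arbitrary: G and G rule: rel_relc.induct)
  case (1 d e H K e' H' K' a b)
  show ?case
  proof (cases "H = H' \<and> DArr e H K \<noteq> DArr e' H' K'")
    case True
    have tv: "tvars_below D H" "tvars_below D K" "tvars_below D K'" using 1 by auto
    let ?G = "star_ty d H # G"
    note G1 = tctx_star_Cons[OF \<open>tctx S D d G\<close> tv(1)]
    have x: "emf_typing S ?G (EVar 0) (star_ty (Suc d) H)"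
      using et_var0[OF is_type_star_ty[OF \<open>tctx S D d G\<close> tv(1)]] by simp
    have "emf_typing S ?G (EApp (elift 0 a) (EVar 0)) (star_comp_ty (Suc d) K e)"
      using emf_typing_elift0[OF 1(5) tctx_wf[OF G1]] x unfolding star_ty_DArr
      by (auto intro: et_app_fun)
    moreover have "emf_typing S ?G (EApp (elift 0 b) (EVar 0)) (star_comp_ty (Suc d) K' e')"
      using emf_typing_elift0[OF 1(6) tctx_wf[OF G1]] x True unfolding star_ty_DArr
      by (auto intro: et_app_fun)
    ultimately have "emf_typing S ?G (relc (Suc d) e e' K K' (EApp (elift 0 a) (EVar 0))
        (EApp (elift 0 b) (EVar 0))) (EType 0)"
      using 1(1)[OF _ _ G1 tv(2,3)] True by blast
    then show ?thesis
      using True et_EAll[OF is_type_star_ty[OF \<open>tctx S D d G\<close> tv(1)]] by auto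
  next
    case False
    then show ?thesis
      using 1(2-) is_type_star_ty[OF 1(2,3)] by (auto simp del: star_ty.simps intro: et_EEq et_false tctx_wf)
  qed
next
  case (2 d H K H' K' a b)
  then show ?case
    using is_type_star_ty[OF \<open>tctx S D d G\<close>, of "DProd H K"]
    by (auto intro!: et_EEq et_and intro: et_fst et_snd)
next
  case (6 d H H' a b)
  have "emf_typing S (star_ty (Suc (Suc (Suc d))) H' # star_ty (Suc (Suc d)) H # G)
     (rel (Suc (Suc (Suc (Suc d)))) H H' (EVar 1) (EVar 0)) (EType 0)"
    if "H \<noteq> H'" "tctx S D (Suc (Suc d)) G" for G
    using 6(1)[OF that(1)] 6(3,4) star_pair_ctx[OF that(2) 6(3,4)] by simp
  then show ?case
    using 6(2-) is_type_wp_ty[OF is_type_star_ty[OF 6(2,3)]]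
    by (auto intro!: et_EEq et_wp_rel[of S D])
qed (auto intro: et_EEq et_false et_true tctx_wf is_type_star_ty is_type_EFun is_type_wp_ty
  is_type_ESum is_type_star_ty[where H = "DTVar i" for i, simplified]
  is_type_star_ty[where H = "DBase b" for b, simplified])

section \<open>Relatedness as a judgment, compatible with the term constructs\<close>

definition relv :: "('b, 'k) signature \<Rightarrow> nat \<Rightarrow> nat \<Rightarrow> ('b, 'k) ectx \<Rightarrow> eff \<Rightarrow> eff \<Rightarrow> 'b dty \<Rightarrow> 'b dty \<Rightarrow>
    ('b, 'k) etm \<Rightarrow> ('b, 'k) etm \<Rightarrow> bool" where
  "relv S D d G e e' H H' a b \<longleftrightarrow> tctx S D d G \<and> tvars_below D H \<and> tvars_below D H' \<and>
     emf_typing S G a (star_comp_ty d H e) \<and> emf_typing S G b (star_comp_ty d H' e') \<and>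
     emf_valid S G (relc d e e' H H' a b)"

lemma relvD:
  assumes "relv S D d G e e' H H' a b"
  shows "tctx S D d G" "tvars_below D H" "tvars_below D H'"
    "emf_typing S G a (star_comp_ty d H e)" "emf_typing S G b (star_comp_ty d H' e')"
    "emf_valid S G (relc d e e' H H' a b)"
  using assms by (auto simp: relv_def)

lemma relv_iff_eqv:
  assumes "tctx S D d G" "tvars_below D H"
  shows "relv S D d G e e H H a b \<longleftrightarrow> eqv S G (star_comp_ty d H e) a b"
  using assms is_type_star_comp_ty by (auto simp: relv_def eqv_def relc_same)

lemma relv_eqv: "relv S D d G e e H H a b \<Longrightarrow> eqv S G (star_comp_ty d H e) a b"
  using is_type_star_comp_ty by (auto simp: relv_def eqv_def relc_same)

lemma relv_ren:
  assumes "relv S D d G e e' H H' a b" "tctx S D d' G'" "renames r G G'" "tren D r d d'"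
  shows "relv S D d' G' e e' H H' (ren r a) (ren r b)"
  unfolding relv_def
  using assms emf_typing_ren[OF relvD(4)[OF assms(1)] tctx_wf[OF assms(2)] assms(3)]
    emf_typing_ren[OF relvD(5)[OF assms(1)] tctx_wf[OF assms(2)] assms(3)]
    emf_valid_ren[OF relvD(6)[OF assms(1)] tctx_wf[OF assms(2)] assms(3)]
    relvD(2,3)[OF assms(1)]
  by (simp add: ren_relc[of D] ren_star_comp_ty[of D])

lemma tren_Suc: "tren D Suc d (Suc d)"
  by (simp add: tren_def)

lemma relv_elift0:
  assumes "relv S D d G e e' H H' a b" "tctx S D (Suc d) (u # G)"
  shows "relv S D (Suc d) (u # G) e e' H H' (elift 0 a) (elift 0 b)"
  unfolding elift0_ren using relv_ren[OF assms renames_Suc tren_Suc] .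

text \<open>The relation is a formula, so Leibniz's law applies with variable 0 in place of the left
  term. Relatedness therefore only has to be checked up to provable equality.\<close>

lemma relv_eqv_left:
  assumes R: "relv S D d G e e' H H' a b" and a: "eqv S G (star_comp_ty d H e) a a'"
  shows "relv S D d G e e' H H' a' b"
proof -
  note G = relvD(1)[OF R] and tv = relvD(2,3)[OF R]
  let ?G = "star_comp_ty d H e # G"
  let ?p = "relc (Suc d) e e' H H' (EVar 0) (elift 0 b)"
  have G1: "tctx S D (Suc d) ?G" using tctx_Cons[OF G eqvD(1)[OF a]] .
  have "emf_typing S ?G ?p (EType 0)"
    using et_relc[OF G1 tv, of "EVar 0" e "elift 0 b" e'] et_var0[OF eqvD(1)[OF a]]
      emf_typing_elift0[OF relvD(5)[OF R] tctx_wf[OF G1]] by simp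
  then have "emf_valid S G (relc d e e' H H' a' b)"
    using ev_subst[OF eqvD(4)[OF a], of ?p] relvD(6)[OF R] by (simp add: esubst_relc)
  then show ?thesis using R eqvD(3)[OF a] by (simp add: relv_def)
qed

lemma relv_eqv_right:
  assumes R: "relv S D d G e e' H H' a b" and b: "eqv S G (star_comp_ty d H' e') b b'"
  shows "relv S D d G e e' H H' a b'"
proof -
  note G = relvD(1)[OF R] and tv = relvD(2,3)[OF R]
  let ?G = "star_comp_ty d H' e' # G"
  let ?p = "relc (Suc d) e e' H H' (elift 0 a) (EVar 0)"
  have G1: "tctx S D (Suc d) ?G" using tctx_Cons[OF G eqvD(1)[OF b]] .
  have "emf_typing S ?G ?p (EType 0)"
    using et_relc[OF G1 tv, of "elift 0 a" e "EVar 0" e'] et_var0[OF eqvD(1)[OF b]]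
      emf_typing_elift0[OF relvD(4)[OF R] tctx_wf[OF G1]] by simp
  then have "emf_valid S G (relc d e e' H H' a b')"
    using ev_subst[OF eqvD(4)[OF b], of ?p] relvD(6)[OF R] by (simp add: esubst_relc)
  then show ?thesis using R eqvD(3)[OF b] by (simp add: relv_def)
qed

lemma relv_cong:
  "\<lbrakk> relv S D d G e e' H H' a b; eqv S G (star_comp_ty d H e) a' a;
     eqv S G (star_comp_ty d H' e') b' b \<rbrakk> \<Longrightarrow> relv S D d G e e' H H' a' b'"
  by (rule relv_eqv_left[OF relv_eqv_right]) (auto intro: eqv_sym)

text \<open>With equal function types this is congruence. With equal domains the pointwise relation
  is taken at \<open>a\<close>, and \<open>b\<close> may replace \<open>a\<close> because related
  terms of one type are equal. With distinct domains the assumption is \<open>EFalse\<close>, from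
  which every well-typed formula follows.\<close>

lemma relv_app:
  assumes F: "relv S D d G NonEff NonEff (DArr e H K) (DArr e' H' K') f g"
    and A: "relv S D d G NonEff NonEff H H' a b"
  shows "relv S D d G e e' K K' (EApp f a) (EApp g b)"
proof -
  note G = relvD(1)[OF F] and tA = relvD(2,3)[OF A]
  have tK: "tvars_below D K" "tvars_below D K'" using relvD(2,3)[OF F] by auto
  have f: "emf_typing S G f (EFun (star_ty d H) (star_comp_ty d K e))"
    and g: "emf_typing S G g (EFun (star_ty d H') (star_comp_ty d K' e'))"
    using relvD(4,5)[OF F] by (simp_all only: star_comp_ty_simps star_ty_DArr)
  have a: "emf_typing S G a (star_ty d H)" and b: "emf_typing S G b (star_ty d H')"
    using relvD(4,5)[OF A] by simp_all
  note ty = et_app_fun[OF f a] et_app_fun[OF g b]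
  consider "DArr e H K = DArr e' H' K'" | "DArr e H K \<noteq> DArr e' H' K'" "H = H'" | "H \<noteq> H'" by blast
  then show ?thesis
  proof cases
    case 1
    have "eqv S G (star_comp_ty d (DArr e H K) NonEff) f g" "eqv S G (star_comp_ty d H NonEff) a b"
      using relv_eqv F A 1 by blast+
    then have "eqv S G (EFun (star_ty d H) (star_comp_ty d K e)) f g" "eqv S G (star_ty d H) a b"
      by (simp_all only: star_comp_ty_simps star_ty_DArr)
    then show ?thesis
      using 1 eqv_app[OF _ _ is_type_star_comp_ty[OF G tK(1)]] relv_iff_eqv[OF G tK(1)] by auto
  next
    case 2
    have "emf_valid S G (EAll (star_ty d H) (relc (Suc d) e e' K K'
        (EApp (elift 0 f) (EVar 0)) (EApp (elift 0 g) (EVar 0))))"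
      using relvD(6)[OF F] 2 by (auto split: if_splits)
    from ev_allE[OF this a] have v: "emf_valid S G (relc d e e' K K' (EApp f a) (EApp g a))"
      by (simp add: esubst_relc)
    have ab: "eqv S G (star_ty d H') a b" using relv_eqv A 2 by fastforce
    have "eqv S G (star_comp_ty d K' e') (EApp g a) (EApp g b)"
      using eqv_app[OF eqv_refl[OF _ g] ab is_type_star_comp_ty[OF G tK(2)]]
        is_type_EFun is_type_star_comp_ty[OF G tK(2)] eqvD(1)[OF ab] by blast
    moreover have "relv S D d G e e' K K' (EApp f a) (EApp g a)"
      using v G tK ty et_app_fun[OF g] a 2 by (simp add: relv_def)
    ultimately show ?thesis using relv_eqv_right by blast
  next
    case 3
    then have "emf_valid S G EFalse" using relvD(6)[OF F] by simp
    then show ?thesis using ev_falseE et_relc[OF G tK ty] G tK ty by (simp add: relv_def)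
  qed
qed

text \<open>The annotation gives both abstractions the same domain, so the \<open>EFalse\<close>
  branch of \<open>rel\<close> does not arise. At distinct function types, beta turns the pointwise
  formula into the hypothesis on the bodies.\<close>

lemma relv_lam:
  assumes G: "tctx S D d G" and H: "tvars_below D H"
    and B: "relv S D (Suc d) (star_ty d H # G) e e' K K' t t'"
  shows "relv S D d G NonEff NonEff (DArr e H K) (DArr e' H K')
    (ELam (star_ty d H) t) (ELam (star_ty d H) t')"
proof -
  note tK = relvD(2,3)[OF B] and tH = is_type_star_ty[OF G H]
  let ?f = "ELam (star_ty d H) t" and ?g = "ELam (star_ty d H) t'"
  have ty: "emf_typing S G ?f (star_ty d (DArr e H K))" "emf_typing S G ?g (star_ty d (DArr e' H K'))"
    using relvD(4,5)[OF B] tH unfolding star_ty_DArr by (auto intro: et_lam_fun)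
  have "emf_valid S G (rel d (DArr e H K) (DArr e' H K') ?f ?g)"
  proof (cases "DArr e H K = DArr e' H K'")
    case True
    then have "eqv S (star_ty d H # G) (elift 0 (star_comp_ty d K e)) t t'"
      using relv_eqv B by fastforce
    from eqv_lam[OF this tH is_type_star_comp_ty[OF G tK(1)]]
    show ?thesis using True eqvD(4) by (auto simp: rel_same star_ty_DArr simp del: star_ty.simps)
  next
    case False
    note G1 = relvD(1)[OF B]
    have "eqv S (star_ty d H # G) (star_comp_ty (Suc d) K e) (EApp (elift 0 ?f) (EVar 0)) t"
      using eqv_lam_var[OF tH _ , of "star_comp_ty d K e" t] is_type_star_comp_ty[OF G1 tK(1)]
        relvD(4)[OF B] by simp
    moreover have "eqv S (star_ty d H # G) (star_comp_ty (Suc d) K' e') (EApp (elift 0 ?g) (EVar 0)) t'"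
      using eqv_lam_var[OF tH _ , of "star_comp_ty d K' e'" t'] is_type_star_comp_ty[OF G1 tK(2)]
        relvD(5)[OF B] by simp
    ultimately have "relv S D (Suc d) (star_ty d H # G) e e' K K' (EApp (elift 0 ?f) (EVar 0))
        (EApp (elift 0 ?g) (EVar 0))"
      by (rule relv_cong[OF B])
    from ev_EAllI[OF tH relvD(6)[OF this]] show ?thesis using False by auto
  qed
  then show ?thesis using G H tK ty by (simp add: relv_def del: rel.simps star_ty.simps)
qed

lemma eqv_fst_pair: "\<lbrakk> emf_typing S G a t; emf_typing S G b t'; is_type S G t \<rbrakk>
    \<Longrightarrow> eqv S G t (EFst (EPair a b)) a"
  by (auto simp: eqv_def intro: ev_fst_pair et_fst et_pair)

lemma eqv_snd_pair: "\<lbrakk> emf_typing S G a t; emf_typing S G b t'; is_type S G t' \<rbrakk>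
    \<Longrightarrow> eqv S G t' (ESnd (EPair a b)) b"
  by (auto simp: eqv_def intro: ev_snd_pair et_snd et_pair)

lemma relv_pair:
  assumes A: "relv S D d G NonEff NonEff H H' a b" and B: "relv S D d G NonEff NonEff K K' a' b'"
  shows "relv S D d G NonEff NonEff (DProd H K) (DProd H' K') (EPair a a') (EPair b b')"
proof -
  note G = relvD(1)[OF A] and tA = relvD(2,3)[OF A] and tB = relvD(2,3)[OF B]
  have a: "emf_typing S G a (star_ty d H)" and b: "emf_typing S G b (star_ty d H')"
    and a': "emf_typing S G a' (star_ty d K)" and b': "emf_typing S G b' (star_ty d K')"
    using relvD(4,5)[OF A] relvD(4,5)[OF B] by simp_all
  have "emf_valid S G (rel d (DProd H K) (DProd H' K') (EPair a a') (EPair b b'))"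
  proof (cases "DProd H K = DProd H' K'")
    case True
    then show ?thesis
      using eqv_pair[of S G "star_ty d H" a b "star_ty d K" a' b'] relv_eqv A B eqvD(4)
      by fastforce
  next
    case False
    have "relv S D d G NonEff NonEff H H' (EFst (EPair a a')) (EFst (EPair b b'))"
      by (rule relv_cong[OF A])
        (auto intro!: eqv_fst_pair a a' b b' is_type_star_ty[OF G tA(1)] is_type_star_ty[OF G tA(2)])
    moreover have "relv S D d G NonEff NonEff K K' (ESnd (EPair a a')) (ESnd (EPair b b'))"
      by (rule relv_cong[OF B])
        (auto intro!: eqv_snd_pair a a' b b' is_type_star_ty[OF G tB(1)] is_type_star_ty[OF G tB(2)])
    ultimately show ?thesis using False by (auto intro: ev_andI simp: relv_def)
  qed
  then show ?thesis using G tA tB a a' b b' by (auto simp: relv_def intro: et_pair)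
qed

lemma relv_fst:
  assumes A: "relv S D d G NonEff NonEff (DProd H K) (DProd H' K') a b"
  shows "relv S D d G NonEff NonEff H H' (EFst a) (EFst b)"
proof -
  note G = relvD(1)[OF A]
  have tv: "tvars_below D H" "tvars_below D H'" using relvD(2,3)[OF A] by auto
  have "emf_valid S G (rel d H H' (EFst a) (EFst b))"
  proof (cases "DProd H K = DProd H' K'")
    case True
    then have "eqv S G (EProd (star_ty d H) (star_ty d K)) a b" using relv_eqv A by fastforce
    then show ?thesis
      using True eqvD(4)[OF eqv_fst] is_type_star_ty[OF G tv(1)] by (auto simp: rel_same)
  next
    case False
    then show ?thesis using relvD(6)[OF A] by (auto dest: ev_andE1)
  qed
  then show ?thesis using G tv relvD(4,5)[OF A] by (auto simp: relv_def intro: et_fst)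
qed

lemma relv_snd:
  assumes A: "relv S D d G NonEff NonEff (DProd H K) (DProd H' K') a b"
  shows "relv S D d G NonEff NonEff K K' (ESnd a) (ESnd b)"
proof -
  note G = relvD(1)[OF A]
  have tv: "tvars_below D K" "tvars_below D K'" using relvD(2,3)[OF A] by auto
  have "emf_valid S G (rel d K K' (ESnd a) (ESnd b))"
  proof (cases "DProd H K = DProd H' K'")
    case True
    then have "eqv S G (EProd (star_ty d H) (star_ty d K)) a b" using relv_eqv A by fastforce
    then show ?thesis
      using True eqvD(4)[OF eqv_snd] is_type_star_ty[OF G tv(1)] by (auto simp: rel_same)
  next
    case False
    then show ?thesis using relvD(6)[OF A] by (auto dest: ev_andE2)
  qed
  then show ?thesis using G tv relvD(4,5)[OF A] by (auto simp: relv_def intro: et_snd)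
qed

text \<open>Equal sum types have equal left summands, where relatedness is equality and congruence
  applies; at distinct sum types the relation is \<open>ETrue\<close>.\<close>

lemma relv_inl:
  assumes A: "relv S D d G NonEff NonEff H H' a b" and K: "tvars_below D K" "tvars_below D K'"
  shows "relv S D d G NonEff NonEff (DSum H K) (DSum H' K') (EInl a) (EInl b)"
proof -
  note G = relvD(1)[OF A]
  have "emf_valid S G (rel d (DSum H K) (DSum H' K') (EInl a) (EInl b))"
  proof (cases "DSum H K = DSum H' K'")
    case True
    then have "eqv S G (star_ty d H) a b" using relv_eqv A by fastforce
    from eqvD(4)[OF eqv_inl[OF this is_type_star_ty[OF G K(1)]]]
    show ?thesis using True by simp
  qed (auto intro: ev_trueI tctx_wf[OF G])
  then show ?thesis using G K relvD(2-5)[OF A] is_type_star_ty[OF G]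
    by (auto simp: relv_def intro: et_inl')
qed

lemma relv_inr:
  assumes A: "relv S D d G NonEff NonEff K K' a b" and H: "tvars_below D H" "tvars_below D H'"
  shows "relv S D d G NonEff NonEff (DSum H K) (DSum H' K') (EInr a) (EInr b)"
proof -
  note G = relvD(1)[OF A]
  have "emf_valid S G (rel d (DSum H K) (DSum H' K') (EInr a) (EInr b))"
  proof (cases "DSum H K = DSum H' K'")
    case True
    then have "eqv S G (star_ty d K) a b" using relv_eqv A by fastforce
    from eqvD(4)[OF eqv_inr[OF this is_type_star_ty[OF G H(1)]]]
    show ?thesis using True by simp
  qed (auto intro: ev_trueI tctx_wf[OF G])
  then show ?thesis using G H relvD(2-5)[OF A] is_type_star_ty[OF G]
    by (auto simp: relv_def intro: et_inr')
qed

text \<open>The annotations force one sum type on both scrutinees, so these are equal outright and a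
  single case analysis serves both terms. The result types may still differ, hence the analysed
  formula is \<open>relc\<close> and not an equation. The second scrutinee is exchanged
  last.\<close>

lemma relv_case:
  assumes s: "relv S D d G NonEff NonEff (DSum A A') (DSum A A') s s'"
    and t1: "relv S D (Suc d) (star_ty d A # G) e e' H H' t1 t1'"
    and t2: "relv S D (Suc d) (star_ty d A' # G) e e' H H' t2 t2'"
  shows "relv S D d G e e' H H' (ECase s (star_ty d A) t1 (star_ty d A') t2)
    (ECase s' (star_ty d A) t1' (star_ty d A') t2')"
proof -
  note G = relvD(1)[OF s] and tH = relvD(2,3)[OF t1]
  have tA: "tvars_below D A" "tvars_below D A'" using relvD(2)[OF s] by auto
  note A = is_type_star_ty[OF G tA(1)] is_type_star_ty[OF G tA(2)]
  note K = is_type_star_comp_ty[OF G tH(1), of e] and K' = is_type_star_comp_ty[OF G tH(2), of e']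
  have ss: "eqv S G (ESum (star_ty d A) (star_ty d A')) s s'" using relv_eqv[OF s] by simp
  have u: "emf_typing S (star_ty d A # G) t1 (elift 0 (star_comp_ty d H e))"
    "emf_typing S (star_ty d A' # G) t2 (elift 0 (star_comp_ty d H e))"
    and u': "emf_typing S (star_ty d A # G) t1' (elift 0 (star_comp_ty d H' e'))"
    "emf_typing S (star_ty d A' # G) t2' (elift 0 (star_comp_ty d H' e'))"
    using relvD(4,5)[OF t1] relvD(4,5)[OF t2] by simp_all
  let ?c = "\<lambda>e1 e2. ECase (EVar 0) (elift 0 (star_ty d A)) (elift (Suc 0) e1)
    (elift 0 (star_ty d A')) (elift (Suc 0) e2)"
  let ?p = "relc (Suc d) e e' H H' (?c t1 t2) (?c t1' t2')"
  have G1: "tctx S D (Suc d) (ESum (star_ty d A) (star_ty d A') # G)"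
    using tctx_Cons[OF G is_type_ESum[OF A]] .
  have p: "emf_typing S (ESum (star_ty d A) (star_ty d A') # G) ?p (EType 0)"
    using et_case_var[OF A K u] et_case_var[OF A K' u']
    by (intro et_relc[OF G1 tH]) simp_all
  have "at_inl ?p = relc (Suc d) e e' H H' (at_inl (?c t1 t2)) (at_inl (?c t1' t2'))"
    "at_inr ?p = relc (Suc d) e e' H H' (at_inr (?c t1 t2)) (at_inr (?c t1' t2'))"
    by (simp_all add: at_inl_def at_inr_def elift_relc[OF tH] esubst_relc)
  moreover have "relv S D (Suc d) (star_ty d A # G) e e' H H' (at_inl (?c t1 t2)) (at_inl (?c t1' t2'))"
    unfolding at_inl_case_var
    using eqv_case_inl_var[OF A K u] eqv_case_inl_var[OF A K' u']
      relv_cong[OF t1] by simp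
  moreover have "relv S D (Suc d) (star_ty d A' # G) e e' H H' (at_inr (?c t1 t2)) (at_inr (?c t1' t2'))"
    unfolding at_inr_case_var
    using eqv_case_inr_var[OF A K u] eqv_case_inr_var[OF A K' u']
      relv_cong[OF t2] by simp
  ultimately have "emf_valid S G (esubst 0 s ?p)"
    using ev_sum_cases[OF eqvD(2)[OF ss] p] relvD(6) by metis
  then have "relv S D d G e e' H H' (ECase s (star_ty d A) t1 (star_ty d A') t2)
      (ECase s (star_ty d A) t1' (star_ty d A') t2')"
    using G tH et_case_const[OF eqvD(2)[OF ss] A K u] et_case_const[OF eqvD(2)[OF ss] A K' u']
    by (simp add: relv_def esubst_relc del: elift_star_ty)
  then show ?thesis using eqv_case_scrutinee[OF ss A K' u'] by (rule relv_eqv_right)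
qed

section \<open>Related continuations and related predicate transformers\<close>

lemma elift0_cont_rel:
  "\<lbrakk> tvars_below D A; tvars_below D A' \<rbrakk> \<Longrightarrow>
   elift 0 (cont_rel d A A' R k k') =
   cont_rel (Suc d) A A' (elift (Suc (Suc 0)) R) (elift 0 k) (elift 0 k')"
  by (simp add: elift_ren upr_liftr ren_cont_rel[OF _ _ tren_liftr[of 0 d D]])

abbreviation (input) var_rel :: "nat \<Rightarrow> 'b dty \<Rightarrow> 'b dty \<Rightarrow> ('b, 'k) etm" where
  "var_rel d A A' \<equiv> rel d A A' (EVar 1) (EVar 0)"

lemma elift_var_rel:
  "\<lbrakk> tvars_below D A; tvars_below D A'; 2 \<le> j; j \<le> d \<rbrakk> \<Longrightarrow>
   elift j (var_rel d A A') = var_rel (Suc d) A A'"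
  by (simp add: elift_ren ren_rel[OF _ _ tren_liftr, of D A A' j d]) (simp add: liftr_def)

text \<open>The parameter \<open>R\<close> of \<open>cont_rel\<close> becomes the relation itself at
  the two bound values; the added depth counts the binders in front of it.\<close>

definition conts :: "nat \<Rightarrow> 'b dty \<Rightarrow> 'b dty \<Rightarrow> ('b, 'k) etm \<Rightarrow> ('b, 'k) etm \<Rightarrow> ('b, 'k) etm" where
  "conts d A A' k k' = cont_rel d A A' (var_rel (Suc (Suc d)) A A') k k'"

definition wps :: "nat \<Rightarrow> 'b dty \<Rightarrow> 'b dty \<Rightarrow> ('b, 'k) etm \<Rightarrow> ('b, 'k) etm \<Rightarrow> ('b, 'k) etm" where
  "wps d A A' m m' = wp_rel d A A' (var_rel (Suc (Suc (Suc (Suc d)))) A A') m m'"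

lemma wps_eq: "wps d A A' m m' = EAll (EPred (star_ty d A)) (EAll (EPred (star_ty (Suc d) A'))
     (EImp (conts (Suc (Suc d)) A A' (EVar 1) (EVar 0))
     (EEq (EType 0) (EApp (elift 0 (elift 0 m)) (EVar 1)) (EApp (elift 0 (elift 0 m')) (EVar 0)))))"
  by (simp add: wps_def wp_rel_def conts_def)

lemma conts_eq: "conts d A A' k k' = EAll (star_ty d A) (EAll (star_ty (Suc d) A')
     (EImp (var_rel (Suc (Suc d)) A A')
     (EEq (EType 0) (EApp (elift 0 (elift 0 k)) (EVar 1)) (EApp (elift 0 (elift 0 k')) (EVar 0)))))"
  by (simp add: conts_def cont_rel_def)

lemma elift0_conts:
  "\<lbrakk> tvars_below D A; tvars_below D A' \<rbrakk> \<Longrightarrow>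
   elift 0 (conts d A A' k k') = conts (Suc d) A A' (elift 0 k) (elift 0 k')"
  by (simp add: conts_def elift0_cont_rel[of D] elift_var_rel[of D, simplified])

lemma elift0_wps:
  "\<lbrakk> tvars_below D A; tvars_below D A' \<rbrakk> \<Longrightarrow>
   elift 0 (wps d A A' m m') = wps (Suc d) A A' (elift 0 m) (elift 0 m')"
  by (simp add: wps_def elift_ren upr_liftr ren_wp_rel[OF _ _ tren_liftr[of 0 d D]])
    (simp add: elift_ren[symmetric] elift_var_rel[of D, simplified])

lemma esubst_conts:
  "j \<le> d \<Longrightarrow> esubst j u (conts (Suc d) A A' k k') = conts d A A' (esubst j u k) (esubst j u k')"
  by (simp add: conts_def esubst_cont_rel esubst_rel)

lemma et_var_rel:
  assumes "tctx S D d G" "tvars_below D A" "tvars_below D A'"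
  shows "emf_typing S (star_ty (Suc d) A' # star_ty d A # G) (var_rel (Suc (Suc d)) A A') (EType 0)"
  using et_rel[OF star_pair_ctx(1)[OF assms] assms(2,3)] star_pair_ctx(2,3)[OF assms] by simp

lemma et_conts:
  "\<lbrakk> tctx S D d G; tvars_below D A; tvars_below D A'; emf_typing S G k (EPred (star_ty d A));
     emf_typing S G k' (EPred (star_ty d A')) \<rbrakk>
   \<Longrightarrow> emf_typing S G (conts d A A' k k') (EType 0)"
  unfolding conts_def by (blast intro: et_cont_rel et_var_rel)

lemma conts_elim:
  assumes c: "emf_valid S G (conts d A A' k k')"
    and r: "relv S D d G NonEff NonEff A A' a b"
    and k: "emf_typing S G k (EPred (star_ty d A))" "emf_typing S G k' (EPred (star_ty d A'))"
  shows "eqv S G (EType 0) (EApp k a) (EApp k' b)"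
proof -
  note G = relvD(1)[OF r] and ab = relvD(4,5)[OF r, simplified]
  from ev_allE[OF c[unfolded conts_eq] ab(1)]
  have 1: "emf_valid S G (EAll (star_ty d A') (EImp (rel (Suc d) A A' (elift 0 a) (EVar 0))
     (EEq (EType 0) (EApp (elift 0 k) (elift 0 a)) (EApp (elift 0 k') (EVar 0)))))"
    by (simp add: esubst_rel flip: elift_esubst)
  from ev_allE[OF this ab(2)]
  have "emf_valid S G (EImp (rel d A A' a b) (EEq (EType 0) (EApp k a) (EApp k' b)))"
    by (simp add: esubst_rel)
  from ev_impE[OF this] have "emf_valid S G (EEq (EType 0) (EApp k a) (EApp k' b))"
    using relvD(6)[OF r] by simp
  then show ?thesis
    using is_type_EType[OF tctx_wf[OF G]] et_app_pred[OF k(1) ab(1)] et_app_pred[OF k(2) ab(2)]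
    by (simp add: eqv_def)
qed

text \<open>Two values together with the hypothesis that they are related. The hypothesis is
  variable 0, so the values are variables 2 and 1.\<close>

lemma var_rel_ctx:
  assumes G: "tctx S D d G" and A: "tvars_below D A" "tvars_below D A'"
  defines "G3 \<equiv> var_rel (Suc (Suc d)) A A' # star_ty (Suc d) A' # star_ty d A # G"
  shows "tctx S D (Suc (Suc (Suc d))) G3"
    "relv S D (Suc (Suc (Suc d))) G3 NonEff NonEff A A' (EVar 2) (EVar 1)"
proof -
  note G2 = star_pair_ctx[OF G A] and r = et_var_rel[OF G A]
  show G3: "tctx S D (Suc (Suc (Suc d))) G3"
    unfolding G3_def using tctx_Cons[OF G2(1) is_type_if[OF r]] .
  have "emf_valid S G3 (rel (Suc (Suc (Suc d))) A A' (EVar 2) (EVar 1))"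
    using ev_var0[OF r] by (simp add: G3_def elift0_ren numeral_2_eq_2 ren_rel[OF A tren_Suc])
  moreover have "emf_typing S G3 (EVar 2) (star_ty (Suc (Suc (Suc d))) A)"
    using et_var_Suc[OF G2(2)] tctx_wf[OF G3] by (simp add: G3_def numeral_2_eq_2)
  moreover have "emf_typing S G3 (EVar 1) (star_ty (Suc (Suc (Suc d))) A')"
    using et_var_Suc[OF G2(3)] tctx_wf[OF G3] by (simp add: G3_def)
  ultimately show "relv S D (Suc (Suc (Suc d))) G3 NonEff NonEff A A' (EVar 2) (EVar 1)"
    using G3 A by (simp add: relv_def)
qed

lemma conts_intro:
  assumes G: "tctx S D d G" and A: "tvars_below D A" "tvars_below D A'"
    and k: "emf_typing S G k (EPred (star_ty d A))" "emf_typing S G k' (EPred (star_ty d A'))"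
    and eq: "emf_valid S (var_rel (Suc (Suc d)) A A' # star_ty (Suc d) A' # star_ty d A # G)
       (EEq (EType 0) (EApp (elift 0 (elift 0 (elift 0 k))) (EVar 2))
         (EApp (elift 0 (elift 0 (elift 0 k'))) (EVar 1)))"
  shows "emf_valid S G (conts d A A' k k')"
proof -
  note G1 = tctx_star_Cons[OF G A(1)] and G2 = star_pair_ctx[OF G A]
  have k1: "emf_typing S (star_ty (Suc d) A' # star_ty d A # G) (elift 0 (elift 0 k))
      (EPred (star_ty (Suc (Suc d)) A))"
    using emf_typing_elift0[OF emf_typing_elift0[OF k(1) tctx_wf[OF G1]] tctx_wf[OF G2(1)]] by simp
  have k2: "emf_typing S (star_ty (Suc d) A' # star_ty d A # G) (elift 0 (elift 0 k'))
      (EPred (star_ty (Suc (Suc d)) A'))"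
    using emf_typing_elift0[OF emf_typing_elift0[OF k(2) tctx_wf[OF G1]] tctx_wf[OF G2(1)]] by simp
  note q = et_EEq[OF is_type_EType[OF tctx_wf[OF G2(1)]] et_app_pred[OF k1 G2(2)] et_app_pred[OF k2 G2(3)]]
  show ?thesis unfolding conts_eq
    using eq ev_EAllI[OF is_type_star_ty[OF G A(1)] ev_EAllI[OF is_type_star_ty[OF G1 A(2)]
      ev_impI[OF et_var_rel[OF G A] q]]]
    by (simp add: numeral_2_eq_2)
qed

lemma conts_same:
  assumes G: "tctx S D d G" and A: "tvars_below D A" and k: "eqv S G (EPred (star_ty d A)) k k'"
  shows "emf_valid S G (conts d A A k k')"
proof (rule conts_intro[OF G A A eqvD(2,3)[OF k]])
  let ?G2 = "star_ty (Suc d) A # star_ty d A # G"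
  let ?G3 = "var_rel (Suc (Suc d)) A A # ?G2"
  note G1 = tctx_star_Cons[OF G A] and G2 = star_pair_ctx(1)[OF G A A] and G3 = var_rel_ctx[OF G A A]
  have "eqv S ?G3 (EPred (star_ty (Suc (Suc (Suc d))) A))
     (elift 0 (elift 0 (elift 0 k))) (elift 0 (elift 0 (elift 0 k')))"
    using eqv_elift0[OF eqv_elift0[OF eqv_elift0[OF k tctx_wf[OF G1]] tctx_wf[OF G2]] tctx_wf[OF G3(1)]]
    by simp
  from eqv_app_pred[OF this, of "EVar 2" "EVar 1"] relv_eqv[OF G3(2)]
  show "emf_valid S ?G3 (EEq (EType 0) (EApp (elift 0 (elift 0 (elift 0 k))) (EVar 2))
         (EApp (elift 0 (elift 0 (elift 0 k'))) (EVar 1)))"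
    using eqvD(4) by simp
qed

text \<open>At a single type a variable is related to itself, so the two predicates agree pointwise
  and extensionality applies.\<close>

lemma conts_same_eqv:
  assumes G: "tctx S D d G" and A: "tvars_below D A" and c: "emf_valid S G (conts d A A k k')"
    and k: "emf_typing S G k (EPred (star_ty d A))" "emf_typing S G k' (EPred (star_ty d A))"
  shows "eqv S G (EPred (star_ty d A)) k k'"
  unfolding EPred_def
proof (rule eqv_ext)
  note G1 = tctx_star_Cons[OF G A] and tA = is_type_star_ty[OF G A]
  have "relv S D (Suc d) (star_ty d A # G) NonEff NonEff A A (EVar 0) (EVar 0)"
    using relv_iff_eqv[OF G1 A] eqv_refl[OF is_type_star_ty[OF G1 A]] et_var0[OF tA] by simp
  moreover have "emf_valid S (star_ty d A # G) (conts (Suc d) A A (elift 0 k) (elift 0 k'))"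
    using emf_valid_elift0[OF c tctx_wf[OF G1]] by (simp add: elift0_conts[OF A A])
  ultimately show "eqv S (star_ty d A # G) (elift 0 (EType 0)) (EApp (elift 0 k) (EVar 0))
      (EApp (elift 0 k') (EVar 0))"
    using conts_elim emf_typing_elift0[OF k(1) tctx_wf[OF G1]] emf_typing_elift0[OF k(2) tctx_wf[OF G1]]
    by fastforce
qed (use k is_type_star_ty[OF G A] is_type_EType[OF tctx_wf[OF G]] in \<open>auto simp: EPred_def\<close>)

lemma wps_elim:
  assumes w: "emf_valid S G (wps d A A' m m')" and c: "emf_valid S G (conts d A A' k k')"
    and k: "emf_typing S G k (EPred (star_ty d A))" "emf_typing S G k' (EPred (star_ty d A'))"
  shows "emf_valid S G (EEq (EType 0) (EApp m k) (EApp m' k'))"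
proof -
  from ev_allE[OF w[unfolded wps_eq] k(1)]
  have 1: "emf_valid S G (EAll (EPred (star_ty d A')) (EImp (conts (Suc d) A A' (elift 0 k) (EVar 0))
     (EEq (EType 0) (EApp (elift 0 m) (elift 0 k)) (EApp (elift 0 m') (EVar 0)))))"
    by (simp add: esubst_conts flip: elift_esubst)
  from ev_allE[OF this k(2)]
  have "emf_valid S G (EImp (conts d A A' k k') (EEq (EType 0) (EApp m k) (EApp m' k')))"
    by (simp add: esubst_conts)
  from ev_impE[OF this c] show ?thesis .
qed

text \<open>\<open>relc\<close> is an equation at equal types and \<open>wps\<close> otherwise; both
  are used here in the same way, the first because related continuations at one type are
  equal.\<close>

lemma relv_wp_elim:
  assumes R: "relv S D d G Tau Tau A A' m m'" and c: "emf_valid S G (conts d A A' k k')"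
    and k: "emf_typing S G k (EPred (star_ty d A))" "emf_typing S G k' (EPred (star_ty d A'))"
  shows "eqv S G (EType 0) (EApp m k) (EApp m' k')"
proof (cases "A = A'")
  case True
  have "eqv S G (EPred (star_ty d A)) k k'"
    using conts_same_eqv[OF relvD(1,2)[OF R]] c k True by simp
  moreover have "eqv S G (wp_ty (star_ty d A)) m m'" using relv_eqv[of S D d G Tau A] R True by simp
  ultimately show ?thesis by (blast intro: eqv_app_wp)
next
  case False
  then have "emf_valid S G (wps d A A' m m')" using relvD(6)[OF R] by (simp add: wps_def)
  from wps_elim[OF this c k] show ?thesis
    using is_type_EType[OF tctx_wf[OF relvD(1)[OF R]]] relvD(4,5)[OF R] k
    by (auto simp: eqv_def intro: et_app_wp)
qed

lemma conts_ctx: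
  assumes G: "tctx S D d G" and A: "tvars_below D A" "tvars_below D A'"
  defines "G3 \<equiv> conts (Suc (Suc d)) A A' (EVar 1) (EVar 0) #
    EPred (star_ty (Suc d) A') # EPred (star_ty d A) # G"
  shows "tctx S D (Suc (Suc (Suc d))) G3"
    "emf_valid S G3 (conts (Suc (Suc (Suc d))) A A' (EVar 2) (EVar 1))"
    "emf_typing S G3 (EVar 2) (EPred (star_ty (Suc (Suc (Suc d))) A))"
    "emf_typing S G3 (EVar 1) (EPred (star_ty (Suc (Suc (Suc d))) A'))"
    "relv S D d G e e' H H' a b \<Longrightarrow>
     relv S D (Suc (Suc (Suc d))) G3 e e' H H' (elift 0 (elift 0 (elift 0 a))) (elift 0 (elift 0 (elift 0 b)))"
proof -
  note G1 = tctx_EPred_Cons[OF G A(1)] and G2 = pred_pair_ctx[OF G A]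
  note c = et_conts[OF G2(1) A G2(2,3)]
  show G3: "tctx S D (Suc (Suc (Suc d))) G3"
    unfolding G3_def using tctx_Cons[OF G2(1) is_type_if[OF c]] .
  show "emf_valid S G3 (conts (Suc (Suc (Suc d))) A A' (EVar 2) (EVar 1))"
    using ev_var0[OF c] by (simp add: G3_def numeral_2_eq_2 elift0_conts[OF A])
  show "emf_typing S G3 (EVar 2) (EPred (star_ty (Suc (Suc (Suc d))) A))"
    using et_var_Suc[OF G2(2)] tctx_wf[OF G3] by (simp add: G3_def numeral_2_eq_2)
  show "emf_typing S G3 (EVar 1) (EPred (star_ty (Suc (Suc (Suc d))) A'))"
    using et_var_Suc[OF G2(3)] tctx_wf[OF G3] by (simp add: G3_def)
  show "relv S D (Suc (Suc (Suc d))) G3 e e' H H' (elift 0 (elift 0 (elift 0 a))) (elift 0 (elift 0 (elift 0 b)))"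
    if "relv S D d G e e' H H' a b"
    using relv_elift0[OF relv_elift0[OF relv_elift0[OF that G1] G2(1)]] G3 by (simp add: G3_def)
qed

text \<open>At equal types the transformer formula has to be turned into an equation: it is taken at
  a predicate variable paired with itself, a related pair by \<open>conts_same\<close>, and
  extensionality concludes.\<close>

lemma relv_wp_intro:
  assumes G: "tctx S D d G" and A: "tvars_below D A" "tvars_below D A'"
    and m: "emf_typing S G m (wp_ty (star_ty d A))" "emf_typing S G m' (wp_ty (star_ty d A'))"
    and eq: "emf_valid S (conts (Suc (Suc d)) A A' (EVar 1) (EVar 0) #
        EPred (star_ty (Suc d) A') # EPred (star_ty d A) # G)
       (EEq (EType 0) (EApp (elift 0 (elift 0 (elift 0 m))) (EVar 2))
         (EApp (elift 0 (elift 0 (elift 0 m'))) (EVar 1)))"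
  shows "relv S D d G Tau Tau A A' m m'"
proof -
  note G1 = tctx_EPred_Cons[OF G A(1)] and G2 = pred_pair_ctx[OF G A]
  let ?G2 = "EPred (star_ty (Suc d) A') # EPred (star_ty d A) # G"
  have m1: "emf_typing S ?G2 (elift 0 (elift 0 m)) (wp_ty (star_ty (Suc (Suc d)) A))"
    using emf_typing_elift0[OF emf_typing_elift0[OF m(1) tctx_wf[OF G1]] tctx_wf[OF G2(1)]] by simp
  have m2: "emf_typing S ?G2 (elift 0 (elift 0 m')) (wp_ty (star_ty (Suc (Suc d)) A'))"
    using emf_typing_elift0[OF emf_typing_elift0[OF m(2) tctx_wf[OF G1]] tctx_wf[OF G2(1)]] by simp
  note q = et_EEq[OF is_type_EType[OF tctx_wf[OF G2(1)]] et_app_wp[OF m1 G2(2)] et_app_wp[OF m2 G2(3)]]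
  have w: "emf_valid S G (wps d A A' m m')" unfolding wps_eq
    using eq ev_EAllI[OF is_type_EPred[OF is_type_star_ty[OF G A(1)]]
      ev_EAllI[OF is_type_EPred[OF is_type_star_ty[OF G1 A(2)]]
      ev_impI[OF et_conts[OF G2(1) A G2(2,3)] q]]]
    by (simp add: numeral_2_eq_2)
  have "emf_valid S G (relc d Tau Tau A A' m m')"
  proof (cases "A = A'")
    case True
    let ?G = "EPred (star_ty d A) # G"
    note tP = is_type_EPred[OF is_type_star_ty[OF G A(1)]]
    have p: "emf_typing S ?G (EVar 0) (EPred (star_ty (Suc d) A))" using et_var0[OF tP] by simp
    have "emf_valid S ?G (conts (Suc d) A A (EVar 0) (EVar 0))"
      using conts_same[OF G1 A(1)] eqv_refl[OF is_type_EPred[OF is_type_star_ty[OF G1 A(1)]] p] by blast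
    moreover have "emf_valid S ?G (wps (Suc d) A A (elift 0 m) (elift 0 m'))"
      using emf_valid_elift0[OF w tctx_wf[OF G1]] A True by (simp add: elift0_wps[of D])
    ultimately have "emf_valid S ?G (EEq (EType 0) (EApp (elift 0 m) (EVar 0)) (EApp (elift 0 m') (EVar 0)))"
      using wps_elim p by blast
    then have "eqv S ?G (EType 0) (EApp (elift 0 m) (EVar 0)) (EApp (elift 0 m') (EVar 0))"
      using is_type_EType[OF tctx_wf[OF G1]] emf_typing_elift0[OF m(1) tctx_wf[OF G1]]
        emf_typing_elift0[OF m(2) tctx_wf[OF G1]] p True
      by (auto simp: eqv_def intro: et_app_wp)
    then have "eqv S G (wp_ty (star_ty d A)) m m'"
      using eqv_ext_wp m is_type_star_ty[OF G A(1)] True by simp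
    then show ?thesis using True by (simp add: eqv_def)
  next
    case False
    then show ?thesis using w by (simp add: wps_def)
  qed
  then show ?thesis using G A m by (simp add: relv_def)
qed

text \<open>Run on related predicates p and p', the two sides become p a and p' b, which agree
  because related continuations agree on related values.\<close>

lemma relv_ret:
  assumes R: "relv S D d G NonEff NonEff A A' a b"
  shows "relv S D d G Tau Tau A A' (ERet (star_ty d A) a) (ERet (star_ty d A') b)"
proof -
  note G = relvD(1)[OF R] and A = relvD(2,3)[OF R] and ab = relvD(4,5)[OF R, simplified]
  note G3 = conts_ctx[OF G A]
  note R3 = G3(5)[OF R]
  note tA = is_type_star_ty[OF G3(1) A(1)] is_type_star_ty[OF G3(1) A(2)]
  note ab3 = relvD(4,5)[OF R3, unfolded star_comp_ty_simps]
  show ?thesis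
  proof (rule relv_wp_intro[OF G A])
    show "emf_valid S (conts (Suc (Suc d)) A A' (EVar 1) (EVar 0) #
        EPred (star_ty (Suc d) A') # EPred (star_ty d A) # G)
      (EEq (EType 0) (EApp (elift 0 (elift 0 (elift 0 (ERet (star_ty d A) a)))) (EVar 2))
        (EApp (elift 0 (elift 0 (elift 0 (ERet (star_ty d A') b)))) (EVar 1)))"
      using eqv_trans[OF eqv_ret_app[OF ab3(1) tA(1) G3(3)] eqv_trans[OF conts_elim[OF G3(2) R3 G3(3,4)]
        eqv_sym[OF eqv_ret_app[OF ab3(2) tA(2) G3(4)]]]]
      by (simp add: eqv_def)
  qed (use ab is_type_star_ty[OF G] A in \<open>auto intro: et_ERet\<close>)
qed

text \<open>Both binds are run on related predicates p and p'. By the hypothesis on the bodies,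
  \<lambda>x. e p and \<lambda>y. e' p' send related values to equal propositions, so they are
  related continuations and \<open>m\<close>, \<open>m'\<close> agree on them. That hypothesis lives
  in the context of x, y and their relatedness: \<open>e\<close> is lifted past y and the
  relatedness, \<open>e'\<close> past x, which lies below its own variable y, and then past the
  relatedness.\<close>

lemma relv_bnd:
  assumes M: "relv S D d G Tau Tau A A' m m'"
    and B: "tvars_below D B" "tvars_below D B'"
    and e: "emf_typing S (star_ty d A # G) e (wp_ty (star_ty (Suc d) B))"
      "emf_typing S (star_ty d A' # G) e' (wp_ty (star_ty (Suc d) B'))"
    and R: "relv S D (Suc (Suc (Suc d)))
      (var_rel (Suc (Suc d)) A A' # star_ty (Suc d) A' # star_ty d A # G) Tau Tau B B'
      (elift 0 (elift 0 e)) (elift 0 (elift (Suc 0) e'))"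
  shows "relv S D d G Tau Tau B B' (EBnd (star_ty d A) (star_ty d B) m e)
    (EBnd (star_ty d A') (star_ty d B') m' e')"
proof (rule relv_wp_intro[OF relvD(1)[OF M] B])
  note G = relvD(1)[OF M] and A = relvD(2,3)[OF M] and m = relvD(4,5)[OF M, unfolded star_comp_ty_simps]
  note tA = is_type_star_ty[OF G A(1)] is_type_star_ty[OF G A(2)]
  note tB = is_type_star_ty[OF G B(1)] is_type_star_ty[OF G B(2)]
  show "emf_typing S G (EBnd (star_ty d A) (star_ty d B) m e) (wp_ty (star_ty d B))"
    "emf_typing S G (EBnd (star_ty d A') (star_ty d B') m' e') (wp_ty (star_ty d B'))"
    using et_EBnd[OF tA(1) tB(1) m(1)] et_EBnd[OF tA(2) tB(2) m(2)] e by simp_all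
  let ?d = "Suc (Suc (Suc d))"
  let ?G = "conts (Suc (Suc d)) B B' (EVar 1) (EVar 0) # EPred (star_ty (Suc d) B') # EPred (star_ty d B) # G"
  let ?up = "\<lambda>t. elift 0 (elift 0 (elift 0 t))" and ?up1 = "\<lambda>t. elift 1 (elift 1 (elift 1 t))"
  note G3 = conts_ctx[OF G B]
  note M3 = G3(5)[OF M]
  note m3 = relvD(4,5)[OF M3, unfolded star_comp_ty_simps]
  note tA3 = is_type_star_ty[OF G3(1) A(1)] is_type_star_ty[OF G3(1) A(2)]
  note tB3 = is_type_star_ty[OF G3(1) B(1)] is_type_star_ty[OF G3(1) B(2)]
  \<comment> \<open>The shift past p, p' and the hypothesis that they are related.\<close>
  define s where "s = (\<lambda>i. Suc (Suc (Suc i)))"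
  have s: "renames s G ?G" "tren D s d ?d"
    using renames_comp[OF renames_comp[OF renames_Suc renames_Suc] renames_Suc]
    by (auto simp: s_def comp_def tren_def)
  have up: "?up t = ren s t" "?up1 t = ren (upr s) t" for t :: "('b, 'k) etm"
  proof -
    have "upr s = upr Suc \<circ> upr Suc \<circ> upr Suc"
      by (auto simp: s_def fun_eq_iff upr_def split: nat.split)
    then show "?up t = ren s t" "?up1 t = ren (upr s) t"
      by (simp_all add: elift0_ren elift1_ren ren_ren s_def comp_def)
  qed
  have e3: "emf_typing S (star_ty ?d A # ?G) (?up1 e) (wp_ty (elift 0 (star_ty ?d B)))"
    "emf_typing S (star_ty ?d A' # ?G) (?up1 e') (wp_ty (elift 0 (star_ty ?d B')))"
    unfolding up
    using emf_typing_ren[OF e(1) is_type_wf_Cons[OF tA3(1)], of "upr s"]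
      emf_typing_ren[OF e(2) is_type_wf_Cons[OF tA3(2)], of "upr s"]
      renames_upr[OF s(1), of "star_ty d A"] renames_upr[OF s(1), of "star_ty d A'"]
    by (simp_all add: ren_star_ty[OF A(1) s(2)] ren_star_ty[OF A(2) s(2)]
        ren_star_ty[OF B(1) tren_upr[OF s(2)]] ren_star_ty[OF B(2) tren_upr[OF s(2)]])
  let ?k = "ELam (star_ty ?d A) (EApp (?up1 e) (elift 0 (EVar 2)))"
  let ?k' = "ELam (star_ty ?d A') (EApp (?up1 e') (elift 0 (EVar 1)))"
  note k = et_bnd_cont[OF tA3(1) tB3(1) e3(1) G3(3)]
  note k' = et_bnd_cont[OF tA3(2) tB3(2) e3(2) G3(4)]
  have "emf_valid S ?G (conts ?d A A' ?k ?k')"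
  proof (rule conts_intro[OF G3(1) A k(1) k'(1)])
    let ?G1 = "star_ty ?d A # ?G" and ?G2 = "star_ty (Suc ?d) A' # star_ty ?d A # ?G"
    let ?G3 = "var_rel (Suc (Suc ?d)) A A' # ?G2"
    note H1 = tctx_star_Cons[OF G3(1) A(1)] and H2 = star_pair_ctx(1)[OF G3(1) A]
      and H3 = var_rel_ctx[OF G3(1) A]
    \<comment> \<open>p and p' are variables 2 and 1 of \<open>?G\<close>; after x, y and their
      hypothesis they are variables 5 and 4.\<close>
    have x: "eqv S ?G3 (EType 0) (EApp (elift 0 (elift 0 (elift 0 ?k))) (EVar 2))
      (EApp (elift 0 (elift 0 (?up1 e))) (EVar 5))"
    proof -
      have "eqv S ?G1 (EType 0) (EApp (elift 0 ?k) (EVar 0)) (EApp (?up1 e) (elift 0 (EVar 2)))"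
        using eqv_lam_var[OF tA3(1), of "EType 0" "EApp (?up1 e) (elift 0 (EVar 2))"] k(2) is_type_EType[OF tctx_wf[OF H1]]
        by simp
      from eqv_elift0[OF eqv_elift0[OF this tctx_wf[OF H2]] tctx_wf[OF H3(1)]]
      show ?thesis by (simp add: eval_nat_numeral)
    qed
    have y: "eqv S ?G3 (EType 0) (EApp (elift 0 (elift 0 (elift 0 ?k'))) (EVar 1))
      (EApp (elift 0 (elift 1 (?up1 e'))) (EVar 4))"
    proof -
      note t1 = is_type_star_ty[OF H1 A(2)]
      have "emf_typing S ?G2 (elift 1 (EApp (?up1 e') (elift 0 (EVar 1)))) (EType 0)"
        using emf_typing_elift1[OF k'(2) tA3(2) tctx_wf[OF H1]] by simp
      then have "eqv S ?G2 (EType 0) (EApp (elift 0 (elift 0 ?k')) (EVar 0))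
         (elift 1 (EApp (?up1 e') (elift 0 (EVar 1))))"
        using eqv_lam_var[OF t1, of "EType 0" "elift 1 (EApp (?up1 e') (elift 0 (EVar 1)))"] is_type_EType[OF tctx_wf[OF H2]]
        by simp
      from eqv_elift0[OF this tctx_wf[OF H3(1)]] show ?thesis by (simp add: eval_nat_numeral)
    qed
    \<comment> \<open>\<open>R\<close> speaks of a context without p and p'; the shift
      \<open>s\<close>, taken under x, y and their hypothesis, carries it to
      \<open>?G3\<close>.\<close>
    have "relv S D (Suc (Suc (Suc ?d))) ?G3 Tau Tau B B'
      (ren (upr (upr (upr s))) (elift 0 (elift 0 e))) (ren (upr (upr (upr s))) (elift 0 (elift (Suc 0) e')))"
    proof (rule relv_ren[OF R H3(1)])
      have "renames (upr (upr (upr s))) (var_rel (Suc (Suc d)) A A' # star_ty (Suc d) A' # star_ty d A # G)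
        (ren (upr (upr s)) (var_rel (Suc (Suc d)) A A') # ren (upr s) (star_ty (Suc d) A') #
         ren s (star_ty d A) # ?G)"
        using s(1) by (intro renames_upr)
      then show "renames (upr (upr (upr s))) (var_rel (Suc (Suc d)) A A' # star_ty (Suc d) A' # star_ty d A # G) ?G3"
        by (simp add: ren_star_ty[OF A(1) s(2)] ren_star_ty[OF A(2) tren_upr[OF s(2)]]
            ren_rel[OF A tren_upr[OF tren_upr[OF s(2)]]])
    qed (use s(2) in \<open>intro tren_upr\<close>)
    then have RR: "relv S D (Suc (Suc (Suc ?d))) ?G3 Tau Tau B B'
      (elift 0 (elift 0 (?up1 e))) (elift 0 (elift 1 (?up1 e')))"
      by (simp add: ren_upr_elift0 ren_upr_upr_elift1 flip: up(2)[of e] up(2)[of e'])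
    have c: "emf_valid S ?G3 (conts (Suc (Suc (Suc ?d))) B B' (EVar 5) (EVar 4))"
      using emf_valid_elift0[OF emf_valid_elift0[OF emf_valid_elift0[OF G3(2) tctx_wf[OF H1]] tctx_wf[OF H2]]
         tctx_wf[OF H3(1)]] by (simp add: elift0_conts[OF B] eval_nat_numeral)
    have p: "emf_typing S ?G3 (EVar 5) (EPred (star_ty (Suc (Suc (Suc ?d))) B))"
      "emf_typing S ?G3 (EVar 4) (EPred (star_ty (Suc (Suc (Suc ?d))) B'))"
      using emf_typing_elift0[OF emf_typing_elift0[OF emf_typing_elift0[OF G3(3) tctx_wf[OF H1]] tctx_wf[OF H2]]
         tctx_wf[OF H3(1)]] emf_typing_elift0[OF emf_typing_elift0[OF emf_typing_elift0[OF G3(4) tctx_wf[OF H1]] tctx_wf[OF H2]]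
         tctx_wf[OF H3(1)]] by (simp_all add: eval_nat_numeral)
    show "emf_valid S ?G3 (EEq (EType 0) (EApp (elift 0 (elift 0 (elift 0 ?k))) (EVar 2))
         (EApp (elift 0 (elift 0 (elift 0 ?k'))) (EVar 1)))"
      using eqvD(4)[OF eqv_trans[OF x eqv_trans[OF relv_wp_elim[OF RR c p] eqv_sym[OF y]]]] .
  qed
  note mid = relv_wp_elim[OF M3 this k(1) k'(1)]
  note b1 = eqv_bnd_app[OF tA3(1) tB3(1) m3(1) e3(1) G3(3)]
  note b2 = eqv_bnd_app[OF tA3(2) tB3(2) m3(2) e3(2) G3(4)]
  show "emf_valid S ?G (EEq (EType 0) (EApp (?up (EBnd (star_ty d A) (star_ty d B) m e)) (EVar 2))
     (EApp (?up (EBnd (star_ty d A') (star_ty d B') m' e')) (EVar 1)))"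
    using eqvD(4)[OF eqv_trans[OF b1 eqv_trans[OF mid eqv_sym[OF b2]]]] by simp
qed

section \<open>Translated terms\<close>

lemma star_return_eq:
  "ELam (EFun (star_ty k A) (EType 0)) (EApp (EVar 0) (elift 0 t)) = ERet (star_ty k A) t"
  by (simp add: ERet_def EPred_def)

lemma star_bind_eq:
  "ELam (EFun (star_ty k A') (EType 0)) (EApp (elift 0 t1)
     (ELam (star_ty (Suc k) A) (EApp (elift (Suc 0) t2) (EVar (Suc 0))))) =
   EBnd (star_ty k A) (star_ty k A') t1 t2"
  by (simp add: EBnd_def EPred_def)

lemmas dm_star_intros = dm_star.intros[unfolded star_return_eq star_bind_eq]
lemmas ds_return' = ds_return[unfolded star_return_eq]
lemmas ds_bind' = ds_bind[unfolded star_bind_eq]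
lemmas dm_star_induct = dm_star.induct[unfolded star_return_eq star_bind_eq, consumes 1,
  case_names var con lam app pair fst snd inl inr case_of return bind]
lemmas dm_star_cases = dm_star.cases[unfolded star_return_eq star_bind_eq, consumes 1, constraints 5,
  case_names var con lam app pair fst snd inl inr case_of return bind]

section \<open>Well-formedness, weakening and substitution for translations\<close>

lemma is_H_DArr: "is_H D (DArr e H H') \<Longrightarrow> is_H D H \<and> is_H D H'"
  by (cases e) (auto simp: is_H_def)

lemma is_H_DProd: "is_H D (DProd H H') \<Longrightarrow> is_H D H \<and> is_H D H'"
  by (auto simp: is_H_def)

lemma is_H_DSum: "is_H D (DSum H H') \<Longrightarrow> is_H D H \<and> is_H D H'"
  by (auto simp: is_H_def)

lemma dm_star_wf: "dm_star S D G e H eps t \<Longrightarrow> dctx_wf D G \<and> is_H D H"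
proof (induction rule: dm_star_induct)
  case (con G c bs b es ts)
  then show ?case by (auto simp: is_H_def)
qed (auto simp: dctx_wf_def dest: is_H_DArr is_H_DProd, auto simp: is_H_def)

lemma dm_star_tvars_below:
  "dm_star S D G e H eps t \<Longrightarrow> (\<forall>U \<in> set G. tvars_below D U) \<and> tvars_below D H"
  using dm_star_wf by (fastforce simp: dctx_wf_def intro: is_H_tvars_below)

text \<open>Weakening acts on a given derivation, so it yields one particular translation, the
  lifted one, and not merely some translation.\<close>

lemma dm_star_elift:
  assumes "dm_star S D (G2 @ G) e K eps t" "is_H D U"
  shows "dm_star S D (G2 @ U # G) (dlift (length G2) e) K eps (elift (length G2) t)"
  using assms(1)
proof (induction "G2 @ G" e K eps t arbitrary: G2 rule: dm_star_induct)
  case (var i H)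
  then show ?case using assms(2) by (auto simp: nth_append dctx_wf_def intro!: ds_var)
next
  case (con c bs b es ts)
  then show ?case using assms(2) by (auto simp: dctx_wf_def intro!: ds_con)
next
  case (lam eps H H' e t)
  then show ?case using lam(3)[of "H # G2"] by (auto dest: ds_lam)
next
  case (case_of e A A' t e1 H eps t1 e2 t2)
  then show ?case using ds_case[OF case_of(2) case_of(4)[of "A # G2", simplified] case_of(6)[of "A' # G2", simplified]] by simp
next
  case (bind A A' e1 t1 e2 t2)
  then show ?case using ds_bind'[OF bind(1,2) bind(4) bind(6)[of "A # G2", simplified]] by simp
next
  case (return A e t)
  then show ?case using ds_return'[OF return(1) return(3)] by simp
qed (auto intro: dm_star_intros)

lemma dm_star_elift0:
  "\<lbrakk> dm_star S D G e K eps t; is_H D U \<rbrakk> \<Longrightarrow> dm_star S D (U # G) (dlift 0 e) K eps (elift 0 t)"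
  using dm_star_elift[of S D "[]"] by simp

text \<open>The translation obtained for the substituted term is exactly the contractum of the
  target reduction; this settles beta and the two case rules.\<close>

lemma dm_star_esubst:
  assumes "dm_star S D (G2 @ H # G) e K eps t" "dm_star S D (G2 @ G) u H NonEff v"
  shows "dm_star S D (G2 @ G) (dsubst (length G2) u e) K eps (esubst (length G2) v t)"
  using assms
proof (induction "G2 @ H # G" e K eps t arbitrary: G2 u v rule: dm_star_induct)
  case (var i H')
  then show ?case by (auto simp: nth_append nth_Cons' dctx_wf_def intro!: ds_var)
next
  case (con c bs b es ts)
  then show ?case by (auto simp: dctx_wf_def intro!: ds_con)
next
  case (lam eps H1 H2 e t)
  then have "dm_star S D ((H1 # G2) @ G) (dlift 0 u) H NonEff (elift 0 v)"
    by (auto intro: dm_star_elift0 dest: is_H_DArr)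
  from lam(3)[OF _ this] lam(1) show ?case by (auto dest: ds_lam)
next
  case (case_of e A A' t e1 K eps t1 e2 t2)
  have "is_H D A" "is_H D A'" using is_H_DSum dm_star_wf[OF case_of(1)] by blast+
  then have *: "dm_star S D (A # G2 @ G) (dlift 0 u) H NonEff (elift 0 v)"
    "dm_star S D (A' # G2 @ G) (dlift 0 u) H NonEff (elift 0 v)"
    using case_of by (auto intro: dm_star_elift0)
  then show ?case
    using ds_case[OF case_of(2)[OF case_of(7)] case_of(4)[of "A # G2", simplified, OF *(1)] case_of(6)[of "A' # G2", simplified, OF *(2)]]
    using case_of by simp
next
  case (bind A A' e1 t1 e2 t2)
  have "is_H D A" using bind by (simp add: is_H_def)
  then have *: "dm_star S D (A # G2 @ G) (dlift 0 u) H NonEff (elift 0 v)"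
    using bind by (auto intro: dm_star_elift0)
  then show ?case using ds_bind'[OF bind(1,2) bind(4)[OF bind(7)] bind(6)[of "A # G2", simplified, OF *]] by simp
next
  case (return A e t)
  then show ?case using ds_return'[OF return(1) return(3)[OF return(4)]] by simp
next
  case (app f eps H1 H2 t e t')
  then show ?case by (simp add: ds_app[OF app(2) app(4)])
qed (auto intro: dm_star_intros)

section \<open>Typing of translations\<close>

primrec star_ctx :: "nat \<Rightarrow> 'b dctx \<Rightarrow> ('b, 'k) ectx" where
  "star_ctx D [] = star_tctx D"
| "star_ctx D (H # G) = star_ty (length G) H # star_ctx D G"

lemma tctx_star_tctx: "tctx S D 0 (star_tctx D)"
proof -
  have "emf_wf S (replicate D (EType 0))"
    by (induction D) (auto intro: ew_nil ew_cons et_type)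
  then show ?thesis by (simp add: tctx_def star_tctx_def)
qed

lemma tctx_star_ctx: "\<forall>U \<in> set G. tvars_below D U \<Longrightarrow> tctx S D (length G) (star_ctx D G)"
  by (induction G) (auto intro: tctx_star_tctx tctx_star_Cons)

lemma star_ctx_nth:
  "i < length G \<Longrightarrow> (elift 0 ^^ Suc i) (star_ctx D G ! i) = star_ty (length G) (G ! i)"
proof (induction G arbitrary: i)
  case (Cons H G)
  then show ?case by (cases i) auto
qed simp

lemma dm_star_typing:
  "dm_star S D G e H eps t \<Longrightarrow> emf_typing S (star_ctx D G) t (star_comp_ty (length G) H eps)"
proof (induction rule: dm_star_induct)
  case (var G i H)
  then have "tctx S D (length G) (star_ctx D G)"
    by (auto simp: dctx_wf_def intro: tctx_star_ctx is_H_tvars_below)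
  then show ?case
    using et_var[of S "star_ctx D G" i] var
    by (auto simp: tctx_def star_ctx_nth simp del: funpow.simps)
next
  case (con G c bs b es ts)
  then have "tctx S D (length G) (star_ctx D G)"
    by (auto simp: dctx_wf_def intro: tctx_star_ctx is_H_tvars_below)
  then show ?case using con by (auto simp: tctx_def intro: et_con)
next
  case (lam eps H H' G e t)
  have "tctx S D (length G) (star_ctx D G)" "tvars_below D H"
    using dm_star_tvars_below[OF lam(2)] by (auto intro: tctx_star_ctx)
  from is_type_star_ty[OF this] lam(3) show ?case
    by (auto simp: star_ty_DArr simp del: star_ty.simps intro: et_lam_fun)
next
  case (app G f eps H H' t e u)
  then show ?case
    by (auto simp: star_ty_DArr simp del: star_ty.simps intro: et_app_fun)
next
  case (inl A A' G e t)
  have "tctx S D (length G) (star_ctx D G)"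
    using dm_star_tvars_below[OF inl(2)] by (auto intro: tctx_star_ctx)
  from is_type_star_ty[OF this, of A'] inl show ?case by (auto intro: et_inl' is_A_tvars_below)
next
  case (inr A A' G e t)
  have "tctx S D (length G) (star_ctx D G)"
    using dm_star_tvars_below[OF inr(2)] by (auto intro: tctx_star_ctx)
  from is_type_star_ty[OF this, of A] inr show ?case by (auto intro: et_inr' is_A_tvars_below)
next
  case (case_of G e A A' t e1 H eps t1 e2 t2)
  have G: "tctx S D (length G) (star_ctx D G)" and tv: "tvars_below D A" "tvars_below D A'" "tvars_below D H"
    using dm_star_tvars_below[OF case_of(1)] dm_star_tvars_below[OF case_of(2)] by (auto intro: tctx_star_ctx)
  from case_of show ?case
    using is_type_star_ty[OF G tv(1)] is_type_star_ty[OF G tv(2)] is_type_star_comp_ty[OF G tv(3)]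
    by (auto intro: et_case_const)
next
  case (return A G e t)
  have G: "tctx S D (length G) (star_ctx D G)" and tv: "tvars_below D A"
    using dm_star_tvars_below[OF return(2)] by (auto intro: tctx_star_ctx)
  then show ?case using return is_type_star_ty[OF G tv] by (auto intro: et_ERet)
next
  case (bind A A' G e1 t1 e2 t2)
  have G: "tctx S D (length G) (star_ctx D G)" and tv: "tvars_below D A" "tvars_below D A'"
    using dm_star_tvars_below[OF bind(3)] dm_star_tvars_below[OF bind(4)] by (auto intro: tctx_star_ctx)
  then show ?case using bind is_type_star_ty[OF G tv(1)] is_type_star_ty[OF G tv(2)]
    by (auto intro: et_EBnd)
qed (auto intro: et_pair et_fst et_snd)

section \<open>Coherence of the translation\<close>

text \<open>Below a \<open>bind\<close>, two derivations of one term may have different contexts.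
  Each translated context is mapped by its own renaming into a common context \<open>E\<close>,
  which may hold further entries.\<close>

definition star_morph ::
  "('b, 'k) signature \<Rightarrow> nat \<Rightarrow> (nat \<Rightarrow> nat) \<Rightarrow> 'b dctx \<Rightarrow> nat \<Rightarrow> ('b, 'k) ectx \<Rightarrow> bool" where
  "star_morph S D r G d E \<longleftrightarrow> tctx S D d E \<and> renames r (star_ctx D G) E \<and> tren D r (length G) d"

lemma ren_star_morph:
  assumes "star_morph S D r G d E" "tvars_below D H"
  shows "ren r (star_ty (length G) H) = star_ty d H"
  using assms ren_star_ty by (auto simp: star_morph_def)

lemma star_morph_Cons:
  assumes "star_morph S D r G d E" "tvars_below D H"
  shows "star_morph S D (upr r) (H # G) (Suc d) (star_ty d H # E)"
  using assms renames_upr[of r "star_ctx D G" E "star_ty (length G) H"]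
  by (auto simp: star_morph_def ren_star_ty[of D] intro: tctx_star_Cons tren_upr)

lemma star_morph_Suc:
  assumes "star_morph S D r G d E" "tctx S D (Suc d) (u # E)"
  shows "star_morph S D (Suc \<circ> r) G (Suc d) (u # E)"
  using assms renames_comp[OF _ renames_Suc] tren_comp[OF _ tren_Suc]
  unfolding star_morph_def by blast

lemma dm_star_ren_typing:
  assumes "dm_star S D G e H eps t" "star_morph S D r G d E"
  shows "emf_typing S E (ren r t) (star_comp_ty d H eps)"
  using emf_typing_ren[OF dm_star_typing[OF assms(1)], of E r] assms(2)
    dm_star_tvars_below[OF assms(1)]
  by (auto simp: star_morph_def ren_star_comp_ty[of D _ r "length G" d] tctx_wf)

text \<open>This plays the part of related closing substitutions in a fundamental lemma. Renamings
  suffice, because the relatedness of two variables can be assumed inside \<open>E\<close> as a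
  hypothesis.\<close>

definition related_ctx where
  "related_ctx S D d E r1 r2 G1 G2 \<longleftrightarrow> length G1 = length G2 \<and>
     (\<forall>i < length G1. relv S D d E NonEff NonEff (G1 ! i) (G2 ! i) (EVar (r1 i)) (EVar (r2 i)))"

lemma related_ctx_Suc:
  assumes "related_ctx S D d E r1 r2 G1 G2" "tctx S D (Suc d) (u # E)"
  shows "related_ctx S D (Suc d) (u # E) (Suc \<circ> r1) (Suc \<circ> r2) G1 G2"
  using assms relv_elift0[OF _ assms(2)] by (fastforce simp: related_ctx_def)

lemma related_ctx_Cons:
  assumes "related_ctx S D d E (r1 \<circ> Suc) (r2 \<circ> Suc) G1 G2"
    "relv S D d E NonEff NonEff H1 H2 (EVar (r1 0)) (EVar (r2 0))"
  shows "related_ctx S D d E r1 r2 (H1 # G1) (H2 # G2)"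
  using assms by (auto simp: related_ctx_def nth_Cons split: nat.split)

lemma upr_comp_Suc: "upr r \<circ> Suc = Suc \<circ> r"
  by (simp add: fun_eq_iff)

lemma related_ctx_upr:
  assumes "related_ctx S D d E r1 r2 G1 G2" "tctx S D d E" "tvars_below D H"
  shows "related_ctx S D (Suc d) (star_ty d H # E) (upr r1) (upr r2) (H # G1) (H # G2)"
proof (rule related_ctx_Cons)
  note E1 = tctx_star_Cons[OF assms(2,3)]
  show "related_ctx S D (Suc d) (star_ty d H # E) (upr r1 \<circ> Suc) (upr r2 \<circ> Suc) G1 G2"
    unfolding upr_comp_Suc using related_ctx_Suc[OF assms(1) E1] .
  show "relv S D (Suc d) (star_ty d H # E) NonEff NonEff H H (EVar (upr r1 0)) (EVar (upr r2 0))"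
    using relv_iff_eqv[OF E1 assms(3)] eqv_refl[OF is_type_star_ty[OF E1 assms(3)]]
      et_var0[OF is_type_star_ty[OF assms(2,3)]] by simp
qed

text \<open>\<open>E\<close> is extended by x, y and the hypothesis relating them. The first
  renaming binds x and then skips two entries; the second skips x, binds y and skips the
  hypothesis.\<close>

lemma related_ctx_bind:
  assumes rel: "related_ctx S D d E r1 r2 G1 G2" and m: "star_morph S D r1 G1 d E" "star_morph S D r2 G2 d E"
    and A: "tvars_below D A" "tvars_below D A'"
  defines "E3 \<equiv> var_rel (Suc (Suc d)) A A' # star_ty (Suc d) A' # star_ty d A # E"
  shows "star_morph S D (Suc \<circ> (Suc \<circ> upr r1)) (A # G1) (Suc (Suc (Suc d))) E3"
    "star_morph S D (Suc \<circ> upr (Suc \<circ> r2)) (A' # G2) (Suc (Suc (Suc d))) E3"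
    "related_ctx S D (Suc (Suc (Suc d))) E3 (Suc \<circ> (Suc \<circ> upr r1)) (Suc \<circ> upr (Suc \<circ> r2))
       (A # G1) (A' # G2)"
proof -
  have E: "tctx S D d E" using m(1) by (simp add: star_morph_def)
  note E1 = tctx_star_Cons[OF E A(1)] and E2 = star_pair_ctx(1)[OF E A]
    and E3 = var_rel_ctx[OF E A, folded E3_def]
  show "star_morph S D (Suc \<circ> (Suc \<circ> upr r1)) (A # G1) (Suc (Suc (Suc d))) E3"
    using star_morph_Suc[OF star_morph_Suc[OF star_morph_Cons[OF m(1) A(1)] E2]] E3(1)
    by (simp add: E3_def)
  show "star_morph S D (Suc \<circ> upr (Suc \<circ> r2)) (A' # G2) (Suc (Suc (Suc d))) E3"
    using star_morph_Suc[OF star_morph_Cons[OF star_morph_Suc[OF m(2) E1] A(2)]] E3(1)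
    by (simp add: E3_def)
  show "related_ctx S D (Suc (Suc (Suc d))) E3 (Suc \<circ> (Suc \<circ> upr r1)) (Suc \<circ> upr (Suc \<circ> r2))
       (A # G1) (A' # G2)"
  proof (rule related_ctx_Cons)
    show "related_ctx S D (Suc (Suc (Suc d))) E3 (Suc \<circ> (Suc \<circ> upr r1) \<circ> Suc)
        (Suc \<circ> upr (Suc \<circ> r2) \<circ> Suc) G1 G2"
      using related_ctx_Suc[OF related_ctx_Suc[OF related_ctx_Suc[OF rel E1] E2]] E3(1)
      by (simp add: E3_def comp_def)
    show "relv S D (Suc (Suc (Suc d))) E3 NonEff NonEff A A'
        (EVar ((Suc \<circ> (Suc \<circ> upr r1)) 0)) (EVar ((Suc \<circ> upr (Suc \<circ> r2)) 0))"
      using E3(2) by (simp add: numeral_2_eq_2)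
  qed
qed

text \<open>The fundamental lemma, by induction on the first derivation with inversion of the
  second: the term fixes the last rule of both, while contexts, types and effects may
  differ.\<close>

lemma dm_star_related:
  assumes "dm_star S D G1 e H1 eps1 u1" "dm_star S D G2 e H2 eps2 u2"
    "star_morph S D r1 G1 d E" "star_morph S D r2 G2 d E" "related_ctx S D d E r1 r2 G1 G2"
  shows "relv S D d E eps1 eps2 H1 H2 (ren r1 u1) (ren r2 u2)"
  using assms
proof (induction arbitrary: G2 H2 eps2 u2 r1 r2 d E rule: dm_star_induct)
  case (var G i H)
  from var(4) show ?case by (cases rule: dm_star_cases) (use var in \<open>auto simp: related_ctx_def\<close>)
next
  case (con G c bs b es ts)
  note IH = con(5) and prems = con(1-4) con(7-9)
  from con(6) show ?case
  proof (cases rule: dm_star_cases)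
  case (con bs' b' ts')
    have E: "tctx S D d E" using prems by (simp add: star_morph_def)
    \<comment> \<open>The signature fixes the base types, so at the arguments of a constant the
      relation is equality.\<close>
    have eq: "bs' = bs" "b' = b" using con prems by auto
    have "eqv S E (EBase (bs ! i)) (map (ren r1) ts ! i) (map (ren r2) ts' ! i)" if "i < length bs" for i
    proof -
      have "relv S D d E NonEff NonEff (DBase (bs ! i)) (DBase (bs ! i)) (ren r1 (ts ! i)) (ren r2 (ts' ! i))"
        using IH prems con eq that by auto
      from relv_eqv[OF this] show ?thesis using that prems con eq by simp
    qed
    then have "eqv S E (EBase b) (ECon c (map (ren r1) ts)) (ECon c (map (ren r2) ts'))"
      using prems con eq tctx_wf[OF E] by (intro eqv_con) auto
    then show ?thesis using relv_iff_eqv[OF E, of "DBase b" NonEff] con eq by simp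
  qed
next
  case (lam eps H H' G e t)
  note IH = lam(3) and prems = lam(1,2) lam(5-7)
  from lam(4) show ?case
  proof (cases rule: dm_star_cases)
    case (lam eps' K' t')
    have E: "tctx S D d E" and tv: "tvars_below D H"
      using prems by (auto simp: star_morph_def dest: is_H_tvars_below)
    have "relv S D (Suc d) (star_ty d H # E) eps eps' H' K' (ren (upr r1) t) (ren (upr r2) t')"
      using IH lam star_morph_Cons[OF _ tv] related_ctx_upr[OF _ E tv] prems by blast
    from relv_lam[OF E tv this] show ?thesis
      using lam by (simp add: ren_star_morph[OF prems(3) tv] ren_star_morph[OF prems(4) tv])
  qed
next
  case (app G f eps H H' t e u)
  note IH = app(3,4) and prems = app(6-8)
  from app(5) show ?case
    by (cases rule: dm_star_cases) (use IH prems relv_app in fastforce)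
next
  case (pair H H' G e t e' t')
  note IH = pair(4,5) and prems = pair(7-9)
  from pair(6) show ?case
    by (cases rule: dm_star_cases) (use IH prems relv_pair in fastforce)
next
  case (fst G e H H' t)
  note IH = fst(2) and prems = fst(4-6)
  from fst(3) show ?case
    by (cases rule: dm_star_cases) (use IH prems relv_fst in fastforce)
next
  case (snd G e H H' t)
  note IH = snd(2) and prems = snd(4-6)
  from snd(3) show ?case
    by (cases rule: dm_star_cases) (use IH prems relv_snd in fastforce)
next
  case (inl A A' G e t)
  note IH = inl(3) and prems = inl(1) inl(5-7)
  from inl(4) show ?case
  proof (cases rule: dm_star_cases)
    case (inl B B' t')
    have "tvars_below D A'" "tvars_below D B'" using prems(1) inl by (auto dest: is_A_tvars_below)
    moreover have "relv S D d E NonEff NonEff A B (ren r1 t) (ren r2 t')"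
      using IH prems inl by blast
    ultimately show ?thesis using relv_inl inl by simp
  qed
next
  case (inr A A' G e t)
  note IH = inr(3) and prems = inr(1) inr(5-7)
  from inr(4) show ?case
  proof (cases rule: dm_star_cases)
    case (inr B B' t')
    have "tvars_below D A" "tvars_below D B" using prems(1) inr by (auto dest: is_A_tvars_below)
    moreover have "relv S D d E NonEff NonEff A' B' (ren r1 t) (ren r2 t')"
      using IH prems inr by blast
    ultimately show ?thesis using relv_inr inr by simp
  qed
next
  case (case_of G e A A' t e1 H eps t1 e2 t2)
  note IH = case_of(4-6) and prems = case_of(1) case_of(8-10)
  from case_of(7) show ?case
  proof (cases rule: dm_star_cases)
    case (case_of t' t1' t2')
    have E: "tctx S D d E" and tv: "tvars_below D A" "tvars_below D A'"
      using prems dm_star_tvars_below[OF prems(1)] by (auto simp: star_morph_def)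
    have 1: "relv S D (Suc d) (star_ty d A # E) eps eps2 H H2 (ren (upr r1) t1) (ren (upr r2) t1')"
      using IH(2) case_of star_morph_Cons[OF _ tv(1)] related_ctx_upr[OF _ E tv(1)] prems by blast
    have 2: "relv S D (Suc d) (star_ty d A' # E) eps eps2 H H2 (ren (upr r1) t2) (ren (upr r2) t2')"
      using IH(3) case_of star_morph_Cons[OF _ tv(2)] related_ctx_upr[OF _ E tv(2)] prems by blast
    have "relv S D d E NonEff NonEff (DSum A A') (DSum A A') (ren r1 t) (ren r2 t')"
      using IH(1) case_of prems by blast
    from relv_case[OF this 1 2] show ?thesis
      using case_of by (simp add: ren_star_morph[OF prems(2)] ren_star_morph[OF prems(3)] tv)
  qed
next
  case (return A G e t)
  note IH = return(3) and prems = return(1) return(5-7)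
  from return(4) show ?case
  proof (cases rule: dm_star_cases)
    case (return t')
    have tv: "tvars_below D A" "tvars_below D H2" using prems(1) return by (auto dest: is_A_tvars_below)
    have "relv S D d E NonEff NonEff A H2 (ren r1 t) (ren r2 t')" using IH return prems by blast
    from relv_ret[OF this] show ?thesis
      using return by (simp add: ren_star_morph[OF prems(2)] ren_star_morph[OF prems(3)] tv)
  qed
next
  case (bind A A' G e1 t1 e2 t2)
  note IH = bind(5,6) and prems = bind(1-4) bind(8-10)
  from bind(7) show ?case
  proof (cases rule: dm_star_cases)
    case (bind B t1' t2')
    have tv: "tvars_below D A" "tvars_below D A'" "tvars_below D B" "tvars_below D H2"
      using prems(1,2) bind by (auto dest: is_A_tvars_below)
    have M: "relv S D d E Tau Tau A B (ren r1 t1) (ren r2 t1')" using IH(1) bind prems by blast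
    note m = related_ctx_bind[OF prems(7,5,6) tv(1,3)]
    \<comment> \<open>The bodies are compared in the context with both bound variables, where their
      relatedness may be assumed even if \<open>A\<close> and \<open>B\<close> differ.\<close>
    have "relv S D (Suc (Suc (Suc d))) (var_rel (Suc (Suc d)) A B # star_ty (Suc d) B # star_ty d A # E)
        Tau Tau A' H2 (ren (Suc \<circ> (Suc \<circ> upr r1)) t2) (ren (Suc \<circ> upr (Suc \<circ> r2)) t2')"
      using IH(2)[OF _ m] bind by blast
    then have "relv S D (Suc (Suc (Suc d))) (var_rel (Suc (Suc d)) A B # star_ty (Suc d) B # star_ty d A # E)
        Tau Tau A' H2 (elift 0 (elift 0 (ren (upr r1) t2))) (elift 0 (elift (Suc 0) (ren (upr r2) t2')))"
      by (simp only: elift0_ren elift1_ren ren_ren upr_comp)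
    moreover have "emf_typing S (star_ty d A # E) (ren (upr r1) t2) (wp_ty (star_ty (Suc d) A'))"
      using dm_star_ren_typing[OF prems(4) star_morph_Cons[OF prems(5) tv(1)]] by simp
    moreover have "emf_typing S (star_ty d B # E) (ren (upr r2) t2') (wp_ty (star_ty (Suc d) H2))"
      using dm_star_ren_typing[OF _ star_morph_Cons[OF prems(6) tv(3)]] bind by fastforce
    ultimately show ?thesis
      using relv_bnd[OF M tv(2,4)] bind
      by (simp add: ren_star_morph[OF prems(5)] ren_star_morph[OF prems(6)] tv)
  qed
qed

text \<open>Both renamings are the identity, and a variable is related to itself because it has the
  same type on both sides.\<close>

corollary dm_star_coherent:
  assumes "dm_star S D G e H eps t" "dm_star S D G e H eps t'"
  shows "eqv S (star_ctx D G) (star_comp_ty (length G) H eps) t t'"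
proof -
  have tv: "\<forall>U \<in> set G. tvars_below D U" using dm_star_tvars_below[OF assms(1)] by blast
  note G = tctx_star_ctx[OF tv]
  have m: "star_morph S D (\<lambda>i. i) G (length G) (star_ctx D G)"
    using G by (simp add: star_morph_def renames_def tren_def)
  have "related_ctx S D (length G) (star_ctx D G) (\<lambda>i. i) (\<lambda>i. i) G G"
    unfolding related_ctx_def
  proof (intro conjI allI impI refl)
    fix i assume i: "i < length G"
    then have U: "tvars_below D (G ! i)" and "dm_star S D G (DVar i) (G ! i) NonEff (EVar i)"
      using tv dm_star_wf[OF assms(1)] by (auto intro: ds_var)
    from dm_star_typing[OF this(2)] show "relv S D (length G) (star_ctx D G) NonEff NonEff
        (G ! i) (G ! i) (EVar i) (EVar i)"
      using eqv_refl[OF is_type_star_ty[OF G U]] by (simp add: relv_iff_eqv[OF G U])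
  qed
  from relv_eqv[OF dm_star_related[OF assms m m this]] show ?thesis by simp
qed

section \<open>Equal terms have equal translations\<close>

text \<open>One pair of equal translations suffices in the induction over equality derivations;
  coherence extends the equation to all pairs.\<close>

definition star_eq ::
  "('b, 'k) signature \<Rightarrow> nat \<Rightarrow> 'b dctx \<Rightarrow> ('b, 'k) dtm \<Rightarrow> ('b, 'k) dtm \<Rightarrow> 'b dty \<Rightarrow> eff \<Rightarrow> bool" where
  "star_eq S D G e e' H eps \<longleftrightarrow> (\<exists>t t'. dm_star S D G e H eps t \<and> dm_star S D G e' H eps t' \<and>
     eqv S (star_ctx D G) (star_comp_ty (length G) H eps) t t')"

lemma star_eqI:
  "\<lbrakk> dm_star S D G e H eps t; dm_star S D G e' H eps t';
     eqv S (star_ctx D G) (star_comp_ty (length G) H eps) t t' \<rbrakk> \<Longrightarrow> star_eq S D G e e' H eps"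
  by (auto simp: star_eq_def)

lemma is_type_star_ctx:
  assumes "dm_star S D G e H eps t"
  shows "tctx S D (length G) (star_ctx D G)" "is_type S (star_ctx D G) (star_ty (length G) H)"
    "is_type S (star_ctx D G) (star_comp_ty (length G) H eps)"
  using dm_star_tvars_below[OF assms] tctx_star_ctx is_type_star_ty is_type_star_comp_ty by blast+

lemma is_type_star_ctx':
  "\<lbrakk> dm_star S D G e H eps t; tvars_below D A \<rbrakk> \<Longrightarrow> is_type S (star_ctx D G) (star_ty (length G) A)"
  using is_type_star_ctx(1) is_type_star_ty by blast

lemma star_eq_refl: "dm_star S D G e H eps t \<Longrightarrow> star_eq S D G e e H eps"
  by (blast intro: star_eqI dm_star_coherent)

lemma dm_eq_star_eq: "dm_eq S D G e e' H eps \<Longrightarrow> star_eq S D G e e' H eps"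
proof (induction rule: dm_eq.induct)
  case (de_refl G e H eps)
  then show ?case using dm_typing_iff_star star_eq_refl by blast
next
  case (de_sym G e e' H eps)
  then show ?case by (auto simp: star_eq_def intro: eqv_sym)
next
  case (de_trans G e e' H eps e'')
  then obtain t1 t2 t3 t4 where "dm_star S D G e H eps t1" "dm_star S D G e' H eps t2"
    "dm_star S D G e' H eps t3" "dm_star S D G e'' H eps t4"
    "eqv S (star_ctx D G) (star_comp_ty (length G) H eps) t1 t2"
    "eqv S (star_ctx D G) (star_comp_ty (length G) H eps) t3 t4"
    by (auto simp: star_eq_def)
  \<comment> \<open>The two hypotheses may translate \<open>e'\<close> differently, as
    \<open>t2\<close> and \<open>t3\<close>; coherence joins them.\<close>
  then show ?case by (meson dm_star_coherent eqv_trans star_eqI)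
next
  case (de_con G c bs b es es')
  then obtain f f' where f: "\<And>i. i < length bs \<Longrightarrow>
      dm_star S D G (es ! i) (DBase (bs ! i)) NonEff (f i) \<and>
      dm_star S D G (es' ! i) (DBase (bs ! i)) NonEff (f' i) \<and>
      eqv S (star_ctx D G) (EBase (bs ! i)) (f i) (f' i)"
    unfolding star_eq_def by (simp) metis
  let ?ts = "map f [0..<length bs]" and ?ts' = "map f' [0..<length bs]"
  have "emf_wf S (star_ctx D G)"
    using de_con(1) by (auto simp: dctx_wf_def intro!: tctx_wf tctx_star_ctx is_H_tvars_below)
  then have "eqv S (star_ctx D G) (EBase b) (ECon c ?ts) (ECon c ?ts')"
    using f de_con by (intro eqv_con) auto
  then show ?case
    using de_con f by (intro star_eqI[OF ds_con[of D G S c bs b es ?ts] ds_con[of D G S c bs b es' ?ts']]) auto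
next
  case (de_lam eps H H' G e e')
  then obtain t t' where t: "dm_star S D (H # G) e H' eps t" "dm_star S D (H # G) e' H' eps t'"
    "eqv S (star_ctx D (H # G)) (star_comp_ty (length (H # G)) H' eps) t t'" by (auto simp: star_eq_def)
  note s = ds_lam[OF de_lam(1) t(1)] ds_lam[OF de_lam(1) t(2)]
  have "tvars_below D H" "tvars_below D H'" and G: "tctx S D (length G) (star_ctx D G)"
    using dm_star_tvars_below[OF s(1)] is_type_star_ctx(1)[OF s(1)] by auto
  then have "eqv S (star_ctx D G) (EFun (star_ty (length G) H) (star_comp_ty (length G) H' eps))
     (ELam (star_ty (length G) H) t) (ELam (star_ty (length G) H) t')"
    using t(3) by (intro eqv_lam is_type_star_ty[OF G] is_type_star_comp_ty[OF G]) auto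
  then show ?case by (intro star_eqI[OF s]) (simp add: star_ty_DArr del: star_ty.simps)
next
  case (de_app G f f' eps H H' e e')
  then obtain t t' u u' where t: "dm_star S D G f (DArr eps H H') NonEff t"
    "dm_star S D G f' (DArr eps H H') NonEff t'"
    "eqv S (star_ctx D G) (star_ty (length G) (DArr eps H H')) t t'"
    and u: "dm_star S D G e H NonEff u" "dm_star S D G e' H NonEff u'"
    "eqv S (star_ctx D G) (star_ty (length G) H) u u'" by (auto simp: star_eq_def simp del: star_ty.simps)
  note s = ds_app[OF t(1) u(1)] ds_app[OF t(2) u(2)]
  show ?case
    using eqv_app[OF t(3)[unfolded star_ty_DArr] u(3) is_type_star_ctx(3)[OF s(1)]]
    by (rule star_eqI[OF s])
next
  case (de_pair H H' G e1 e1' e2 e2')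
  then obtain t t' u u' where t: "dm_star S D G e1 H NonEff t" "dm_star S D G e1' H NonEff t'"
      "eqv S (star_ctx D G) (star_ty (length G) H) t t'"
    and u: "dm_star S D G e2 H' NonEff u" "dm_star S D G e2' H' NonEff u'"
      "eqv S (star_ctx D G) (star_ty (length G) H') u u'" by (auto simp: star_eq_def)
  show ?case
    using eqv_pair[OF t(3) u(3)]
    by (intro star_eqI[OF ds_pair[OF de_pair(1) t(1) u(1)] ds_pair[OF de_pair(1) t(2) u(2)]]) simp
next
  case (de_fst G e e' H H')
  then obtain t t' where t: "dm_star S D G e (DProd H H') NonEff t" "dm_star S D G e' (DProd H H') NonEff t'"
    "eqv S (star_ctx D G) (star_ty (length G) (DProd H H')) t t'" by (auto simp: star_eq_def)
  note s = ds_fst[OF t(1)] ds_fst[OF t(2)]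
  show ?case using eqv_fst[OF _ is_type_star_ctx(2)[OF s(1)]] t(3) by (intro star_eqI[OF s]) simp
next
  case (de_snd G e e' H H')
  then obtain t t' where t: "dm_star S D G e (DProd H H') NonEff t" "dm_star S D G e' (DProd H H') NonEff t'"
    "eqv S (star_ctx D G) (star_ty (length G) (DProd H H')) t t'" by (auto simp: star_eq_def)
  note s = ds_snd[OF t(1)] ds_snd[OF t(2)]
  show ?case using eqv_snd[OF _ is_type_star_ctx(2)[OF s(1)]] t(3) by (intro star_eqI[OF s]) simp
next
  case (de_inl A A' G e e')
  then obtain t t' where t: "dm_star S D G e A NonEff t" "dm_star S D G e' A NonEff t'"
    "eqv S (star_ctx D G) (star_ty (length G) A) t t'" by (auto simp: star_eq_def)
  note s = ds_inl[OF de_inl(1) t(1)] ds_inl[OF de_inl(1) t(2)]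
  have "is_type S (star_ctx D G) (star_ty (length G) A')"
    using is_type_star_ctx'[OF s(1)] de_inl(1) by (auto intro: is_A_tvars_below)
  then show ?case using eqv_inl[OF t(3)] by (intro star_eqI[OF s]) simp
next
  case (de_inr A A' G e e')
  then obtain t t' where t: "dm_star S D G e A' NonEff t" "dm_star S D G e' A' NonEff t'"
    "eqv S (star_ctx D G) (star_ty (length G) A') t t'" by (auto simp: star_eq_def)
  note s = ds_inr[OF de_inr(1) t(1)] ds_inr[OF de_inr(1) t(2)]
  have "is_type S (star_ctx D G) (star_ty (length G) A)"
    using is_type_star_ctx'[OF s(1)] de_inr(1) by (auto intro: is_A_tvars_below)
  then show ?case using eqv_inr[OF t(3)] by (intro star_eqI[OF s]) simp
next
  case (de_case G e e' A A' e1 e1' H eps e2 e2')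
  then obtain t t' t1 t1' t2 t2' where t: "dm_star S D G e (DSum A A') NonEff t"
      "dm_star S D G e' (DSum A A') NonEff t'"
      "eqv S (star_ctx D G) (star_ty (length G) (DSum A A')) t t'"
    and t1: "dm_star S D (A # G) e1 H eps t1" "dm_star S D (A # G) e1' H eps t1'"
      "eqv S (star_ctx D (A # G)) (star_comp_ty (length (A # G)) H eps) t1 t1'"
    and t2: "dm_star S D (A' # G) e2 H eps t2" "dm_star S D (A' # G) e2' H eps t2'"
      "eqv S (star_ctx D (A' # G)) (star_comp_ty (length (A' # G)) H eps) t2 t2'"
    unfolding star_eq_def by auto
  note s = ds_case[OF t(1) t1(1) t2(1)] ds_case[OF t(2) t1(2) t2(2)]
  have tv: "tvars_below D A" "tvars_below D A'" using dm_star_tvars_below[OF t(1)] by auto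
  show ?case
    using eqv_case[OF _ is_type_star_ctx'[OF t(1) tv(1)] is_type_star_ctx'[OF t(1) tv(2)]
      is_type_star_ctx(3)[OF s(1)]] t(3) t1(3) t2(3) by (intro star_eqI[OF s]) simp
next
  case (de_return A G e e')
  then obtain t t' where t: "dm_star S D G e A NonEff t" "dm_star S D G e' A NonEff t'"
    "eqv S (star_ctx D G) (star_ty (length G) A) t t'" by (auto simp: star_eq_def)
  show ?case
    using eqv_ERet[OF t(3)]
    by (intro star_eqI[OF ds_return'[OF de_return(1) t(1)] ds_return'[OF de_return(1) t(2)]]) simp
next
  case (de_bind A A' G e1 e1' e2 e2')
  then obtain t1 t1' t2 t2' where t1: "dm_star S D G e1 A Tau t1" "dm_star S D G e1' A Tau t1'"
      "eqv S (star_ctx D G) (wp_ty (star_ty (length G) A)) t1 t1'"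
    and t2: "dm_star S D (A # G) e2 A' Tau t2" "dm_star S D (A # G) e2' A' Tau t2'"
      "eqv S (star_ctx D (A # G)) (wp_ty (star_ty (length (A # G)) A')) t2 t2'"
    unfolding star_eq_def by auto
  note s = ds_bind'[OF de_bind(1,2) t1(1) t2(1)] ds_bind'[OF de_bind(1,2) t1(2) t2(2)]
  show ?case
    using eqv_EBnd[OF t1(3) _ is_type_star_ctx(2)[OF t1(1)] is_type_star_ctx(2)[OF s(1)]] t2(3)
    by (intro star_eqI[OF s]) simp
next
  case (de_beta eps H H' G e1 e2)
  then obtain t1 t2 where t: "dm_star S D (H # G) e1 H' eps t1" "dm_star S D G e2 H NonEff t2"
    using dm_typing_iff_star by blast
  have s: "dm_star S D G (DApp (DLam H e1) e2) H' eps (EApp (ELam (star_ty (length G) H) t1) t2)"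
    "dm_star S D G (dsubst 0 e2 e1) H' eps (esubst 0 t2 t1)"
    using ds_app[OF ds_lam[OF de_beta(1) t(1)] t(2)] dm_star_esubst[of S D "[]", simplified, OF t] by auto
  show ?case
    using eqv_beta[OF is_type_star_ctx(2)[OF t(2)] is_type_star_ctx(3)[OF s(2)], of t1 t2]
      dm_star_typing[OF t(1)] dm_star_typing[OF t(2)] dm_star_typing[OF s(2)]
    by (intro star_eqI[OF s]) simp
next
  case (de_eta G e eps H H')
  then obtain t where t: "dm_star S D G e (DArr eps H H') NonEff t" using dm_typing_iff_star by blast
  have wf: "dctx_wf D G" "is_H D (DArr eps H H')" "is_H D H" using dm_star_wf[OF t] is_H_DArr by auto
  then have "dm_star S D (H # G) (DVar 0) H NonEff (EVar 0)"
    by (intro ds_var) (auto simp: dctx_wf_def)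
  from ds_lam[OF wf(2) ds_app[OF dm_star_elift0[OF t wf(3)] this]]
  have s: "dm_star S D G (DLam H (DApp (dlift 0 e) (DVar 0))) (DArr eps H H') NonEff
      (ELam (star_ty (length G) H) (EApp (elift 0 t) (EVar 0)))" .
  have "tvars_below D H" "tvars_below D H'" and G: "tctx S D (length G) (star_ctx D G)"
    using dm_star_tvars_below[OF t] is_type_star_ctx(1)[OF t] by auto
  from eqv_eta[OF _ is_type_star_ty[OF G this(1)] is_type_star_comp_ty[OF G this(2)]]
  show ?case using dm_star_typing[OF t]
    by (intro star_eqI[OF s t]) (simp add: star_ty_DArr del: star_ty.simps)
next
  case (de_fst_pair H H' G e1 e2)
  then obtain t1 t2 where t: "dm_star S D G e1 H NonEff t1" "dm_star S D G e2 H' NonEff t2"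
    using dm_typing_iff_star by blast
  show ?case
    using eqv_fst_pair[OF dm_star_typing[OF t(1)] dm_star_typing[OF t(2)]] is_type_star_ctx(2)[OF t(1)]
    by (intro star_eqI[OF ds_fst[OF ds_pair[OF de_fst_pair(1) t]] t(1)]) simp
next
  case (de_snd_pair H H' G e1 e2)
  then obtain t1 t2 where t: "dm_star S D G e1 H NonEff t1" "dm_star S D G e2 H' NonEff t2"
    using dm_typing_iff_star by blast
  show ?case
    using eqv_snd_pair[OF dm_star_typing[OF t(1)] dm_star_typing[OF t(2)]] is_type_star_ctx(2)[OF t(2)]
    by (intro star_eqI[OF ds_snd[OF ds_pair[OF de_snd_pair(1) t]] t(2)]) simp
next
  case (de_surj_pair G e H H')
  then obtain t where t: "dm_star S D G e (DProd H H') NonEff t" using dm_typing_iff_star by blast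
  have s: "dm_star S D G (DPair (DFst e) (DSnd e)) (DProd H H') NonEff (EPair (EFst t) (ESnd t))"
    using dm_star_wf[OF t] t by (blast intro: ds_pair ds_fst ds_snd)
  show ?case
    using ev_surj_pair[of S "star_ctx D G" t] dm_star_typing[OF t] dm_star_typing[OF s] is_type_star_ctx(2)[OF t]
    by (intro star_eqI[OF s t]) (simp add: eqv_def)
next
  case (de_case_inl A A' G e e1 H eps e2)
  then obtain t t1 t2 where t: "dm_star S D G e A NonEff t" "dm_star S D (A # G) e1 H eps t1"
     "dm_star S D (A' # G) e2 H eps t2" using dm_typing_iff_star by metis
  note s = ds_case[OF ds_inl[OF de_case_inl(1) t(1)] t(2,3)]
  have s': "dm_star S D G (dsubst 0 e e1) H eps (esubst 0 t t1)"
    using dm_star_esubst[of S D "[]", simplified, OF t(2,1)] .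
  have tv: "tvars_below D A" "tvars_below D A'" using de_case_inl(1) by (auto intro: is_A_tvars_below)
  show ?case
    using eqv_case_inl[OF _ is_type_star_ctx'[OF s tv(1)] is_type_star_ctx'[OF s tv(2)] is_type_star_ctx(3)[OF s],
        of t t1 t2] dm_star_typing[OF t(1)] dm_star_typing[OF t(2)] dm_star_typing[OF t(3)] dm_star_typing[OF s']
    by (intro star_eqI[OF s s']) simp
next
  case (de_case_inr A A' G e e1 H eps e2)
  then obtain t t1 t2 where t: "dm_star S D G e A' NonEff t" "dm_star S D (A # G) e1 H eps t1"
     "dm_star S D (A' # G) e2 H eps t2" using dm_typing_iff_star by metis
  note s = ds_case[OF ds_inr[OF de_case_inr(1) t(1)] t(2,3)]
  have s': "dm_star S D G (dsubst 0 e e2) H eps (esubst 0 t t2)"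
    using dm_star_esubst[of S D "[]", simplified, OF t(3,1)] .
  have tv: "tvars_below D A" "tvars_below D A'" using de_case_inr(1) by (auto intro: is_A_tvars_below)
  show ?case
    using eqv_case_inr[OF _ is_type_star_ctx'[OF s tv(1)] is_type_star_ctx'[OF s tv(2)] is_type_star_ctx(3)[OF s],
        of t t1 t2] dm_star_typing[OF t(1)] dm_star_typing[OF t(2)] dm_star_typing[OF t(3)] dm_star_typing[OF s']
    by (intro star_eqI[OF s s']) simp
next
  case (de_case_eta G e A A')
  then obtain t where t: "dm_star S D G e (DSum A A') NonEff t" using dm_typing_iff_star by blast
  have wf: "dctx_wf D G" "is_A D (DSum A A')" "is_H D A" "is_H D A'"
    using dm_star_wf[OF t] by (auto simp: is_H_def)
  have "dm_star S D (A # G) (DVar 0) A NonEff (EVar 0)" "dm_star S D (A' # G) (DVar 0) A' NonEff (EVar 0)"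
    using wf by (auto intro!: ds_var simp: dctx_wf_def)
  note s = ds_case[OF t ds_inl[OF wf(2) this(1)] ds_inr[OF wf(2) this(2)]]
  have tv: "tvars_below D A" "tvars_below D A'" using wf by (auto intro: is_A_tvars_below)
  show ?case
    using eqv_case_eta[OF _ is_type_star_ctx'[OF t tv(1)] is_type_star_ctx'[OF t tv(2)], of t] dm_star_typing[OF t]
    by (intro star_eqI[OF s t]) simp
next
  case (de_bind_return A G m)
  then obtain t where t: "dm_star S D G m A Tau t" using dm_typing_iff_star by blast
  have "dm_star S D (A # G) (DVar 0) A NonEff (EVar 0)"
    using dm_star_wf[OF t] by (auto intro!: ds_var simp: dctx_wf_def)
  note s = ds_bind'[OF de_bind_return(1,1) t ds_return'[OF de_bind_return(1) this]]
  show ?case using eqv_bnd_ret[OF _ is_type_star_ctx(2)[OF t], of t] dm_star_typing[OF t]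
    by (intro star_eqI[OF s t]) simp
next
  case (de_return_bind A A' G e f)
  then obtain t u where t: "dm_star S D G e A NonEff t" and u: "dm_star S D G f (DArr Tau A A') NonEff u"
    using dm_typing_iff_star by metis
  have A: "is_H D A" and "dm_star S D (A # G) (DVar 0) A NonEff (EVar 0)"
    using dm_star_wf[OF t] by (auto intro!: ds_var simp: dctx_wf_def)
  note s = ds_bind'[OF de_return_bind(1,2) ds_return'[OF de_return_bind(1) t] ds_app[OF dm_star_elift0[OF u A] this(2)]]
  note s' = ds_app[OF u t]
  show ?case
    using eqv_ret_bnd[OF _ _ is_type_star_ctx(2)[OF t] is_type_star_ctx(2)[OF s], of t u]
      dm_star_typing[OF t] dm_star_typing[OF u]
    by (intro star_eqI[OF s s']) simp
next
  case (de_bind_assoc A A' A'' G m e1 e2)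
  then obtain t t1 t2 where t: "dm_star S D G m A Tau t" "dm_star S D (A # G) e1 A' Tau t1"
    "dm_star S D (A' # G) e2 A'' Tau t2" using dm_typing_iff_star by metis
  have "is_H D A" using dm_star_wf[OF t(1)] by blast
  \<comment> \<open>The prefix holds the one binding of y, hence level 1: \<open>e2\<close> is
    weakened by x below its own variable.\<close>
  then have t2: "dm_star S D (A' # A # G) (dlift (Suc 0) e2) A'' Tau (elift (Suc 0) t2)"
    using dm_star_elift[of S D "[A']" G e2] t(3) by simp
  note A = de_bind_assoc(1-3)
  note s = ds_bind'[OF A(2,3) ds_bind'[OF A(1,2) t(1,2)] t(3)]
  note s' = ds_bind'[OF A(1,3) t(1) ds_bind'[OF A(2,3) t(2) t2]]
  have tv: "tvars_below D A'" using A by (auto intro: is_A_tvars_below)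
  show ?case
    using eqv_bnd_assoc[OF _ _ _ is_type_star_ctx(2)[OF t(1)] is_type_star_ctx'[OF t(1) tv] is_type_star_ctx(2)[OF s], of t t1 t2]
      dm_star_typing[OF t(1)] dm_star_typing[OF t(2)] dm_star_typing[OF t(3)]
    by (intro star_eqI[OF s s']) simp
qed

text \<open>The existence clauses exclude a vacuous reading, and the universal clause makes the
  result independent of the derivations along which the two terms are translated.\<close>

theorem theorem9:
  fixes S :: "('b, 'k) signature" and D :: nat
    and e1 e2 :: "('b, 'k) dtm" and H :: "'b dty" and eps :: eff
  assumes "dm_eq S D [] e1 e2 H eps"
  shows "(\<exists>t1. dm_star S D [] e1 H eps t1) \<and> (\<exists>t2. dm_star S D [] e2 H eps t2) \<and>
    (\<forall>t1 t2. dm_star S D [] e1 H eps t1 \<longrightarrow> dm_star S D [] e2 H eps t2 \<longrightarrow>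
       emf_valid S (star_tctx D) (EEq (star_comp_ty 0 H eps) t1 t2))"
proof -
  obtain u1 u2 where u: "dm_star S D [] e1 H eps u1" "dm_star S D [] e2 H eps u2"
    "eqv S (star_tctx D) (star_comp_ty 0 H eps) u1 u2"
    using dm_eq_star_eq[OF assms] by (auto simp: star_eq_def)
  \<comment> \<open>Coherence joins each of the two arbitrary translations to the chosen
    pair.\<close>
  have "eqv S (star_tctx D) (star_comp_ty 0 H eps) t1 t2"
    if "dm_star S D [] e1 H eps t1" "dm_star S D [] e2 H eps t2" for t1 t2
    using dm_star_coherent[OF that(1) u(1)] dm_star_coherent[OF u(2) that(2)] u(3)
    by (auto intro: eqv_trans)
  then show ?thesis using u(1,2) eqvD(4) by blast
qed

end
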